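(* Fix an o-minimal structure and let $\mathrm{CS}(\mathbb{R}^d)$ be the set of constructible sets, i.e. compact definable subsets of $\mathbb{R}^d$. The map $\operatorname{ECT}:\mathrm{CS}(\mathbb{R}^d)\to \mathrm{CF}(S^{d-1}\times\mathbb{R})$ is injective. Equivalently, if $M,M'\in \mathrm{CS}(\mathbb{R}^d)$ satisfy $\operatorname{ECT}(M)(v)=\operatorname{ECT}(M')(v)$ as functions on $\mathbb{R}$ for every $v\in S^{d-1}$, then $M=M'$.
   Context: An o-minimal structure $\mathcal{O}=\{\mathcal{O}_d\}_{d\ge 0}$ here means: for each $d$ a collection $\mathcal{O}_d$ of subsets of $\mathbb{R}^d$ closed under intersection and complement, such that $A\in\mathcal{O}_d$ implies $A\times\mathbb{R},\mathbb{R}\times A\in\mathcal{O}_{d+1}$; $A\in\mathcal{O}_{d+1}$ implies $\pi(A)\in\mathcal{O}_d$ for axis-aligned projections $\pi:\mathbb{R}^{d+1}\to\mathbb{R}^d$; the order, addition and multiplication of $\mathbb{R}$ are in the structure, with real constants allowed (so all semialgebraic sets belong to it); and $\mathcal{O}_1$ consists exactly of the finite unions of points and open intervals. Elements are called definable sets; a map is definable if its graph is. Every definable set $X$ admits a definable bijection with a finite disjoint union of open simplices $\sigma_i$ of a finite Euclidean simplicial complex, and the definable Euler characteristic is $\chi(X)=\sum_i(-1)^{\dim\sigma_i}$ (independent of the choice; $\chi(\varnothing)=0$). $\mathrm{CF}(X)$ denotes the constructible functions on a definable set $X$: functions $X\to\mathbb{Z}$ with definable level sets, only finitely many of them nonempty.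 For $M\in\mathrm{CS}(\mathbb{R}^d)$, the Euler Characteristic Transform is $\operatorname{ECT}(M)(v,t)=\operatorname{ECT}(M)(v)(t)=\chi(M\cap\{x\in\mathbb{R}^d: x\cdot v\le t\})$ for $v\in S^{d-1}$, $t\in\mathbb{R}$; it is a constructible function on $S^{d-1}\times\mathbb{R}$. *)

theory Defs
  imports "HOL-Analysis.Analysis" "HOL-Library.Function_Algebras"
begin

text \<open>
  Since the dimension varies inside the definition of an o-minimal structure, the space
  \<open>\<real>\<^sup>d\<close> is \<^term>\<open>topspace (Euclidean_space d)\<close>: sequences
  \<^typ>\<open>nat \<Rightarrow> real\<close> that vanish from index \<open>d\<close> on, with coordinates
  \<open>0, \<dots>, d - 1\<close>.
  The vector space structure below makes the library's \<^const>\<open>affine_dependent\<close> and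
  \<^const>\<open>hull\<close> available for such sequences.
\<close>

instantiation "fun" :: (type, real_vector) real_vector
begin

definition scaleR_fun :: "real \<Rightarrow> ('a \<Rightarrow> 'b) \<Rightarrow> 'a \<Rightarrow> 'b" where
  "scaleR_fun r f = (\<lambda>x. r *\<^sub>R f x)"

instance
  by standard
    (auto simp: scaleR_fun_def fun_eq_iff scaleR_add_right scaleR_add_left)

end

abbreviation espace :: "nat \<Rightarrow> (nat \<Rightarrow> real) set" where
  "espace d \<equiv> topspace (Euclidean_space d)"

text \<open>\<open>A \<times> \<real>\<close>, \<open>\<real> \<times> A\<close> (for \<open>A \<subseteq> \<real>\<^sup>d\<close>), concatenation of
  \<open>x \<in> \<real>\<^sup>m\<close> with \<open>y \<in> \<real>\<^sup>n\<close>, and the projection \<open>\<real>\<^sup>d\<^sup>+\<^sup>1 \<rightarrow> \<real>\<^sup>d\<close> forgetting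
  coordinate \<open>j\<close>.\<close>

definition times_line :: "nat \<Rightarrow> (nat \<Rightarrow> real) set \<Rightarrow> (nat \<Rightarrow> real) set" where
  "times_line d A = {x(d := t) | x t. x \<in> A}"

definition line_times :: "(nat \<Rightarrow> real) set \<Rightarrow> (nat \<Rightarrow> real) set" where
  "line_times A = {case_nat t x | t x. x \<in> A}"

definition append_pt :: "nat \<Rightarrow> (nat \<Rightarrow> real) \<Rightarrow> (nat \<Rightarrow> real) \<Rightarrow> nat \<Rightarrow> real" where
  "append_pt m x y = (\<lambda>i. if i < m then x i else y (i - m))"

definition drop_coord :: "nat \<Rightarrow> (nat \<Rightarrow> real) \<Rightarrow> nat \<Rightarrow> real" where
  "drop_coord j x = (\<lambda>i. if i < j then x i else x (Suc i))"

text \<open>\<open>D d\<close> is the collection of definable subsets of \<open>\<real>\<^sup>d\<close>. In \<open>one_dim\<close>, the sets that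
  are both \<^const>\<open>open\<close> and \<^const>\<open>is_interval\<close> are the open intervals, bounded or not
  (the empty set included, harmlessly).\<close>

locale o_minimal_structure =
  fixes D :: "nat \<Rightarrow> (nat \<Rightarrow> real) set set"
  assumes subset_space: "A \<in> D d \<Longrightarrow> A \<subseteq> espace d"
    and inter: "A \<in> D d \<Longrightarrow> B \<in> D d \<Longrightarrow> A \<inter> B \<in> D d"
    and complement: "A \<in> D d \<Longrightarrow> espace d - A \<in> D d"
    and times_line: "A \<in> D d \<Longrightarrow> times_line d A \<in> D (Suc d)"
    and line_times: "A \<in> D d \<Longrightarrow> line_times A \<in> D (Suc d)"
    and projection: "A \<in> D (Suc d) \<Longrightarrow> j \<le> d \<Longrightarrow> drop_coord j ` A \<in> D d"
    and order: "{x \<in> espace 2. x 0 < x 1} \<in> D 2"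
    and addition: "{x \<in> espace 3. x 0 + x 1 = x 2} \<in> D 3"
    and multiplication: "{x \<in> espace 3. x 0 * x 1 = x 2} \<in> D 3"
    and one_dim: "D 1 = {{x \<in> espace 1. x 0 \<in> \<Union>F} | F.
          finite F \<and> (\<forall>I\<in>F. (\<exists>a. I = {a}) \<or> (open I \<and> is_interval I))}"

definition definable_map ::
  "(nat \<Rightarrow> (nat \<Rightarrow> real) set set) \<Rightarrow> nat \<Rightarrow> nat \<Rightarrow> (nat \<Rightarrow> real) set \<Rightarrow>
   ((nat \<Rightarrow> real) \<Rightarrow> (nat \<Rightarrow> real)) \<Rightarrow> bool" where
  "definable_map D m n X f \<longleftrightarrow> {append_pt m x (f x) | x. x \<in> X} \<in> D (m + n)"

text \<open>A finite simplicial complex in \<open>\<real>\<^sup>N\<close> is given by the vertex sets of its simplices.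
  Affine independence makes the vertex sets of the faces of \<open>convex hull V\<close> exactly the
  subsets of \<open>V\<close>.\<close>

definition finite_complex :: "nat \<Rightarrow> (nat \<Rightarrow> real) set set \<Rightarrow> bool" where
  "finite_complex N K \<longleftrightarrow> finite K \<and>
     (\<forall>V\<in>K. V \<subseteq> espace N \<and> finite V \<and> V \<noteq> {} \<and> \<not> affine_dependent V) \<and>
     (\<forall>V\<in>K. \<forall>W. W \<subseteq> V \<and> W \<noteq> {} \<longrightarrow> W \<in> K) \<and>
     (\<forall>V\<in>K. \<forall>W\<in>K. convex hull V \<inter> convex hull W = convex hull (V \<inter> W))"

definition open_simplex :: "(nat \<Rightarrow> real) set \<Rightarrow> (nat \<Rightarrow> real) set" where
  "open_simplex V = {\<Sum>v\<in>V. u v *\<^sub>R v | u. (\<forall>v\<in>V. 0 < u v) \<and> sum u V = 1}"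

text \<open>The bijection below need not be continuous. The open simplices of a
  simplicial complex are pairwise disjoint, and the simplex with vertex set \<open>V\<close> has dimension
  \<open>card V - 1\<close>.\<close>

definition has_euler_char ::
  "(nat \<Rightarrow> (nat \<Rightarrow> real) set set) \<Rightarrow> nat \<Rightarrow> (nat \<Rightarrow> real) set \<Rightarrow> int \<Rightarrow> bool" where
  "has_euler_char D d X e \<longleftrightarrow>
     (\<exists>N K L h. finite_complex N K \<and> L \<subseteq> K \<and>
        definable_map D d N X h \<and> bij_betw h X (\<Union>V\<in>L. open_simplex V) \<and>
        e = (\<Sum>V\<in>L. (- 1) ^ (card V - 1)))"

definition euler_char ::
  "(nat \<Rightarrow> (nat \<Rightarrow> real) set set) \<Rightarrow> nat \<Rightarrow> (nat \<Rightarrow> real) set \<Rightarrow> int" where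
  "euler_char D d X = (THE e. has_euler_char D d X e)"

definition constructible_sets ::
  "(nat \<Rightarrow> (nat \<Rightarrow> real) set set) \<Rightarrow> nat \<Rightarrow> (nat \<Rightarrow> real) set set" where
  "constructible_sets D d = {M \<in> D d. compactin (Euclidean_space d) M}"

text \<open>\<open>CF(X)\<close> for \<open>X \<subseteq> \<real>\<^sup>n\<close>. Functions on \<open>X\<close> are total functions that are
  \<^const>\<open>undefined\<close> outside \<open>X\<close>, so that their equality is equality on \<open>X\<close>.\<close>

definition constructible_functions ::
  "(nat \<Rightarrow> (nat \<Rightarrow> real) set set) \<Rightarrow> nat \<Rightarrow> (nat \<Rightarrow> real) set \<Rightarrow> ((nat \<Rightarrow> real) \<Rightarrow> int) set" where
  "constructible_functions D n X =
     {f \<in> extensional X. (\<forall>c. {x \<in> X. f x = c} \<in> D n) \<and>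
        finite {c. {x \<in> X. f x = c} \<noteq> {}}}"

text \<open>\<open>usphere d\<close> is \<open>S\<^sup>d\<^sup>-\<^sup>1\<close>, the unit sphere of \<open>\<real>\<^sup>d\<close>; it is empty for \<open>d = 0\<close>.\<close>

definition usphere :: "nat \<Rightarrow> (nat \<Rightarrow> real) set" where
  "usphere d = {v \<in> espace d. (\<Sum>i<d. (v i)\<^sup>2) = 1}"

lemma usphere_Suc: "usphere (Suc n) = topspace (nsphere n)"
  by (auto simp: usphere_def nsphere_def lessThan_Suc_atMost)

definition ECT ::
  "(nat \<Rightarrow> (nat \<Rightarrow> real) set set) \<Rightarrow> nat \<Rightarrow> (nat \<Rightarrow> real) set \<Rightarrow> (nat \<Rightarrow> real) \<Rightarrow> real \<Rightarrow> int" where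
  "ECT D d M v t = euler_char D d (M \<inter> {x \<in> espace d. (\<Sum>i<d. x i * v i) \<le> t})"

text \<open>The same transform as a single function on \<open>S\<^sup>d\<^sup>-\<^sup>1 \<times> \<real> \<subseteq> \<real>\<^sup>d\<^sup>+\<^sup>1\<close>: the point
  \<open>p\<close> stands for the pair \<open>(v, t)\<close> with \<open>v = p(d := 0)\<close> and \<open>t = p d\<close>.\<close>

definition ECT_fun ::
  "(nat \<Rightarrow> (nat \<Rightarrow> real) set set) \<Rightarrow> nat \<Rightarrow> (nat \<Rightarrow> real) set \<Rightarrow> (nat \<Rightarrow> real) \<Rightarrow> int" where
  "ECT_fun D d M = (\<lambda>p \<in> times_line d (usphere d). ECT D d M (p(d := 0)) (p d))"

end

theory Submission
  imports Defs
begin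

text \<open>
  Integration against the Euler characteristic, \<open>\<integral> F d\<chi>\<close>, is defined for constructible functions of
  one variable by a local formula and for several variables by iteration. Since the structure lives on
  the real field itself, a countable definable set of reals is finite; this gives piecewise continuity of
  definable functions, uniform finiteness, and the interchange of two integrations. The interchange
  makes the iterated integral of an indicator function invariant under definable bijections, so it is
  \<open>\<chi>\<close>. Finally, for fixed \<open>x\<close>, integrating \<open>\<chi>(M \<inter> {y. (y - x) \<bullet> v \<le> 0})\<close> over all \<open>v \<in> \<real>\<^sup>d\<close> and
  interchanging the integrals yields \<open>(-1)\<^sup>d\<close> if \<open>x \<in> M\<close> and \<open>0\<close> otherwise, because a closed
  half-space has Euler characteristic \<open>0\<close>. Hence the transform determines \<open>M\<close>.
\<close>

section \<open>Definable predicates and terms\<close>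

text \<open>\<open>euler_char\<close> is a description over unspecified definable bijections that
  need not be continuous, so existence and uniqueness of the value both have to be proved. The same
  freedom makes existence manageable: the pieces of a decomposition may be moved apart and reshaped
  one by one, so cells suffice in place of a triangulation.

  Over the reals a definable set without interior is finite, and one with interior is uncountable.
  Hence an exceptional set that is first order and a countable union of finite sets is finite, even
  when nothing bounds the sizes of these sets.

  The inversion is of Schapira's type. Integrating over all vectors instead of unit vectors lets one
  coordinate be integrated at a time. The price is paid at the vectors that are not unit: scaling
  treats the nonzero ones, and the zero vector asks for the Euler characteristic of \<open>M\<close>
  itself, which the transform shows at a high level because \<open>M\<close> is bounded.\<close>

lemma espace_iff: "x \<in> espace n \<longleftrightarrow> (\<forall>i\<ge>n. x i = 0)"
  by (simp add: topspace_Euclidean_space)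

definition dep :: "nat \<Rightarrow> ((nat \<Rightarrow> real) \<Rightarrow> 'a) \<Rightarrow> bool" where
  "dep n f \<longleftrightarrow> (\<forall>x y. (\<forall>i<n. x i = y i) \<longrightarrow> f x = f y)"

lemma depD: "dep n f \<Longrightarrow> (\<And>i. i < n \<Longrightarrow> x i = y i) \<Longrightarrow> f x = f y"
  by (auto simp: dep_def)

lemma dep_mono: "dep n f \<Longrightarrow> n \<le> m \<Longrightarrow> dep m f"
  by (auto simp: dep_def)

text \<open>Retraction of all assignments onto \<open>espace n\<close>. It turns membership in a set
  of points, which vanish from index \<open>n\<close> on, into a predicate on arbitrary
  assignments.\<close>

definition trunc :: "nat \<Rightarrow> (nat \<Rightarrow> real) \<Rightarrow> nat \<Rightarrow> real" where
  "trunc n x = (\<lambda>i. if i < n then x i else 0)"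

lemma trunc_espace [simp]: "trunc n x \<in> espace n"
  by (simp add: trunc_def espace_iff)

lemma trunc_id: "x \<in> espace n \<Longrightarrow> trunc n x = x"
  by (auto simp: trunc_def espace_iff fun_eq_iff)

lemma trunc_less [simp]: "i < n \<Longrightarrow> trunc n x i = x i"
  by (simp add: trunc_def)

lemma dep_trunc: "dep n (\<lambda>x. f (trunc n x))"
  by (auto simp: dep_def trunc_def intro!: arg_cong[where f=f])

lemma dep_truncD: "dep n f \<Longrightarrow> f (trunc n x) = f x"
  by (rule depD) auto

text \<open>A section of \<open>drop_coord j\<close> with prescribed coordinate \<open>j\<close>;
  for \<open>j = 0\<close> it is the binding of a de Bruijn variable.\<close>

definition ins_coord :: "nat \<Rightarrow> real \<Rightarrow> (nat \<Rightarrow> real) \<Rightarrow> nat \<Rightarrow> real" where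
  "ins_coord j t x = (\<lambda>i. if i < j then x i else if i = j then t else x (i - 1))"

lemma ins_coord_0: "ins_coord 0 t x = case_nat t x"
  by (auto simp: ins_coord_def fun_eq_iff split: nat.split)

context o_minimal_structure
begin

text \<open>Formulas are modelled semantically: a definable predicate is a predicate on assignments
  \<^typ>\<open>nat \<Rightarrow> real\<close> that depends on finitely many coordinates only, and a quantifier
  binds coordinate \<open>0\<close> while shifting the others, as with de Bruijn indices. Definable terms \<open>dt\<close> are
  given by their graphs, with the value in coordinate \<open>0\<close>.\<close>

definition defp :: "((nat \<Rightarrow> real) \<Rightarrow> bool) \<Rightarrow> bool" where
  "defp P \<longleftrightarrow> (\<exists>n. dep n P \<and> {x \<in> espace n. P x} \<in> D n)"

lemma definable_Suc:
  assumes "dep n P" "{x \<in> espace n. P x} \<in> D n"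
  shows "{x \<in> espace (Suc n). P x} \<in> D (Suc n)"
proof -
  have "{x \<in> espace (Suc n). P x} = times_line n {x \<in> espace n. P x}"
  proof (intro equalityI subsetI)
    fix x assume x: "x \<in> {x \<in> espace (Suc n). P x}"
    then have "P (trunc n x)" using dep_truncD[OF assms(1)] by simp
    moreover have "x = (trunc n x)(n := x n)"
      using x by (auto simp: trunc_def espace_iff fun_eq_iff)
    ultimately show "x \<in> times_line n {x \<in> espace n. P x}"
      unfolding times_line_def by (intro CollectI exI[of _ "trunc n x"] exI[of _ "x n"]) auto
  next
    fix x assume "x \<in> times_line n {x \<in> espace n. P x}"
    then obtain y t where y: "x = y(n := t)" "y \<in> espace n" "P y"
      by (auto simp: times_line_def)
    have "P x = P y" by (rule depD[OF assms(1)]) (simp add: y)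
    with y show "x \<in> {x \<in> espace (Suc n). P x}" by (auto simp: espace_iff)
  qed
  then show ?thesis using times_line[OF assms(2)] by simp
qed

lemma definable_mono:
  assumes "dep n P" "{x \<in> espace n. P x} \<in> D n" "n \<le> m"
  shows "{x \<in> espace m. P x} \<in> D m"
  using assms(3)
proof (induction m rule: dec_induct)
  case base
  then show ?case using assms by simp
next
  case (step k)
  then show ?case using definable_Suc dep_mono[OF assms(1)] by simp
qed

lemma defp_eventually:
  assumes "defp P"
  obtains n where "\<And>m. n \<le> m \<Longrightarrow> dep m P \<and> {x \<in> espace m. P x} \<in> D m"
proof -
  obtain n where "dep n P" "{x \<in> espace n. P x} \<in> D n"
    using assms by (auto simp: defp_def)
  then show thesis using that definable_mono dep_mono by blast
qed

text \<open>The projection axiom read logically: an image under \<open>drop_coord j\<close> is an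
  existential quantifier over coordinate \<open>j\<close>.\<close>

lemma definable_proj:
  assumes "{x \<in> espace (Suc n). P x} \<in> D (Suc n)" "j \<le> n"
  shows "{x \<in> espace n. \<exists>t. P (ins_coord j t x)} \<in> D n"
proof -
  have "{x \<in> espace n. \<exists>t. P (ins_coord j t x)} = drop_coord j ` {x \<in> espace (Suc n). P x}"
  proof (intro equalityI subsetI)
    fix x assume "x \<in> {x \<in> espace n. \<exists>t. P (ins_coord j t x)}"
    then obtain t where t: "x \<in> espace n" "P (ins_coord j t x)" by auto
    have "drop_coord j (ins_coord j t x) = x"
      by (auto simp: drop_coord_def ins_coord_def fun_eq_iff)
    moreover have "ins_coord j t x \<in> espace (Suc n)"
      using t assms by (auto simp: ins_coord_def espace_iff)
    ultimately show "x \<in> drop_coord j ` {x \<in> espace (Suc n). P x}"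
      using t by (intro image_eqI[of _ _ "ins_coord j t x"]) auto
  next
    fix x assume "x \<in> drop_coord j ` {x \<in> espace (Suc n). P x}"
    then obtain y where y: "x = drop_coord j y" "y \<in> espace (Suc n)" "P y" by auto
    have "ins_coord j (y j) x = y"
      using y by (auto simp: drop_coord_def ins_coord_def fun_eq_iff)
    moreover have "x \<in> espace n"
      using y assms by (auto simp: drop_coord_def espace_iff)
    ultimately show "x \<in> {x \<in> espace n. \<exists>t. P (ins_coord j t x)}"
      using y(3) by (intro CollectI conjI exI[of _ "y j"]) simp_all
  qed
  then show ?thesis using projection[OF assms] by simp
qed

lemma defp_ins: "defp P \<Longrightarrow> defp (\<lambda>x. \<exists>t. P (ins_coord j t x))"
proof -
  assume "defp P"
  then obtain n where n: "\<And>m. n \<le> m \<Longrightarrow> dep m P \<and> {x \<in> espace m. P x} \<in> D m"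
    by (rule defp_eventually) blast
  define m where "m = max n j"
  have m: "dep (Suc m) P" "{x \<in> espace (Suc m). P x} \<in> D (Suc m)" "j \<le> m"
    using n[of "Suc m"] by (auto simp: m_def)
  have "dep m (\<lambda>x. \<exists>t. P (ins_coord j t x))"
    unfolding dep_def
  proof (intro allI impI)
    fix x y :: "nat \<Rightarrow> real" assume xy: "\<forall>i<m. x i = y i"
    have "P (ins_coord j t x) = P (ins_coord j t y)" for t
      by (rule depD[OF m(1)]) (use xy m(3) in \<open>auto simp: ins_coord_def\<close>)
    then show "(\<exists>t. P (ins_coord j t x)) = (\<exists>t. P (ins_coord j t y))" by simp
  qed
  with definable_proj[OF m(2,3)] show ?thesis by (auto simp: defp_def)
qed

text \<open>\<open>defp\<close> speaks about some dimension, possibly larger than \<open>n\<close>.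
  The descent projects away the last coordinate; since \<open>P\<close> ignores it, the quantifier
  that \<open>definable_proj\<close> introduces is vacuous.\<close>

lemma definable_of_defp:
  assumes "defp P" "dep n P"
  shows "{x \<in> espace n. P x} \<in> D n"
proof -
  obtain N where N: "\<And>m. N \<le> m \<Longrightarrow> dep m P \<and> {x \<in> espace m. P x} \<in> D m"
    using assms(1) by (rule defp_eventually) blast
  have "{x \<in> espace n. P x} \<in> D n" if "{x \<in> espace m. P x} \<in> D m" "n \<le> m" for m
    using that(2,1)
  proof (induction m rule: dec_induct)
    case (step k)
    have "P (ins_coord k t x) = P x" for t x
      by (rule depD[OF assms(2)]) (use step in \<open>auto simp: ins_coord_def\<close>)
    then show ?case using definable_proj[OF step(4), of k] step(3) by simp
  qed
  then show ?thesis using N[of "max n N"] by (meson max.cobounded1 max.cobounded2)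
qed

lemma defp_not: "defp P \<Longrightarrow> defp (\<lambda>x. \<not> P x)"
proof -
  assume "defp P"
  then obtain n where n: "dep n P" "{x \<in> espace n. P x} \<in> D n" by (auto simp: defp_def)
  have "{x \<in> espace n. \<not> P x} = espace n - {x \<in> espace n. P x}" by auto
  moreover have "dep n (\<lambda>x. \<not> P x)" using n(1) by (simp add: dep_def)
  ultimately show ?thesis using complement[OF n(2)] unfolding defp_def by (intro exI[of _ n]) simp
qed

lemma defp_conj: "defp P \<Longrightarrow> defp Q \<Longrightarrow> defp (\<lambda>x. P x \<and> Q x)"
proof -
  assume P: "defp P" and Q: "defp Q"
  obtain n where n: "\<And>m. n \<le> m \<Longrightarrow> dep m P \<and> {x \<in> espace m. P x} \<in> D m"
    using P by (rule defp_eventually) blast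
  obtain k where k: "\<And>m. k \<le> m \<Longrightarrow> dep m Q \<and> {x \<in> espace m. Q x} \<in> D m"
    using Q by (rule defp_eventually) blast
  define m where "m = max n k"
  have "{x \<in> espace m. P x \<and> Q x} = {x \<in> espace m. P x} \<inter> {x \<in> espace m. Q x}" by auto
  then have "{x \<in> espace m. P x \<and> Q x} \<in> D m"
    using n[of m] k[of m] inter by (simp add: m_def)
  moreover have "dep m (\<lambda>x. P x \<and> Q x)"
    using n[of m] k[of m] by (auto simp: m_def dep_def)
  ultimately show ?thesis by (auto simp: defp_def)
qed

lemma defp_disj: "defp P \<Longrightarrow> defp Q \<Longrightarrow> defp (\<lambda>x. P x \<or> Q x)"
  using defp_not[OF defp_conj[OF defp_not defp_not, of P Q]] by simp

lemma defp_imp: "defp P \<Longrightarrow> defp Q \<Longrightarrow> defp (\<lambda>x. P x \<longrightarrow> Q x)"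
  using defp_not[OF defp_conj[OF _ defp_not, of P Q]] by simp

lemma defp_iff: "defp P \<Longrightarrow> defp Q \<Longrightarrow> defp (\<lambda>x. P x \<longleftrightarrow> Q x)"
  using defp_conj[OF defp_imp[of P Q] defp_imp[of Q P]] by (simp add: iff_conv_conj_imp)

lemma defp_unary:
  assumes "finite F" "\<And>I. I \<in> F \<Longrightarrow> (\<exists>a. I = {a}) \<or> (open I \<and> is_interval I)"
  shows "defp (\<lambda>x. x 0 \<in> \<Union>F)"
proof -
  have "{x \<in> espace 1. x 0 \<in> \<Union>F} \<in> D 1"
    unfolding one_dim using assms by blast
  moreover have "dep 1 (\<lambda>x. x 0 \<in> \<Union>F)" by (auto simp: dep_def)
  ultimately show ?thesis unfolding defp_def by blast
qed

lemma defp_const: "defp (\<lambda>x. b)"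
proof -
  have "defp (\<lambda>x. True)" using defp_unary[of "{UNIV}"] by simp
  then show ?thesis using defp_not by (cases b) fastforce+
qed

lemma defp_eq_const_0: "defp (\<lambda>x. x 0 = c)"
  using defp_unary[of "{{c}}"] by simp

lemma defp_shift1: "defp P \<Longrightarrow> defp (\<lambda>x. P (\<lambda>i. x (Suc i)))"
proof -
  assume "defp P"
  then obtain n where n: "dep n P" "{x \<in> espace n. P x} \<in> D n" by (auto simp: defp_def)
  have "{x \<in> espace (Suc n). P (\<lambda>i. x (Suc i))} = line_times {x \<in> espace n. P x}"
  proof (intro equalityI subsetI)
    fix x assume x: "x \<in> {x \<in> espace (Suc n). P (\<lambda>i. x (Suc i))}"
    have "x = case_nat (x 0) (\<lambda>i. x (Suc i))" by (auto simp: fun_eq_iff split: nat.split)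
    moreover have "(\<lambda>i. x (Suc i)) \<in> {x \<in> espace n. P x}" using x by (auto simp: espace_iff)
    ultimately show "x \<in> line_times {x \<in> espace n. P x}"
      unfolding line_times_def by blast
  next
    fix x assume "x \<in> line_times {x \<in> espace n. P x}"
    then obtain t y where "x = case_nat t y" "y \<in> espace n" "P y"
      by (auto simp: line_times_def)
    then show "x \<in> {x \<in> espace (Suc n). P (\<lambda>i. x (Suc i))}"
      by (auto simp: espace_iff split: nat.split)
  qed
  moreover have "dep (Suc n) (\<lambda>x. P (\<lambda>i. x (Suc i)))"
    unfolding dep_def by (intro allI impI depD[OF n(1)]) simp
  ultimately show ?thesis using line_times[OF n(2)] unfolding defp_def
    by (intro exI[of _ "Suc n"]) simp
qed

lemma defp_shift: "defp P \<Longrightarrow> defp (\<lambda>x. P (\<lambda>i. x (i + k)))"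
proof (induction k)
  case (Suc k)
  from defp_shift1[OF Suc.IH[OF Suc.prems]] show ?case by simp
qed simp

lemma defp_less_01: "defp (\<lambda>x. x 0 < x 1)"
  unfolding defp_def using order by (intro exI[of _ 2]) (auto simp: dep_def)

lemma defp_add_012: "defp (\<lambda>x. x 0 + x 1 = x 2)"
  unfolding defp_def using addition by (intro exI[of _ 3]) (auto simp: dep_def)

lemma defp_mult_012: "defp (\<lambda>x. x 0 * x 1 = x 2)"
  unfolding defp_def using multiplication by (intro exI[of _ 3]) (auto simp: dep_def)

text \<open>The axioms provide no permutation of coordinates. Equality of two distant coordinates comes
  from \<open>c = a + b\<close>, \<open>d = c - b\<close>, which forces \<open>d = a\<close> while \<open>b\<close> stays free.\<close>

lemma defp_neg_01: "defp (\<lambda>x. x 1 = - x 0)"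
proof -
  from defp_ins[OF defp_conj[OF defp_add_012 defp_shift[OF defp_eq_const_0, of 2 0]], of 2]
  show ?thesis
    by (simp add: ins_coord_def algebra_simps add_eq_0_iff)
qed

lemma defp_diff_012: "defp (\<lambda>x. x 2 = x 0 - x 1)"
proof -
  have "defp (\<lambda>x. \<exists>t. ins_coord 1 t x 1 = - ins_coord 1 t x 0
     \<and> ins_coord 1 t x (0 + 1) + ins_coord 1 t x (1 + 1) = ins_coord 1 t x (2 + 1))"
    by (rule defp_ins[OF defp_conj[OF defp_neg_01 defp_shift[OF defp_add_012, of 1]]])
  then have A: "defp (\<lambda>x. x 2 = x 1 - x 0)"
    by (simp add: ins_coord_def algebra_simps eq_commute numeral_2_eq_2)
  have "defp (\<lambda>x. \<exists>t. ins_coord 2 t x 2 = ins_coord 2 t x 1 - ins_coord 2 t x 0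
     \<and> ins_coord 2 t x (1 + 2) = - ins_coord 2 t x (0 + 2))"
    by (rule defp_ins[OF defp_conj[OF A defp_shift[OF defp_neg_01, of 2]]])
  then show ?thesis by (simp add: ins_coord_def numeral_2_eq_2)
qed

lemma defp_eq_02: "defp (\<lambda>x. x 2 = x 0)"
proof -
  \<comment> \<open>The shifted difference reads \<open>b - c\<close>, hence \<open>- a\<close>; a
    second elimination restores the sign.\<close>
  have "defp (\<lambda>x. \<exists>t. ins_coord 2 t x 0 + ins_coord 2 t x 1 = ins_coord 2 t x 2
     \<and> ins_coord 2 t x (2 + 1) = ins_coord 2 t x (0 + 1) - ins_coord 2 t x (1 + 1))"
    by (rule defp_ins[OF defp_conj[OF defp_add_012 defp_shift[OF defp_diff_012, of 1]]])
  then have A: "defp (\<lambda>x. x 2 = - x 0)"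
    by (simp add: ins_coord_def)
  have "defp (\<lambda>x. \<exists>t. ins_coord 2 t x 2 = - ins_coord 2 t x 0
     \<and> ins_coord 2 t x (1 + 2) = - ins_coord 2 t x (0 + 2))"
    by (rule defp_ins[OF defp_conj[OF A defp_shift[OF defp_neg_01, of 2]]])
  then show ?thesis by (simp add: ins_coord_def numeral_2_eq_2)
qed

text \<open>Distance 1 is reached by negating twice through an inserted coordinate. For larger
  distances a copy of coordinate 0 is inserted at position \<open>Suc k\<close>, and equality at
  distance 2 leads from there to the old coordinate \<open>k + 2\<close>, which the insertion has
  moved up by one.\<close>

lemma defp_eq_0_Suc: "defp (\<lambda>x. x (Suc k) = x 0)"
proof (induction k)
  case 0
  have "defp (\<lambda>x. \<exists>t. ins_coord 1 t x 1 = - ins_coord 1 t x 0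
     \<and> ins_coord 1 t x (1 + 1) = - ins_coord 1 t x (0 + 1))"
    by (rule defp_ins[OF defp_conj[OF defp_neg_01 defp_shift[OF defp_neg_01, of 1]]])
  then show ?case by (simp add: ins_coord_def)
next
  case (Suc k)
  have "defp (\<lambda>x. \<exists>t. ins_coord (Suc k) t x (Suc k) = ins_coord (Suc k) t x 0
     \<and> ins_coord (Suc k) t x (2 + Suc k) = ins_coord (Suc k) t x (0 + Suc k))"
    by (rule defp_ins[OF defp_conj[OF Suc.IH defp_shift[OF defp_eq_02, of "Suc k"]]])
  then show ?case by (simp add: ins_coord_def)
qed

lemma defp_eq_var: "defp (\<lambda>x. x i = x j)"
proof -
  have *: "defp (\<lambda>x. x j = x i)" if "i < j" for i j
    using defp_shift[OF defp_eq_0_Suc, of "j - i - 1" i] that by simp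
  show ?thesis
    using *[of i j] *[of j i] defp_const[of True] by (cases i j rule: linorder_cases) (auto simp: eq_commute)
qed

section \<open>Quantifier blocks, substitution and definable terms\<close>

lemma defp_ex_block:
  "defp P \<Longrightarrow> defp (\<lambda>x. \<exists>y. P (\<lambda>i. if i < n then y i else x (i - n)))"
proof (induction n arbitrary: P)
  case (Suc n)
  have 1: "defp (\<lambda>x. \<exists>y. \<exists>t. P (ins_coord 0 t (\<lambda>i. if i < n then y i else x (i - n))))"
    by (rule Suc.IH[OF defp_ins[OF Suc.prems]])
  have "(\<exists>y t. P (ins_coord 0 t (\<lambda>i. if i < n then y i else x (i - n)))) =
     (\<exists>y. P (\<lambda>i. if i < Suc n then y i else x (i - Suc n)))" for x :: "nat \<Rightarrow> real"
  proof safe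
    fix y t assume *: "P (ins_coord 0 t (\<lambda>i. if i < n then y i else x (i - n)))"
    have "ins_coord 0 t (\<lambda>i. if i < n then y i else x (i - n)) =
       (\<lambda>i. if i < Suc n then case_nat t y i else x (i - Suc n))"
      by (auto simp: ins_coord_def fun_eq_iff split: nat.split)
    with * show "\<exists>y. P (\<lambda>i. if i < Suc n then y i else x (i - Suc n))"
      by (intro exI[of _ "case_nat t y"]) simp
  next
    fix y assume *: "P (\<lambda>i. if i < Suc n then y i else x (i - Suc n))"
    have "ins_coord 0 (y 0) (\<lambda>i. if i < n then y (Suc i) else x (i - n)) =
       (\<lambda>i. if i < Suc n then y i else x (i - Suc n))"
      by (auto simp: ins_coord_def fun_eq_iff)
    with * show "\<exists>y t. P (ins_coord 0 t (\<lambda>i. if i < n then y i else x (i - n)))"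
      by (intro exI[of _ "\<lambda>i. y (Suc i)"] exI[of _ "y 0"]) simp
  qed
  with 1 show ?case by simp
qed simp

lemma defp_ball_finite: "finite I \<Longrightarrow> (\<And>i. i \<in> I \<Longrightarrow> defp (P i)) \<Longrightarrow> defp (\<lambda>x. \<forall>i\<in>I. P i x)"
  by (induction I rule: finite_induct) (auto intro: defp_const defp_conj)

lemma defp_bex_finite: "finite I \<Longrightarrow> (\<And>i. i \<in> I \<Longrightarrow> defp (P i)) \<Longrightarrow> defp (\<lambda>x. \<exists>i\<in>I. P i x)"
  by (induction I rule: finite_induct) (auto intro: defp_const defp_disj)

lemma defp_all_less:
  fixes n :: nat
  assumes "\<And>i. i < n \<Longrightarrow> defp (P i)"
  shows "defp (\<lambda>x. \<forall>i<n. P i x)"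
proof -
  have "defp (\<lambda>x. \<forall>i\<in>{..<n}. P i x)" by (rule defp_ball_finite) (use assms in auto)
  then show ?thesis by (simp add: Ball_def)
qed

text \<open>Substitution expressed by quantifiers: a block of \<open>n\<close> fresh coordinates is
  forced to equal the terms and then quantified away. A finite block suffices because
  \<open>P\<close> sees only \<open>n\<close> coordinates.\<close>

lemma defp_subst_rel:
  assumes P: "dep n P" "defp P"
    and R: "\<And>i. i < n \<Longrightarrow> defp (\<lambda>z. z i = \<tau> i (\<lambda>k. z (k + n)))"
  shows "defp (\<lambda>x. P (\<lambda>i. \<tau> i x))"
proof -
  have "defp (\<lambda>x. \<exists>y. (\<lambda>z. P z \<and> (\<forall>i<n. z i = \<tau> i (\<lambda>k. z (k + n)))) (\<lambda>i. if i < n then y i else x (i - n)))"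
    by (intro defp_ex_block defp_conj P defp_all_less R)
  moreover have "(\<exists>y. (\<lambda>z. P z \<and> (\<forall>i<n. z i = \<tau> i (\<lambda>k. z (k + n)))) (\<lambda>i. if i < n then y i else x (i - n)))
     = P (\<lambda>i. \<tau> i x)" for x
  proof -
    have *: "P (\<lambda>i. if i < n then y i else x (i - n)) = P (\<lambda>i. \<tau> i x)" if "\<forall>i<n. y i = \<tau> i x" for y
      by (rule depD[OF P(1)]) (use that in auto)
    then show ?thesis by (auto intro: exI[of _ "\<lambda>i. \<tau> i x"])
  qed
  ultimately show ?thesis by simp
qed

text \<open>Substitution of variables for variables. From here on the position of a coordinate no
  longer matters.\<close>

lemma defp_rename: "defp P \<Longrightarrow> defp (\<lambda>x. P (\<lambda>i. x (\<sigma> i)))"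
proof -
  assume P: "defp P"
  then obtain n where n: "dep n P" by (auto simp: defp_def)
  show ?thesis by (rule defp_subst_rel[OF n P]) (rule defp_eq_var)
qed

definition dt :: "((nat \<Rightarrow> real) \<Rightarrow> real) \<Rightarrow> bool" where
  "dt \<tau> \<longleftrightarrow> defp (\<lambda>y. y 0 = \<tau> (\<lambda>i. y (Suc i)))"

lemma defp_subst:
  assumes "defp P" "\<And>i. dt (\<tau> i)"
  shows "defp (\<lambda>x. P (\<lambda>i. \<tau> i x))"
proof -
  obtain n where n: "dep n P" using assms by (auto simp: defp_def)
  show ?thesis
  proof (rule defp_subst_rel[OF n assms(1)])
    fix i
    from defp_rename[OF assms(2)[unfolded dt_def, of i], of "case_nat i (\<lambda>k. k + n)"]
    show "defp (\<lambda>z. z i = \<tau> i (\<lambda>k. z (k + n)))" by simp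
  qed
qed

lemma defp_ex: "defp (\<lambda>y. Q (\<lambda>i. y (Suc i)) (y 0)) \<Longrightarrow> defp (\<lambda>x. \<exists>t. Q x t)"
  using defp_ins[of "\<lambda>y. Q (\<lambda>i. y (Suc i)) (y 0)" 0] by (simp add: ins_coord_0)

lemma defp_all: "defp (\<lambda>y. Q (\<lambda>i. y (Suc i)) (y 0)) \<Longrightarrow> defp (\<lambda>x. \<forall>t. Q x t)"
  using defp_not[OF defp_ex[of "\<lambda>x t. \<not> Q x t"]] defp_not by simp

lemma dt_var: "dt (\<lambda>x. x i)"
  unfolding dt_def by (rule defp_eq_var)

lemma dt_const: "dt (\<lambda>x. c)"
  unfolding dt_def by (rule defp_eq_const_0)

lemma dt_shift: "dt \<tau> \<Longrightarrow> dt (\<lambda>y. \<tau> (\<lambda>i. y (Suc i)))"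
  unfolding dt_def
  using defp_rename[of "\<lambda>y. y 0 = \<tau> (\<lambda>i. y (Suc i))" "case_nat 0 (\<lambda>k. Suc (Suc k))"] by simp

lemma defp_subst2:
  assumes "defp (\<lambda>x. P (x 0) (x 1))" "dt \<tau>" "dt \<sigma>"
  shows "defp (\<lambda>x. P (\<tau> x) (\<sigma> x))"
  using defp_subst[OF assms(1), of "\<lambda>i. if i = 0 then \<tau> else \<sigma>"] assms by simp

lemma defp_subst3:
  assumes "defp (\<lambda>x. P (x 0) (x 1) (x 2))" "dt \<tau>" "dt \<sigma>" "dt \<rho>"
  shows "defp (\<lambda>x. P (\<tau> x) (\<sigma> x) (\<rho> x))"
  using defp_subst[OF assms(1), of "\<lambda>i. if i = 0 then \<tau> else if i = 1 then \<sigma> else \<rho>"] assms by simp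

lemma defp_eq: "dt \<tau> \<Longrightarrow> dt \<sigma> \<Longrightarrow> defp (\<lambda>x. \<tau> x = \<sigma> x)"
  by (rule defp_subst2[of "(=)"]) (rule defp_eq_var)

lemma defp_less: "dt \<tau> \<Longrightarrow> dt \<sigma> \<Longrightarrow> defp (\<lambda>x. \<tau> x < \<sigma> x)"
  by (rule defp_subst2[of "(<)"]) (rule defp_less_01)

lemma defp_le: "dt \<tau> \<Longrightarrow> dt \<sigma> \<Longrightarrow> defp (\<lambda>x. \<tau> x \<le> \<sigma> x)"
  using defp_not[OF defp_less[of \<sigma> \<tau>]] by (simp add: not_less)

lemma dt_add: "dt \<tau> \<Longrightarrow> dt \<sigma> \<Longrightarrow> dt (\<lambda>x. \<tau> x + \<sigma> x)"
  using defp_subst3[of "\<lambda>a b c. a + b = c" "\<lambda>y. \<tau> (\<lambda>i. y (Suc i))" "\<lambda>y. \<sigma> (\<lambda>i. y (Suc i))" "\<lambda>y. y 0",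
      OF defp_add_012]
  by (simp add: dt_shift dt_var dt_def[of "\<lambda>x. \<tau> x + \<sigma> x"] eq_commute)

lemma dt_mult: "dt \<tau> \<Longrightarrow> dt \<sigma> \<Longrightarrow> dt (\<lambda>x. \<tau> x * \<sigma> x)"
  using defp_subst3[of "\<lambda>a b c. a * b = c" "\<lambda>y. \<tau> (\<lambda>i. y (Suc i))" "\<lambda>y. \<sigma> (\<lambda>i. y (Suc i))" "\<lambda>y. y 0",
      OF defp_mult_012]
  by (simp add: dt_shift dt_var dt_def[of "\<lambda>x. \<tau> x * \<sigma> x"] eq_commute)

lemma dt_minus: "dt \<tau> \<Longrightarrow> dt (\<lambda>x. - \<tau> x)"
  using dt_mult[OF dt_const[of "-1"]] by simp

lemma dt_diff: "dt \<tau> \<Longrightarrow> dt \<sigma> \<Longrightarrow> dt (\<lambda>x. \<tau> x - \<sigma> x)"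
  using dt_add[OF _ dt_minus] by simp

lemma dt_if: "defp P \<Longrightarrow> dt \<tau> \<Longrightarrow> dt \<sigma> \<Longrightarrow> dt (\<lambda>x. if P x then \<tau> x else \<sigma> x)"
proof -
  assume *: "defp P" "dt \<tau>" "dt \<sigma>"
  have "defp (\<lambda>y. P (\<lambda>i. y (Suc i)) \<and> y 0 = \<tau> (\<lambda>i. y (Suc i)) \<or>
      \<not> P (\<lambda>i. y (Suc i)) \<and> y 0 = \<sigma> (\<lambda>i. y (Suc i)))"
    by (intro defp_disj defp_conj defp_not defp_rename[OF *(1)] defp_eq dt_shift[OF *(2)]
        dt_shift[OF *(3)] dt_var)
  then show ?thesis unfolding dt_def by (rule back_subst[of defp]) auto
qed

lemma dt_divide: "dt \<tau> \<Longrightarrow> dt \<sigma> \<Longrightarrow> dt (\<lambda>x. \<tau> x / \<sigma> x)"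
proof -
  assume *: "dt \<tau>" "dt \<sigma>"
  \<comment> \<open>The second disjunct reproduces the value 0 of a division by zero.\<close>
  have "defp (\<lambda>y. \<sigma> (\<lambda>i. y (Suc i)) \<noteq> 0 \<and> y 0 * \<sigma> (\<lambda>i. y (Suc i)) = \<tau> (\<lambda>i. y (Suc i)) \<or>
      \<sigma> (\<lambda>i. y (Suc i)) = 0 \<and> y 0 = 0)"
    by (intro defp_disj defp_conj defp_not defp_eq dt_shift[OF *(1)] dt_mult
        dt_shift[OF *(2)] dt_var dt_const)
  then show ?thesis unfolding dt_def by (rule back_subst[of defp]) (auto simp: field_simps)
qed

lemma dt_sum: "finite I \<Longrightarrow> (\<And>i. i \<in> I \<Longrightarrow> dt (\<tau> i)) \<Longrightarrow> dt (\<lambda>x. \<Sum>i\<in>I. \<tau> i x)"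
  by (induction I rule: finite_induct) (auto intro: dt_const dt_add)

lemma dt_subst: "dt \<tau> \<Longrightarrow> (\<And>i. dt (\<sigma> i)) \<Longrightarrow> dt (\<lambda>x. \<tau> (\<lambda>i. \<sigma> i x))"
proof -
  assume *: "dt \<tau>" "\<And>i. dt (\<sigma> i)"
  define \<rho> where "\<rho> = case_nat (\<lambda>y. y 0) (\<lambda>k y. \<sigma> k (\<lambda>i. y (Suc i)))"
  have "dt (\<rho> i)" for i
    by (auto simp: \<rho>_def split: nat.split intro: dt_var dt_shift *)
  from defp_subst[where \<tau> = \<rho>, OF *(1)[unfolded dt_def] this] show ?thesis by (simp add: dt_def \<rho>_def)
qed

definition defp2 :: "((nat \<Rightarrow> real) \<Rightarrow> real \<Rightarrow> bool) \<Rightarrow> bool" where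
  "defp2 Q \<longleftrightarrow> defp (\<lambda>y. Q (\<lambda>i. y (Suc i)) (y 0))"

lemma defp2_subst:
  assumes "defp2 Q" "\<And>i. dt (\<sigma> i)" "dt \<tau>"
  shows "defp (\<lambda>x. Q (\<lambda>i. \<sigma> i x) (\<tau> x))"
proof -
  define \<rho> where "\<rho> = case_nat \<tau> \<sigma>"
  have "dt (\<rho> i)" for i
    by (auto simp: \<rho>_def split: nat.split intro: assms)
  from defp_subst[where \<tau> = \<rho>, OF assms(1)[unfolded defp2_def] this] show ?thesis by (simp add: \<rho>_def)
qed

lemma dt_upd: "dt \<tau> \<Longrightarrow> dt (\<sigma> i) \<Longrightarrow> dt (\<lambda>x. (((\<lambda>i. \<sigma> i x)(j := \<tau> x)) :: nat \<Rightarrow> real) i)"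
  by (cases "i = j") auto

lemma defp_update:
  "defp P \<Longrightarrow> dt \<tau> \<Longrightarrow> defp (\<lambda>x. P (x(j := \<tau> x)))"
  using defp_subst[of P "\<lambda>i x. (x(j := \<tau> x)) i"] dt_upd[of \<tau> "\<lambda>i x. x i", OF _ dt_var] by (simp add: fun_upd_def)

lemma defp2_update: "defp P \<Longrightarrow> defp2 (\<lambda>x t. P (x(j := t)))"
  unfolding defp2_def
  using defp_subst[of P "\<lambda>i y. ((\<lambda>i. y (Suc i))(j := y 0)) i"]
    dt_upd[of "\<lambda>y. y 0" "\<lambda>i y. y (Suc i)", OF dt_var dt_var] by (simp add: fun_upd_def)

lemmas dt_intros = dt_var dt_const dt_add dt_minus dt_diff dt_mult dt_divide
lemmas defp_intros = defp_const defp_conj defp_disj defp_not defp_imp defp_iff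
  defp_eq defp_less defp_le defp_ex defp_all

end

section \<open>One variable\<close>

definition tame :: "(real \<Rightarrow> 'a) \<Rightarrow> bool" where
  "tame f \<longleftrightarrow> (\<exists>S. finite S \<and> (\<forall>a b. a \<le> b \<and> {a..b} \<inter> S = {} \<longrightarrow> f a = f b))"

lemma tameE:
  assumes "tame f"
  obtains S where "finite S" "\<And>a b. a \<le> b \<Longrightarrow> {a..b} \<inter> S = {} \<Longrightarrow> f a = f b"
  using assms unfolding tame_def by blast

lemma tame_const [simp]: "tame (\<lambda>t. c)"
  by (auto simp: tame_def)

lemma tame_comb:
  assumes "tame f" "tame g"
  shows "tame (\<lambda>t. h (f t) (g t))"
proof -
  obtain S where S: "finite S" "\<And>a b. a \<le> b \<Longrightarrow> {a..b} \<inter> S = {} \<Longrightarrow> f a = f b"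
    using assms(1) by (rule tameE) blast
  obtain T where T: "finite T" "\<And>a b. a \<le> b \<Longrightarrow> {a..b} \<inter> T = {} \<Longrightarrow> g a = g b"
    using assms(2) by (rule tameE) blast
  have "h (f a) (g a) = h (f b) (g b)" if "a \<le> b" "{a..b} \<inter> (S \<union> T) = {}" for a b
  proof -
    have "f a = f b" "g a = g b" using that by (intro S(2) T(2); blast)+
    then show ?thesis by simp
  qed
  then show ?thesis unfolding tame_def using S(1) T(1) by (intro exI[of _ "S \<union> T"]) blast
qed

lemma tame_comp: "tame f \<Longrightarrow> tame (\<lambda>t. h (f t))"
  using tame_comb[of f f "\<lambda>a b. h a"] .

lemma tame_interval:
  fixes J :: "real set"
  assumes "is_interval J"
  shows "tame (\<lambda>t. t \<in> J)"
  unfolding tame_def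
\<comment> \<open>For empty or unbounded \<open>J\<close> one of these may be an arbitrary real. An
  additional break point does no harm, and below each of the two is used only after \<open>J\<close>
  has been shown nonempty and bounded on that side.\<close>
proof (intro exI[of _ "{Inf J, Sup J}"] conjI allI impI)
  fix a b :: real assume ab: "a \<le> b \<and> {a..b} \<inter> {Inf J, Sup J} = {}"
  have conv: "x \<in> J" if "u \<in> J" "v \<in> J" "u \<le> x" "x \<le> v" for u v x
    using assms that unfolding is_interval_1 by blast
  show "(a \<in> J) = (b \<in> J)"
  proof (rule ccontr)
    assume "(a \<in> J) \<noteq> (b \<in> J)"
    then consider "a \<in> J" "b \<notin> J" | "a \<notin> J" "b \<in> J" by blast
    then show False
    proof cases
      case 1
      have le: "x \<le> b" if "x \<in> J" for x
        using conv[OF 1(1) that, of b] 1 ab by force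
      then have "Sup J \<le> b" using 1 by (intro cSup_least) auto
      moreover have "a \<le> Sup J" using 1 le by (intro cSup_upper bdd_aboveI) auto
      ultimately show False using ab by auto
    next
      case 2
      have le: "a \<le> x" if "x \<in> J" for x
        using conv[OF that 2(2), of a] 2 ab by force
      then have "a \<le> Inf J" using 2 by (intro cInf_greatest) auto
      moreover have "Inf J \<le> b" using 2 le by (intro cInf_lower bdd_belowI) auto
      ultimately show False using ab by auto
    qed
  qed
qed simp

lemma tame_Union:
  assumes "finite F" "\<And>I. I \<in> F \<Longrightarrow> is_interval (I :: real set)"
  shows "tame (\<lambda>t. t \<in> \<Union>F)"
  using assms
proof (induction F rule: finite_induct)
  case (insert I F)
  have "tame (\<lambda>t. t \<in> I \<or> t \<in> \<Union>F)"
    by (rule tame_comb[OF tame_interval insert.IH]) (use insert.prems in simp_all)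
  then show ?case by simp
qed simp

lemma finite_nbhd_right:
  fixes t :: real
  assumes "finite S"
  obtains d where "0 < d" "\<And>s. t < s \<Longrightarrow> s < t + d \<Longrightarrow> s \<notin> S"
proof -
  have "eventually (\<lambda>s. s \<notin> S) (at_right t)"
    using assms
  proof (induction S rule: finite_induct)
    case (insert a S)
    have "eventually (\<lambda>s. s \<noteq> a) (at_right t)"
    proof (cases "a \<le> t")
      case True
      then show ?thesis by (auto simp: eventually_at_right_field intro: exI[of _ "t + 1"])
    next
      case False
      then show ?thesis by (auto simp: eventually_at_right_field intro: exI[of _ a])
    qed
    then show ?case using insert.IH by eventually_elim auto
  qed simp
  then obtain b where "t < b" "\<And>s. t < s \<Longrightarrow> s < b \<Longrightarrow> s \<notin> S"
    by (auto simp: eventually_at_right_field)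
  then show thesis using that[of "b - t"] by auto
qed

lemma tame_right:
  assumes "tame f"
  shows "\<exists>c. eventually (\<lambda>s. f s = c) (at_right t)"
proof -
  obtain S where S: "finite S" "\<And>a b. a \<le> b \<Longrightarrow> {a..b} \<inter> S = {} \<Longrightarrow> f a = f b"
    using assms(1) by (rule tameE) blast
  obtain d where d: "0 < d" "\<And>s. t < s \<Longrightarrow> s < t + d \<Longrightarrow> s \<notin> S"
    using finite_nbhd_right[OF S(1)] by blast
  have *: "f s = f (t + d / 2)" if s: "t < s" "s < t + d" for s
  proof (cases s "t + d/2" rule: linorder_le_cases)
    case le
    show ?thesis by (rule S(2)[OF le]) (use d s in force)
  next
    case ge
    show ?thesis by (rule S(2)[OF ge, symmetric]) (use d s in force)
  qed
  show ?thesis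
    unfolding eventually_at_right_field
    by (intro exI[of _ "f (t + d/2)"] exI[of _ "t + d"] conjI allI impI *) (use d in simp_all)
qed

lemma tame_bot:
  assumes "tame f"
  shows "\<exists>c. eventually (\<lambda>s. f s = c) at_bot"
proof -
  obtain S where S: "finite S" "\<And>a b. a \<le> b \<Longrightarrow> {a..b} \<inter> S = {} \<Longrightarrow> f a = f b"
    using assms(1) by (rule tameE) blast
  define m where "m = Min (insert 0 S) - 1"
  have m: "m < s" if "s \<in> S" for s
  proof -
    have "Min (insert 0 S) \<le> s" using S(1) that by (intro Min_le) auto
    then show ?thesis by (simp add: m_def)
  qed
  have "f s = f m" if "s \<le> m" for s
    by (rule S(2)[OF that]) (use m in force)
  then show ?thesis unfolding eventually_at_bot_linorder by blast
qed

text \<open>A point outside the break points brings a whole interval with it, which is uncountable.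
  In this way \<open>finite_discontinuities\<close> and \<open>finite_bad\<close> pass from a
  countable exceptional set to a finite one.\<close>

lemma tame_finite_if_countable:
  assumes "tame P" "countable {t. P t}"
  shows "finite {t. P t}"
proof -
  obtain S where S: "finite S" "\<And>a b. a \<le> b \<Longrightarrow> {a..b} \<inter> S = {} \<Longrightarrow> P a = P b"
    using assms(1) by (rule tameE) blast
  have "{t. P t} \<subseteq> S"
  proof (rule ccontr)
    assume "\<not> {t. P t} \<subseteq> S"
    then obtain t where t: "P t" "t \<notin> S" by auto
    obtain d where d: "0 < d" "\<And>s. t < s \<Longrightarrow> s < t + d \<Longrightarrow> s \<notin> S"
      using finite_nbhd_right[OF S(1)] by blast
    have "P s" if "t < s" "s < t + d" for s
    proof -
      have "x \<notin> S" if "x \<in> {t..s}" for x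
        using d(2)[of x] t that \<open>s < t + d\<close> by (cases "x = t") auto
      then have "{t..s} \<inter> S = {}" by blast
      then show ?thesis using S(2)[of t s] t that by simp
    qed
    then have "{t<..<t+d} \<subseteq> {t. P t}" by auto
    then have "countable {t<..<t+d}" using assms countable_subset by blast
    then show False using d uncountable_open_interval[of t "t+d"] by auto
  qed
  then show ?thesis using S finite_subset by blast
qed

text \<open>A local maximum value is the supremum of \<open>g\<close> over an interval with rational
  endpoints, and there are only countably many such intervals. Nothing is assumed about
  \<open>g\<close>.\<close>

lemma countable_local_max_values:
  fixes g :: "real \<Rightarrow> real"
  shows "countable {g s | s. \<exists>d>0. \<forall>s'. s - d < s' \<and> s' < s + d \<longrightarrow> g s' \<le> g s}"
proof -
  have "{g s | s. \<exists>d>0. \<forall>s'. s - d < s' \<and> s' < s + d \<longrightarrow> g s' \<le> g s}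
     \<subseteq> (\<lambda>(p, q). Sup (g ` {p<..<q})) ` (\<rat> \<times> \<rat>)"
  proof
    fix y assume "y \<in> {g s | s. \<exists>d>0. \<forall>s'. s - d < s' \<and> s' < s + d \<longrightarrow> g s' \<le> g s}"
    then obtain s d where s: "y = g s" "d > 0" "\<And>s'. s - d < s' \<Longrightarrow> s' < s + d \<Longrightarrow> g s' \<le> g s" by auto
    obtain p where p: "p \<in> \<rat>" "s - d < p" "p < s" using Rats_dense_in_real[of "s - d" s] s by auto
    obtain q where q: "q \<in> \<rat>" "s < q" "q < s + d" using Rats_dense_in_real[of s "s + d"] s by auto
    have "Sup (g ` {p<..<q}) = g s"
      by (rule cSup_eq_maximum) (use p q s in auto)
    then show "y \<in> (\<lambda>(p, q). Sup (g ` {p<..<q})) ` (\<rat> \<times> \<rat>)" using p q s by force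
  qed
  then show ?thesis by (rule countable_subset) (intro countable_image countable_SIGMA countable_rat)
qed

text \<open>The argument of Rolle's theorem: if \<open>g a = g b\<close>, then maximum and minimum
  over \<open>{a..b}\<close> are both taken at the ends, so \<open>g\<close> is constant there and
  the midpoint is a local maximum after all.\<close>

lemma inj_on_if_no_local_extremum:
  fixes g :: "real \<Rightarrow> real"
  assumes "is_interval J" "continuous_on J g"
    and no: "\<And>s d. s \<in> J \<Longrightarrow> d > 0 \<Longrightarrow> \<exists>s'. s - d < s' \<and> s' < s + d \<and> g s < g s'"
      "\<And>s d. s \<in> J \<Longrightarrow> d > 0 \<Longrightarrow> \<exists>s'. s - d < s' \<and> s' < s + d \<and> g s' < g s"
  shows "inj_on g J"
proof (rule linorder_inj_onI')
  fix a b assume ab: "a \<in> J" "b \<in> J" "a < b"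
  show "g a \<noteq> g b"
  proof
    assume eq: "g a = g b"
    have sub: "{a..b} \<subseteq> J" using assms(1) ab unfolding is_interval_1 by (meson atLeastAtMost_iff subsetI)
    have c: "continuous_on {a..b} g" using assms(2) sub continuous_on_subset by blast
    obtain p where p: "p \<in> {a..b}" "\<And>x. x \<in> {a..b} \<Longrightarrow> g x \<le> g p"
      using continuous_attains_sup[OF compact_Icc _ c] ab by auto
    obtain q where q: "q \<in> {a..b}" "\<And>x. x \<in> {a..b} \<Longrightarrow> g q \<le> g x"
      using continuous_attains_inf[OF compact_Icc _ c] ab by auto
    have 1: False if "a < s" "s < b" "\<And>x. x \<in> {a..b} \<Longrightarrow> g x \<le> g s" for s
    proof -
      have "s \<in> J" "0 < min (s - a) (b - s)" using sub that by auto
      from no(1)[OF this] obtain s' where "s - min (s - a) (b - s) < s'" "s' < s + min (s - a) (b - s)" "g s < g s'" by auto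
      then show False using that(3)[of s'] by (auto simp: min_def split: if_splits)
    qed
    have 2: False if "a < s" "s < b" "\<And>x. x \<in> {a..b} \<Longrightarrow> g s \<le> g x" for s
    proof -
      have "s \<in> J" "0 < min (s - a) (b - s)" using sub that by auto
      from no(2)[OF this] obtain s' where "s - min (s - a) (b - s) < s'" "s' < s + min (s - a) (b - s)" "g s' < g s" by auto
      then show False using that(3)[of s'] by (auto simp: min_def split: if_splits)
    qed
    have "\<not> (a < p \<and> p < b)" using 1[of p] p(2) by blast
    then have "p = a \<or> p = b" using p(1) by auto
    then have gp: "g p = g a" using eq by auto
    have "\<not> (a < q \<and> q < b)" using 2[of q] q(2) by blast
    then have "q = a \<or> q = b" using q(1) by auto
    then have gq: "g q = g a" using eq by auto
    have const: "g x = g a" if "x \<in> {a..b}" for x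
      using p(2)[OF that] q(2)[OF that] gp gq by linarith
    have "g x \<le> g ((a + b) / 2)" if "x \<in> {a..b}" for x
      using const[OF that] const[of "(a + b) / 2"] ab by simp
    then show False using ab by (intro 1[of "(a + b) / 2"]) auto
  qed
qed

text \<open>The image is connected, and a connected set of reals with two points contains an
  uncountable interval.\<close>

lemma const_if_countable_image:
  fixes g :: "real \<Rightarrow> real"
  assumes "is_interval J" "continuous_on J g" "countable (g ` J)" "a \<in> J" "b \<in> J"
  shows "g a = g b"
proof (rule ccontr)
  assume ne: "g a \<noteq> g b"
  have conn: "connected (g ` J)"
    using assms(1,2) connected_continuous_image is_interval_connected_1 by blast
  define l where "l = min (g a) (g b)"
  define u where "u = max (g a) (g b)"
  have "l \<in> g ` J" "u \<in> g ` J" "l < u" using assms ne by (auto simp: l_def u_def min_def max_def)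
  then have "{l..u} \<subseteq> g ` J" using connected_contains_Icc[OF conn] by blast
  then have "countable {l..u}" using assms(3) countable_subset by blast
  then show False using \<open>l < u\<close> uncountable_closed_interval[of l u] by simp
qed

section \<open>The Euler integral in one variable\<close>

definition lbot :: "(real \<Rightarrow> int) \<Rightarrow> int" where
  "lbot f = (THE c. eventually (\<lambda>s. f s = c) at_bot)"

definition rlim :: "(real \<Rightarrow> int) \<Rightarrow> real \<Rightarrow> int" where
  "rlim f t = (THE c. eventually (\<lambda>s. f s = c) (at_right t))"

text \<open>Integration of a constructible function of one real variable against the Euler characteristic.
  Each half-open interval \<open>[a, b)\<close> contributes \<open>0\<close>, so that only the discontinuities from the right
  and the limit at \<open>-\<infinity>\<close> matter. In contrast to a sum over the pieces of a partition, this formula is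
  local.\<close>

definition Eint :: "(real \<Rightarrow> int) \<Rightarrow> int" where
  "Eint f = (\<Sum>t | f t \<noteq> rlim f t. f t - rlim f t) - lbot f"

lemma lbot_eq:
  assumes "eventually (\<lambda>s. f s = c) at_bot"
  shows "lbot f = c"
  unfolding lbot_def
proof (rule the_equality, fact)
  fix c' assume "eventually (\<lambda>s. f s = c') at_bot"
  with assms have "eventually (\<lambda>s. c' = c) (at_bot :: real filter)" by eventually_elim auto
  then show "c' = c" by simp
qed

lemma rlim_eq:
  assumes "eventually (\<lambda>s. f s = c) (at_right t)"
  shows "rlim f t = c"
  unfolding rlim_def
proof (rule the_equality, fact)
  fix c' assume "eventually (\<lambda>s. f s = c') (at_right t)"
  with assms have "eventually (\<lambda>s. c' = c) (at_right t)" by eventually_elim auto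
  then show "c' = c" by simp
qed

lemma ev_lbot: "tame f \<Longrightarrow> eventually (\<lambda>s. f s = lbot f) at_bot"
  using tame_bot lbot_eq by metis

lemma ev_rlim: "tame f \<Longrightarrow> eventually (\<lambda>s. f s = rlim f t) (at_right t)"
  using tame_right rlim_eq by metis

lemma tame_finite_jumps:
  assumes "tame f"
  shows "finite {t. f t \<noteq> rlim f t}"
proof -
  obtain S where S: "finite S" "\<And>a b. a \<le> b \<Longrightarrow> {a..b} \<inter> S = {} \<Longrightarrow> f a = f b"
    using assms(1) by (rule tameE) blast
  have "rlim f t = f t" if "t \<notin> S" for t
  proof (rule rlim_eq)
    obtain d where d: "0 < d" "\<And>s. t < s \<Longrightarrow> s < t + d \<Longrightarrow> s \<notin> S"
      using finite_nbhd_right[OF S(1)] by blast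
    have "f s = f t" if "t < s" "s < t + d" for s
    proof -
      have "x \<notin> S" if "x \<in> {t..s}" for x
        using d(2)[of x] \<open>t \<notin> S\<close> that \<open>s < t + d\<close> by (cases "x = t") auto
      then have "{t..s} \<inter> S = {}" by blast
      then show ?thesis using S(2)[of t s] that by simp
    qed
    then show "eventually (\<lambda>s. f s = f t) (at_right t)"
      using d by (auto simp: eventually_at_right_field intro!: exI[of _ "t + d"])
  qed
  then have "{t. f t \<noteq> rlim f t} \<subseteq> S" by force
  then show ?thesis using S finite_subset by blast
qed

text \<open>Lets the jumps of several functions be summed over one common finite set, as additivity
  requires.\<close>

lemma Eint_superset:
  assumes "finite T" "{t. f t \<noteq> rlim f t} \<subseteq> T"
  shows "Eint f = (\<Sum>t\<in>T. f t - rlim f t) - lbot f"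
  unfolding Eint_def using assms by (subst sum.mono_neutral_left[of T]) auto

lemma
  assumes "tame f" "tame g"
  shows lbot_add: "lbot (\<lambda>t. f t + g t) = lbot f + lbot g"
    and rlim_add: "rlim (\<lambda>t. f t + g t) t = rlim f t + rlim g t"
proof -
  show "lbot (\<lambda>t. f t + g t) = lbot f + lbot g"
    by (rule lbot_eq) (use ev_lbot[OF assms(1)] ev_lbot[OF assms(2)] in eventually_elim, simp)
  show "rlim (\<lambda>t. f t + g t) t = rlim f t + rlim g t"
    by (rule rlim_eq) (use ev_rlim[OF assms(1)] ev_rlim[OF assms(2)] in eventually_elim, simp)
qed

lemma
  assumes "tame f"
  shows lbot_cmult: "lbot (\<lambda>t. c * f t) = c * lbot f"
    and rlim_cmult: "rlim (\<lambda>t. c * f t) t = c * rlim f t"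
proof -
  show "lbot (\<lambda>t. c * f t) = c * lbot f"
    by (rule lbot_eq) (use ev_lbot[OF assms(1)] in eventually_elim, simp)
  show "rlim (\<lambda>t. c * f t) t = c * rlim f t"
    by (rule rlim_eq) (use ev_rlim[OF assms(1)] in eventually_elim, simp)
qed

lemma Eint_add:
  assumes "tame f" "tame g"
  shows "Eint (\<lambda>t. f t + g t) = Eint f + Eint g"
proof -
  define T where "T = {t. f t \<noteq> rlim f t} \<union> {t. g t \<noteq> rlim g t}"
  have T: "finite T" using tame_finite_jumps assms by (simp add: T_def)
  have "Eint f = (\<Sum>t\<in>T. f t - rlim f t) - lbot f"
    by (rule Eint_superset[OF T]) (auto simp: T_def)
  moreover have "Eint g = (\<Sum>t\<in>T. g t - rlim g t) - lbot g"
    by (rule Eint_superset[OF T]) (auto simp: T_def)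
  moreover have "Eint (\<lambda>t. f t + g t) = (\<Sum>t\<in>T. f t + g t - rlim (\<lambda>t. f t + g t) t) - lbot (\<lambda>t. f t + g t)"
    by (rule Eint_superset[OF T]) (auto simp: T_def rlim_add[OF assms])
  ultimately show ?thesis
    by (simp add: rlim_add[OF assms] lbot_add[OF assms] sum.distrib sum_subtractf)
qed

lemma Eint_cmult:
  assumes "tame f"
  shows "Eint (\<lambda>t. c * f t) = c * Eint f"
proof -
  define T where "T = {t. f t \<noteq> rlim f t}"
  have T: "finite T" using tame_finite_jumps assms by (simp add: T_def)
  have "Eint f = (\<Sum>t\<in>T. f t - rlim f t) - lbot f"
    by (rule Eint_superset[OF T]) (auto simp: T_def)
  moreover have "Eint (\<lambda>t. c * f t) = (\<Sum>t\<in>T. c * f t - rlim (\<lambda>t. c * f t) t) - lbot (\<lambda>t. c * f t)"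
    by (rule Eint_superset[OF T]) (auto simp: T_def rlim_cmult[OF assms])
  ultimately show ?thesis
    by (simp add: rlim_cmult[OF assms] lbot_cmult[OF assms] right_diff_distrib sum_distrib_left)
qed

lemma Eint_const [simp]: "Eint (\<lambda>t. c) = - c"
proof -
  have "rlim (\<lambda>t. c) t = c" for t by (rule rlim_eq) simp
  moreover have "lbot (\<lambda>t. c) = c" by (rule lbot_eq) simp
  ultimately show ?thesis by (simp add: Eint_def)
qed

lemma Eint_point: "Eint (\<lambda>t. of_bool (t = a)) = 1"
proof -
  have "rlim (\<lambda>t. of_bool (t = a)) t = 0" for t
  proof (rule rlim_eq)
    obtain d where d: "0 < d" "\<And>s. t < s \<Longrightarrow> s < t + d \<Longrightarrow> s \<notin> {a}"
      using finite_nbhd_right[of "{a}" t] by blast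
    then show "eventually (\<lambda>s. of_bool (s = a) = 0) (at_right t)"
      by (auto simp: eventually_at_right_field intro!: exI[of _ "t + d"])
  qed
  moreover have "lbot (\<lambda>t. of_bool (t = a)) = 0"
    by (rule lbot_eq) (auto simp: eventually_at_bot_linorder intro!: exI[of _ "a - 1"])
  ultimately show ?thesis using Eint_superset[of "{a}" "\<lambda>t. of_bool (t = a)"] by simp
qed

text \<open>If \<open>J\<close> is bounded below, the only discontinuity from the right is
  \<open>Inf J\<close>, where the value is 0 and the right limit 1. Otherwise there is none, and the
  limit at minus infinity is 1. A finite right end does not belong to \<open>J\<close>, so the
  indicator is continuous from the right there.\<close>

lemma Eint_open_interval:
  fixes J :: "real set"
  assumes "open J" "is_interval J" "J \<noteq> {}"
  shows "Eint (\<lambda>t. of_bool (t \<in> J)) = -1"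
proof -
  have conv: "x \<in> J" if "u \<in> J" "v \<in> J" "u \<le> x" "x \<le> v" for u v x
    using assms(2) that unfolding is_interval_1 by blast
  have inside: "rlim (\<lambda>t. of_bool (t \<in> J)) t = 1" if "t \<in> J" for t
  proof (rule rlim_eq)
    obtain e where "e > 0" "\<And>s. \<bar>s - t\<bar> < e \<Longrightarrow> s \<in> J"
      using assms(1) \<open>t \<in> J\<close> unfolding open_real by (auto simp: dist_real_def)
    then show "eventually (\<lambda>s. of_bool (s \<in> J) = (1::int)) (at_right t)"
      by (auto simp: eventually_at_right_field intro!: exI[of _ "t + e"])
  qed
  have outside: "rlim (\<lambda>t. of_bool (t \<in> J)) t = 0" if "s \<in> J" "s < t" "t \<notin> J" for s t
    using conv[OF that(1)] that
    by (intro rlim_eq) (force simp: eventually_at_right_field intro!: exI[of _ "t + 1"])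
  obtain j where j: "j \<in> J" using assms by blast
  show ?thesis
  proof (cases "bdd_below J")
    case False
    have low: "t \<in> J" if "t < j" for t
    proof -
      obtain s where "s \<in> J" "s < t" using False by (meson bdd_belowI linorder_not_le)
      then show ?thesis using conv[OF _ j, of s t] that by auto
    qed
    have out: "\<exists>s\<in>J. s < t" if "t \<notin> J" for t
      using that low[of "min (t - 1) (j - 1)"] by (intro bexI[of _ "min (t-1) (j-1)"]) auto
    have "lbot (\<lambda>t. of_bool (t \<in> J)) = 1"
      by (rule lbot_eq) (use low in \<open>auto simp: eventually_at_bot_linorder intro!: exI[of _ "j - 1"]\<close>)
    moreover have "rlim (\<lambda>t. of_bool (t \<in> J)) t = of_bool (t \<in> J)" for t
      using inside[of t] out[of t] outside[of _ t] by (cases "t \<in> J") auto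
    ultimately show ?thesis by (simp add: Eint_def)
  next
    case True
    define a where "a = Inf J"
    have a: "a \<le> x" if "x \<in> J" for x using True that by (simp add: a_def cInf_lower)
    have a': "\<exists>s\<in>J. s < t" if "a < t" for t using that cInf_lessD[of J t] j by (auto simp: a_def)
    have an: "a \<notin> J"
    proof
      assume "a \<in> J"
      then obtain e where "e > 0" "\<And>s. \<bar>s - a\<bar> < e \<Longrightarrow> s \<in> J"
        using assms(1) unfolding open_real by (auto simp: dist_real_def)
      then show False using a[of "a - e/2"] by auto
    qed
    have "a < j" using a[OF j] an j by (cases "a = j") auto
    have "lbot (\<lambda>t. of_bool (t \<in> J)) = 0"
      by (rule lbot_eq) (use a in \<open>force simp: eventually_at_bot_linorder intro!: exI[of _ "a - 1"]\<close>)
    moreover have "rlim (\<lambda>t. of_bool (t \<in> J)) a = 1"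
    proof (rule rlim_eq)
      have "s \<in> J" if "a < s" "s < j" for s using a'[OF that(1)] conv[OF _ j] that by force
      then show "eventually (\<lambda>s. of_bool (s \<in> J) = (1::int)) (at_right a)"
        using \<open>a < j\<close> by (auto simp: eventually_at_right_field intro!: exI[of _ j])
    qed
    moreover have "{t. of_bool (t \<in> J) \<noteq> rlim (\<lambda>t. of_bool (t \<in> J)) t} \<subseteq> {a}"
    proof safe
      fix t assume *: "of_bool (t \<in> J) \<noteq> rlim (\<lambda>t. of_bool (t \<in> J)) t"
      show "t = a"
      proof (cases t a rule: linorder_cases)
        case less
        have "rlim (\<lambda>t. of_bool (t \<in> J)) t = 0"
          by (rule rlim_eq) (use a less in \<open>force simp: eventually_at_right_field intro!: exI[of _ a]\<close>)
        then show ?thesis using * a[of t] less by auto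
      next
        case greater
        then show ?thesis using * inside[of t] a'[of t] outside[of _ t] by (cases "t \<in> J") auto
      qed
    qed
    ultimately show ?thesis using Eint_superset[of "{a}" "\<lambda>t. of_bool (t \<in> J)"] an by simp
  qed
qed

lemma tame_of_bool: "is_interval J \<Longrightarrow> tame (\<lambda>t. of_bool (t \<in> J) :: int)"
  using tame_comp[OF tame_interval] .

lemma tame_point: "tame (\<lambda>t. of_bool (t = a) :: int)"
  using tame_of_bool[of "{a}"] by (simp add: is_interval_1)

text \<open>An open ray and its end point contribute -1 and 1. This cancellation is what makes
  half-spaces vanish in the inversion.\<close>

lemma Eint_atMost: "Eint (\<lambda>t. of_bool (t \<le> a)) = 0"
proof -
  have *: "(\<lambda>t. of_bool (t \<le> a)) = (\<lambda>t. of_bool (t \<in> {..<a}) + (of_bool (t = a) :: int))" by auto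
  have "Eint (\<lambda>t. of_bool (t \<le> a)) = Eint (\<lambda>t. of_bool (t \<in> {..<a})) + Eint (\<lambda>t. of_bool (t = a))"
    unfolding * by (rule Eint_add[OF tame_of_bool tame_point]) (auto simp: is_interval_1)
  moreover have "Eint (\<lambda>t. of_bool (t \<in> {..<a})) = -1"
    by (rule Eint_open_interval) (auto simp: is_interval_1)
  ultimately show ?thesis by (simp add: Eint_point)
qed

lemma Eint_atLeast: "Eint (\<lambda>t. of_bool (a \<le> t)) = 0"
proof -
  have *: "(\<lambda>t. of_bool (a \<le> t)) = (\<lambda>t. of_bool (t \<in> {a<..}) + (of_bool (t = a) :: int))" by auto
  have "Eint (\<lambda>t. of_bool (a \<le> t)) = Eint (\<lambda>t. of_bool (t \<in> {a<..})) + Eint (\<lambda>t. of_bool (t = a))"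
    unfolding * by (rule Eint_add[OF tame_of_bool tame_point]) (auto simp: is_interval_1)
  moreover have "Eint (\<lambda>t. of_bool (t \<in> {a<..})) = -1"
    by (rule Eint_open_interval) (auto simp: is_interval_1)
  ultimately show ?thesis by (simp add: Eint_point)
qed

lemma Eint_sum:
  assumes "finite I" "\<And>i. i \<in> I \<Longrightarrow> tame (f i)"
  shows "tame (\<lambda>t. \<Sum>i\<in>I. f i t)" "Eint (\<lambda>t. \<Sum>i\<in>I. f i t) = (\<Sum>i\<in>I. Eint (f i))"
proof -
  have "tame (\<lambda>t. \<Sum>i\<in>I. f i t) \<and> Eint (\<lambda>t. \<Sum>i\<in>I. f i t) = (\<Sum>i\<in>I. Eint (f i))"
    using assms
  proof (induction I rule: finite_induct)
    case (insert i I)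
    have *: "tame (f i)" "tame (\<lambda>t. \<Sum>i\<in>I. f i t)" using insert by auto
    have "tame (\<lambda>t. f i t + (\<Sum>i\<in>I. f i t))" using tame_comb[OF *, of "(+)"] .
    then show ?case using Eint_add[OF *] insert by simp
  qed simp
  then show "tame (\<lambda>t. \<Sum>i\<in>I. f i t)" "Eint (\<lambda>t. \<Sum>i\<in>I. f i t) = (\<Sum>i\<in>I. Eint (f i))" by auto
qed

context o_minimal_structure
begin

text \<open>Here o-minimality enters as a restriction on definable sets of reals; the finiteness
  results that follow go back to this lemma.\<close>

lemma defp_tame:
  assumes "defp (\<lambda>x. P (x 0))"
  shows "tame P"
proof -
  have "{x \<in> espace 1. P (x 0)} \<in> D 1"
    by (rule definable_of_defp[OF assms]) (auto simp: dep_def)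
  then obtain F where F: "{x \<in> espace 1. P (x 0)} = {x \<in> espace 1. x 0 \<in> \<Union>F}" "finite F"
    "\<And>I. I \<in> F \<Longrightarrow> (\<exists>a. I = {a}) \<or> (open I \<and> is_interval I)"
    unfolding one_dim by blast
  have "P t \<longleftrightarrow> t \<in> \<Union>F" for t
  proof -
    define y :: "nat \<Rightarrow> real" where "y = (\<lambda>i. if i = 0 then t else 0)"
    have "y \<in> {x \<in> espace 1. P (x 0)} \<longleftrightarrow> y \<in> {x \<in> espace 1. x 0 \<in> \<Union>F}" using F(1) by simp
    moreover have "y \<in> espace 1" "y 0 = t" by (simp_all add: espace_iff y_def)
    ultimately show ?thesis by simp
  qed
  moreover have "tame (\<lambda>t. t \<in> \<Union>F)"
  proof (rule tame_Union[OF F(2)])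
    show "is_interval I" if "I \<in> F" for I
      using F(3)[OF that] by (auto simp: is_interval_1)
  qed
  moreover have "P = (\<lambda>t. t \<in> \<Union>F)" using calculation(1) by (intro ext)
  ultimately show ?thesis by simp
qed

lemma defp2_section: "defp2 Q \<Longrightarrow> defp (\<lambda>y. Q x (y 0))"
  using defp2_subst[of Q "\<lambda>i y. x i" "\<lambda>y. y 0"] dt_const dt_var by blast

lemma defp2_tame: "defp2 Q \<Longrightarrow> tame (\<lambda>t. Q x t)"
  using defp_tame[OF defp2_section] .

section \<open>Definable functions of one variable: continuity and monotonicity\<close>

definition du :: "(real \<Rightarrow> real) \<Rightarrow> bool" where
  "du g \<longleftrightarrow> dt (\<lambda>x. g (x 0))"

lemma dt_unary: "du g \<Longrightarrow> dt \<tau> \<Longrightarrow> dt (\<lambda>x. g (\<tau> x))"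
  using dt_subst[of "\<lambda>x. g (x 0)" "\<lambda>i. \<tau>"] by (simp add: du_def)

lemma du_minus: "du g \<Longrightarrow> du (\<lambda>t. - g t)"
  unfolding du_def by (rule dt_minus)

lemma du_reflect: "du g \<Longrightarrow> du (\<lambda>t. g (- t))"
  using dt_unary[of g "\<lambda>x. - x 0"] dt_minus[OF dt_var] by (simp add: du_def)

text \<open>If the condition held at a point \<open>t\<close> that is not a break point, it would
  also hold at some \<open>s\<close> slightly to the right. But at \<open>t\<close> it says
  \<open>p < g s\<close>, and at \<open>s\<close> it says \<open>g s < p\<close>.\<close>

lemma finite_right_jumps_above:
  assumes "du g"
  shows "finite {t. g t < p \<and> (\<exists>d>0. \<forall>s. t < s \<and> s < t + d \<longrightarrow> p < g s)}"
    (is "finite {t. ?P t}")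
proof -
  have "defp (\<lambda>x. ?P (x 0))"
    by (intro defp_intros dt_unary[OF assms] dt_intros)
  then have "tame ?P" by (rule defp_tame)
  then obtain S where S: "finite S" "\<And>a b. a \<le> b \<Longrightarrow> {a..b} \<inter> S = {} \<Longrightarrow> ?P a = ?P b"
    by (rule tameE) blast
  have "t \<in> S" if t: "?P t" for t
  proof (rule ccontr)
    assume nt: "t \<notin> S"
    obtain e where e: "0 < e" "\<And>s. t < s \<Longrightarrow> s < t + e \<Longrightarrow> s \<notin> S"
      using finite_nbhd_right[OF S(1)] by blast
    obtain d where d: "d > 0" "\<And>s. t < s \<Longrightarrow> s < t + d \<Longrightarrow> p < g s" using t by blast
    define s where "s = t + min d e / 2"
    have s: "t < s" "s < t + d" "s < t + e" using d e by (auto simp: s_def)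
    have "x \<notin> S" if "x \<in> {t..s}" for x
      using e(2)[of x] nt that s by (cases "x = t") auto
    then have "{t..s} \<inter> S = {}" by blast
    then have "?P t = ?P s" using S(2)[of t s] s by simp
    then have "?P s" using t by blast
    then show False using d(2)[of s] s by auto
  qed
  then have "{t. ?P t} \<subseteq> S" by blast
  then show ?thesis using S(1) finite_subset by blast
qed

text \<open>By tameness a failure of right continuity leaves a gap: on a right neighbourhood of
  \<open>t\<close> the function stays by some \<open>e\<close> above, or by some \<open>e\<close>
  below, its value at \<open>t\<close>. A rational \<open>p\<close> inside the gap puts
  \<open>t\<close> into one of countably many finite sets.\<close>

lemma countable_not_right_continuous:
  assumes g: "du g"
  shows "countable {t. \<not> (g \<longlongrightarrow> g t) (at_right t)}"
proof -
  let ?P = "\<lambda>g p t. g t < p \<and> (\<exists>d>0. \<forall>s. t < s \<and> s < t + d \<longrightarrow> p < g s)"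
  define B where "B = (\<Union>p\<in>\<rat>. {t. ?P g p t} \<union> {t. ?P (\<lambda>t. - g t) p t})"
  have "countable B"
    unfolding B_def
    by (intro countable_UN countable_rat countable_Un countable_finite finite_right_jumps_above g du_minus)
  moreover have half: "eventually (\<lambda>s. f s < f t + e) (at_right t)"
    if f: "du f" and e: "e > 0" and no: "\<And>p. p \<in> \<rat> \<Longrightarrow> \<not> ?P f p t" for f t e
  proof (rule ccontr)
    assume *: "\<not> eventually (\<lambda>s. f s < f t + e) (at_right t)"
    have "defp (\<lambda>x. f (x 0) < f t + e)"
      by (intro defp_intros dt_unary[OF f] dt_intros)
    from tame_right[OF defp_tame[OF this], of t] obtain c
      where c: "eventually (\<lambda>s. (f s < f t + e) = c) (at_right t)" by blast
    with * have "\<not> c" by (auto elim: eventually_mono)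
    then have "eventually (\<lambda>s. f t + e \<le> f s) (at_right t)"
      using c by (auto elim!: eventually_mono)
    then obtain b where b: "t < b" "\<And>s. t < s \<Longrightarrow> s < b \<Longrightarrow> f t + e \<le> f s"
      by (auto simp: eventually_at_right_field)
    obtain p where p: "p \<in> \<rat>" "f t < p" "p < f t + e" using Rats_dense_in_real[of "f t" "f t + e"] e by auto
    have "?P f p t"
      using b p by (intro conjI exI[of _ "b - t"]) force+
    then show False using no p by blast
  qed
  have "(g \<longlongrightarrow> g t) (at_right t)" if "t \<notin> B" for t
    unfolding tendsto_iff
  proof (intro allI impI)
    fix e :: real assume e: "e > 0"
    have "eventually (\<lambda>s. g s < g t + e) (at_right t)"
      by (rule half[OF g e]) (use that in \<open>auto simp: B_def\<close>)
    moreover have "eventually (\<lambda>s. - g s < - g t + e) (at_right t)"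
      by (rule half[OF du_minus[OF g] e]) (use that in \<open>auto simp: B_def\<close>)
    ultimately show "eventually (\<lambda>s. dist (g s) (g t) < e) (at_right t)"
      by eventually_elim (auto simp: dist_real_def)
  qed
  then have "{t. \<not> (g \<longlongrightarrow> g t) (at_right t)} \<subseteq> B" by blast
  ultimately show ?thesis using countable_subset by blast
qed

text \<open>Continuity is spelled out with epsilon and delta over definable terms, so that the
  discontinuities form a definable set; it is countable and therefore finite. Left continuity is
  right continuity of the reflected function.\<close>

lemma finite_discontinuities:
  assumes g: "du g"
  shows "finite {t. \<not> isCont g t}"
proof -
  let ?C = "\<lambda>t. \<forall>e. 0 < e \<longrightarrow> (\<exists>d. 0 < d \<and> (\<forall>s. t - d < s \<and> s < t + d \<longrightarrow> g t - e < g s \<and> g s < g t + e))"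
  have C: "isCont g t \<longleftrightarrow> ?C t" for t
  proof -
    have *: "dist s t < d \<longleftrightarrow> t - d < s \<and> s < t + d" for s t d :: real
      by (auto simp: dist_real_def abs_less_iff)
    show ?thesis unfolding continuous_at_eps_delta * by (simp add: imp_conjL)
  qed
  have "defp (\<lambda>x. \<not> ?C (x 0))"
    by (intro defp_intros dt_unary[OF g] dt_intros)
  then have "tame (\<lambda>t. \<not> isCont g t)" unfolding C by (rule defp_tame)
  moreover have "countable {t. \<not> isCont g t}"
  proof -
    let ?R = "{t. \<not> (g \<longlongrightarrow> g t) (at_right t)}"
    let ?L = "uminus ` {t. \<not> ((\<lambda>t. g (- t)) \<longlongrightarrow> g (- t)) (at_right t)}"
    have "isCont g t" if "t \<notin> ?R" "t \<notin> ?L" for t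
    proof -
      have "- t \<notin> {t. \<not> ((\<lambda>t. g (- t)) \<longlongrightarrow> g (- t)) (at_right t)}"
        using that(2) by (metis imageI minus_minus)
      then have "((\<lambda>t. g (- t)) \<longlongrightarrow> g t) (at_right (- t))" by simp
      then have "(g \<longlongrightarrow> g t) (at_left t)" by (simp add: filterlim_at_left_to_right)
      with that(1) show ?thesis
        unfolding continuous_at by (intro filterlim_split_at) auto
    qed
    then have "{t. \<not> isCont g t} \<subseteq> ?R \<union> ?L" by blast
    moreover have "countable (?R \<union> ?L)"
      using countable_not_right_continuous[OF g] countable_not_right_continuous[OF du_reflect[OF g]]
      by blast
    ultimately show ?thesis using countable_subset by blast
  qed
  ultimately show ?thesis by (rule tame_finite_if_countable)
qed

text \<open>A weak form of the monotonicity theorem. Away from finitely many points, being a local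
  extremum does not change along an interval. If every point is one, the image is countable and
  \<open>g\<close> is constant; if none is, \<open>g\<close> is injective.\<close>

lemma piecewise_injective_or_constant:
  assumes g: "du g"
  obtains S where "finite S"
    "\<And>J. open J \<Longrightarrow> is_interval J \<Longrightarrow> J \<inter> S = {} \<Longrightarrow>
      continuous_on J g \<and> (inj_on g J \<or> (\<exists>c. \<forall>s\<in>J. g s = c))"
proof -
  let ?M = "\<lambda>s. \<exists>d. 0 < d \<and> (\<forall>s'. s - d < s' \<and> s' < s + d \<longrightarrow> g s' \<le> g s)"
  let ?m = "\<lambda>s. \<exists>d. 0 < d \<and> (\<forall>s'. s - d < s' \<and> s' < s + d \<longrightarrow> g s \<le> g s')"
  have "defp (\<lambda>x. ?M (x 0) \<or> ?m (x 0))"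
    by (intro defp_intros dt_unary[OF g] dt_intros)
  then have "tame (\<lambda>s. ?M s \<or> ?m s)" by (rule defp_tame)
  then obtain S where S: "finite S" "\<And>a b. a \<le> b \<Longrightarrow> {a..b} \<inter> S = {} \<Longrightarrow> (?M a \<or> ?m a) = (?M b \<or> ?m b)"
    by (rule tameE) blast
  have "continuous_on J g \<and> (inj_on g J \<or> (\<exists>c. \<forall>s\<in>J. g s = c))"
    if J: "open J" "is_interval J" "J \<inter> (S \<union> {t. \<not> isCont g t}) = {}" for J
  proof
    show cont: "continuous_on J g"
      using J(3) by (intro continuous_at_imp_continuous_on) auto
    have sub: "{a..b} \<subseteq> J" if "a \<in> J" "b \<in> J" for a b
      using J(2) that unfolding is_interval_1 by (meson atLeastAtMost_iff subsetI)
    have const: "(?M a \<or> ?m a) = (?M b \<or> ?m b)" if "a \<in> J" "b \<in> J" for a b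
    proof (cases "a \<le> b")
      case True
      show ?thesis by (rule S(2)[OF True]) (use sub[OF that] J(3) in blast)
    next
      case False
      then have "b \<le> a" by simp
      show ?thesis by (rule S(2)[OF \<open>b \<le> a\<close>, symmetric]) (use sub[OF that(2,1)] J(3) in blast)
    qed
    show "inj_on g J \<or> (\<exists>c. \<forall>s\<in>J. g s = c)"
    proof (cases "\<exists>s\<in>J. ?M s \<or> ?m s")
      case True
      then have all: "?M s \<or> ?m s" if "s \<in> J" for s using const that by blast
      have m: "?m s \<longleftrightarrow> (\<exists>d>0. \<forall>s'. s - d < s' \<and> s' < s + d \<longrightarrow> - g s' \<le> - g s)" for s by simp
      have "g ` J \<subseteq> {g s | s. ?M s} \<union> uminus ` {- g s | s. ?m s}"
      proof
        fix y assume "y \<in> g ` J"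
        then obtain s where s: "s \<in> J" "y = g s" by auto
        from all[OF s(1)] show "y \<in> {g s | s. ?M s} \<union> uminus ` {- g s | s. ?m s}"
        proof
          assume "?m s"
          then have "- g s \<in> {- g s | s. ?m s}" by blast
          then have "y \<in> uminus ` {- g s | s. ?m s}" by (rule rev_image_eqI) (simp add: s(2))
          then show ?thesis by blast
        qed (use s in blast)
      qed
      moreover have "countable ({g s | s. ?M s} \<union> uminus ` {- g s | s. ?m s})"
        using countable_local_max_values[of g] countable_local_max_values[of "\<lambda>s. - g s"] by auto
      ultimately have "countable (g ` J)" using countable_subset by blast
      from const_if_countable_image[OF J(2) cont this] show ?thesis by metis
    next
      case False
      have "inj_on g J"
        by (rule inj_on_if_no_local_extremum[OF J(2) cont]) (use False in \<open>meson not_le\<close>)+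
      then show ?thesis ..
    qed
  qed
  then show thesis using that[of "S \<union> {t. \<not> isCont g t}"] S(1) finite_discontinuities[OF g] by blast
qed

end

section \<open>Uniform finiteness\<close>

text \<open>A lower bound on a cardinality written with quantifiers over reals only, so that for
  each fixed \<open>n\<close> it is a definable predicate (\<open>defp_atleast\<close>).\<close>

fun atleast :: "nat \<Rightarrow> (real \<Rightarrow> bool) \<Rightarrow> bool" where
  "atleast 0 P = True"
| "atleast (Suc n) P = (\<exists>t. P t \<and> atleast n (\<lambda>s. P s \<and> s \<noteq> t))"

lemma atleast_iff_card: "finite {t. P t} \<Longrightarrow> atleast n P \<longleftrightarrow> n \<le> card {t. P t}"
proof (induction n arbitrary: P)
  case (Suc n)
  have *: "{s. P s \<and> s \<noteq> t} = {s. P s} - {t}" for t by auto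
  have "atleast n (\<lambda>s. P s \<and> s \<noteq> t) \<longleftrightarrow> n \<le> card ({s. P s} - {t})" for t
    using Suc.IH[of "\<lambda>s. P s \<and> s \<noteq> t"] Suc.prems unfolding * by simp
  then have "atleast (Suc n) P \<longleftrightarrow> (\<exists>t. P t \<and> n \<le> card ({s. P s} - {t}))"
    by (simp only: atleast.simps)
  also have "\<dots> \<longleftrightarrow> Suc n \<le> card {t. P t}"
  proof
    assume "\<exists>t. P t \<and> n \<le> card ({s. P s} - {t})"
    then obtain t where t: "P t" "n \<le> card ({s. P s} - {t})" by blast
    have "card {s. P s} = Suc (card ({s. P s} - {t}))"
      by (rule card.remove) (use Suc.prems t in auto)
    with t show "Suc n \<le> card {t. P t}" by linarith
  next
    assume *: "Suc n \<le> card {t. P t}"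
    then have "{t. P t} \<noteq> {}" by force
    then obtain t where t: "P t" by auto
    have "card {s. P s} = Suc (card ({s. P s} - {t}))"
      by (rule card.remove) (use Suc.prems t in auto)
    with * have "n \<le> card ({s. P s} - {t})" by linarith
    with t show "\<exists>t. P t \<and> n \<le> card ({s. P s} - {t})" by blast
  qed
  finally show ?case .
qed simp

lemma finite_separated:
  fixes S :: "real set"
  assumes "finite S"
  obtains e where "0 < e" "\<And>a b. a \<in> S \<Longrightarrow> b \<in> S \<Longrightarrow> a < b \<Longrightarrow> a + e + e < b"
proof -
  define T where "T = (\<lambda>(a, b). b - a) ` {(a, b). a \<in> S \<and> b \<in> S \<and> a < b}"
  have "finite T" unfolding T_def
    by (intro finite_imageI finite_subset[OF _ finite_cartesian_product[OF assms assms]]) auto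
  \<comment> \<open>A third rather than a half keeps \<open>a + e + e < b\<close> strict; the
    element 1 provides for an empty \<open>T\<close>.\<close>
  define e where "e = Min (insert 1 T) / 3"
  have "0 < Min (insert 1 T)" using \<open>finite T\<close> by (subst Min_gr_iff) (auto simp: T_def)
  moreover have "a + e + e < b" if "a \<in> S" "b \<in> S" "a < b" for a b
  proof -
    have "b - a \<in> T" using that by (auto simp: T_def)
    then have "Min (insert 1 T) \<le> b - a" using \<open>finite T\<close> by (intro Min_le) auto
    then show ?thesis using calculation by (simp add: e_def)
  qed
  ultimately show thesis using that[of e] by (auto simp: e_def)
qed

text \<open>A first-order condition ensuring that the number of points in the fibre \<open>A s'\<close> is constant for
  \<open>s'\<close> near \<open>s\<close>.\<close>

definition matching :: "real \<Rightarrow> (real \<Rightarrow> bool) \<Rightarrow> (real \<Rightarrow> bool) \<Rightarrow> bool" where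
  "matching e P P' \<longleftrightarrow> (\<forall>t. P t \<longrightarrow> (\<exists>t'. P' t' \<and> t - e < t' \<and> t' < t + e \<and>
       (\<forall>u. P' u \<and> t - e < u \<and> u < t + e \<longrightarrow> u = t'))) \<and>
     (\<forall>t'. P' t' \<longrightarrow> (\<exists>t. P t \<and> t - e < t' \<and> t' < t + e))"

definition good :: "(real \<Rightarrow> real \<Rightarrow> bool) \<Rightarrow> real \<Rightarrow> bool" where
  "good A s \<longleftrightarrow> (\<exists>e. 0 < e \<and> (\<forall>t1 t2. A s t1 \<and> A s t2 \<and> t1 < t2 \<longrightarrow> t1 + e + e < t2) \<and>
     (\<exists>d. 0 < d \<and> (\<forall>s'. s - d < s' \<and> s' < s + d \<longrightarrow> matching e (A s) (A s'))))"

text \<open>Every point of the fibre over \<open>s\<close> has exactly one partner within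
  \<open>e\<close> in the fibre over \<open>s'\<close>, and every point there is a partner.
  Different points have different partners because they are more than \<open>2 * e\<close>
  apart.\<close>

lemma good_card_const:
  assumes "good A s"
  obtains d where "0 < d" "\<And>s'. s - d < s' \<Longrightarrow> s' < s + d \<Longrightarrow> card {t. A s' t} = card {t. A s t}"
proof -
  obtain e d where e: "\<And>t1 t2. A s t1 \<Longrightarrow> A s t2 \<Longrightarrow> t1 < t2 \<Longrightarrow> t1 + e + e < t2"
    and d: "0 < d" and all: "\<And>s'. s - d < s' \<Longrightarrow> s' < s + d \<Longrightarrow> matching e (A s) (A s')"
    using assms unfolding good_def by blast
  have "card {t. A s' t} = card {t. A s t}" if s': "s - d < s'" "s' < s + d" for s'
  proof -
    obtain f where f: "\<And>t. A s t \<Longrightarrow> A s' (f t) \<and> t - e < f t \<and> f t < t + e"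
      and uniq: "\<And>t u. A s t \<Longrightarrow> A s' u \<Longrightarrow> t - e < u \<Longrightarrow> u < t + e \<Longrightarrow> u = f t"
      using all[OF s'] unfolding matching_def by metis
    have "bij_betw f {t. A s t} {t. A s' t}"
      unfolding bij_betw_def
    proof
      show "inj_on f {t. A s t}"
      proof (rule linorder_inj_onI')
        fix a b assume ab: "a \<in> {t. A s t}" "b \<in> {t. A s t}" "a < b"
        then show "f a \<noteq> f b" using e[of a b] f[of a] f[of b] by auto
      qed
      show "f ` {t. A s t} = {t. A s' t}"
      proof (intro equalityI subsetI)
        fix u assume u: "u \<in> {t. A s' t}"
        then obtain t where t: "A s t" "t - e < u" "u < t + e" using all[OF s'] u unfolding matching_def by blast
        then have "u = f t" using uniq u by blast
        then show "u \<in> f ` {t. A s t}" using t by blast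
      qed (use f in blast)
    qed
    then show ?thesis by (metis bij_betw_same_card)
  qed
  with d show thesis using that by blast
qed

lemma tame_not_locally_const:
  assumes "tame f"
  shows "finite {s. \<not> eventually (\<lambda>s'. f s' = f s) (nhds s)}"
proof -
  obtain S where S: "finite S" "\<And>a b. a \<le> b \<Longrightarrow> {a..b} \<inter> S = {} \<Longrightarrow> f a = f b"
    using assms(1) by (rule tameE) blast
  have "eventually (\<lambda>s'. f s' = f s) (nhds s)" if "s \<notin> S" for s
  proof -
    have "open (- S)" using S(1) by (simp add: finite_imp_closed open_Compl)
    then have "\<exists>e>0. \<forall>x. \<bar>x - s\<bar> < e \<longrightarrow> x \<in> - S" using that unfolding open_real by blast
    then obtain e where e: "e > 0" "\<And>x. \<bar>x - s\<bar> < e \<Longrightarrow> x \<notin> S" by blast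
    have "f x = f s" if "\<bar>x - s\<bar> < e" for x
    proof (cases "x \<le> s")
      case True
      have "{x..s} \<inter> S = {}" using e(2) that by force
      then show ?thesis using S(2) True by blast
    next
      case False
      then have "s \<le> x" by simp
      have "{s..x} \<inter> S = {}" using e(2) that by force
      then show ?thesis using S(2)[OF \<open>s \<le> x\<close>] by simp
    qed
    then show ?thesis unfolding eventually_nhds_metric dist_real_def using e(1) by blast
  qed
  then have "{s. \<not> eventually (\<lambda>s'. f s' = f s) (nhds s)} \<subseteq> S" by blast
  then show ?thesis using S(1) finite_subset by blast
qed

lemma const_on_if_locally_const:
  fixes f :: "real \<Rightarrow> 'a"
  assumes loc: "\<And>s. s \<in> {a..b} \<Longrightarrow> \<exists>d>0. \<forall>s'. s - d < s' \<and> s' < s + d \<longrightarrow> f s' = f s"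
    and ab: "u \<in> {a..b}" "v \<in> {a..b}"
  shows "f u = f v"
proof -
  have "f constant_on {a..b}"
  proof (rule locally_constant_imp_constant)
    fix s assume s: "s \<in> {a..b}"
    then obtain d where d: "d > 0" "\<forall>s'. s - d < s' \<and> s' < s + d \<longrightarrow> f s' = f s" using loc by blast
    have "openin (top_of_set {a..b}) ({a..b} \<inter> {s-d<..<s+d})" by (intro openin_open_Int) simp
    moreover have "s \<in> {a..b} \<inter> {s-d<..<s+d}" using s d(1) by simp
    moreover have "\<forall>x\<in>{a..b} \<inter> {s-d<..<s+d}. f x = f s"
      by (intro ballI d(2)[rule_format]) simp
    ultimately show "\<exists>T. openin (top_of_set {a..b}) T \<and> s \<in> T \<and> (\<forall>x\<in>T. f x = f s)"
      by blast
  qed simp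
  then obtain c where c: "\<forall>x\<in>{a..b}. f x = c" unfolding constant_on_def ..
  show ?thesis using c[rule_format, OF ab(1)] c[rule_format, OF ab(2)] by simp
qed

text \<open>The sample points are fixed expressions in the break points, so that they become
  definable functions of the parameters in \<open>uniform_finiteness_dep\<close>: the midpoint of a
  bounded gap, a shift by 1 into an unbounded one, and 0 when there is no break point.\<close>

lemma representative_of_gap:
  fixes h :: "real \<Rightarrow> 'a"
  assumes "finite S" "s \<notin> S"
    and loc: "\<And>s. s \<notin> S \<Longrightarrow> \<exists>d>0. \<forall>s'. s - d < s' \<and> s' < s + d \<longrightarrow> h s' = h s"
  obtains r where "h r = h s"
    "(\<exists>a\<in>S. \<exists>b\<in>S. r = (a + b) / 2) \<or> (\<exists>a\<in>S. r = a + 1 \<or> r = a - 1) \<or> r = 0"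
proof -
  have h: "h r = h s" if "\<And>x. min r s \<le> x \<Longrightarrow> x \<le> max r s \<Longrightarrow> x \<notin> S" for r
    by (rule const_on_if_locally_const[where a = "min r s" and b = "max r s"]) (use loc that in auto)
  define L U where "L = {a \<in> S. a < s}" and "U = {a \<in> S. s < a}"
  have fin: "finite L" "finite U" using assms(1) by (auto simp: L_def U_def)
  have S: "x \<in> L \<or> x \<in> U" if "x \<in> S" for x using that assms(2) by (cases x s rule: linorder_cases) (auto simp: L_def U_def)
  have L: "Max L \<in> S" "Max L < s" "\<And>x. x \<in> L \<Longrightarrow> x \<le> Max L" if "L \<noteq> {}"
    using Max_in[OF fin(1) that] Max_ge[OF fin(1)] by (auto simp: L_def)
  have U: "Min U \<in> S" "s < Min U" "\<And>x. x \<in> U \<Longrightarrow> Min U \<le> x" if "U \<noteq> {}"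
    using Min_in[OF fin(2) that] Min_le[OF fin(2)] by (auto simp: U_def)
  consider "L = {}" "U = {}" | "L = {}" "U \<noteq> {}" | "L \<noteq> {}" "U = {}" | "L \<noteq> {}" "U \<noteq> {}" by blast
  then show thesis
  proof cases
    case 1
    have "h 0 = h s" by (rule h) (use S 1 in auto)
    then show thesis using that by blast
  next
    case 2
    have "h (Min U - 1) = h s"
      by (rule h) (use S 2(1) U[OF 2(2)] in \<open>fastforce simp: min_def max_def split: if_splits\<close>)
    then show thesis using that U(1)[OF 2(2)] by blast
  next
    case 3
    have "h (Max L + 1) = h s"
      by (rule h) (use S 3(2) L[OF 3(1)] in \<open>fastforce simp: min_def max_def split: if_splits\<close>)
    then show thesis using that L(1)[OF 3(1)] by blast
  next
    case 4
    have "h ((Max L + Min U) / 2) = h s"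
    proof (rule h)
      fix x assume x: "min ((Max L + Min U) / 2) s \<le> x" "x \<le> max ((Max L + Min U) / 2) s"
      then have "Max L < x" "x < Min U" using L(2)[OF 4(1)] U(2)[OF 4(2)]
        by (auto simp: min_def max_def split: if_splits)
      then show "x \<notin> S" using S[of x] L(3)[OF 4(1), of x] U(3)[OF 4(2), of x] by force
    qed
    then show thesis using that L(1)[OF 4(1)] U(1)[OF 4(2)] by blast
  qed
qed

context o_minimal_structure
begin

lemma defp_atleast: "defp2 Q \<Longrightarrow> defp (\<lambda>x. atleast n (Q x))"
proof (induction n arbitrary: Q)
  case 0
  then show ?case by (simp add: defp_const)
next
  case (Suc n)
  have "defp2 (\<lambda>y s. Q (\<lambda>i. y (Suc i)) s \<and> s \<noteq> y 0)"
    unfolding defp2_def by (intro defp_intros dt_intros defp2_subst[OF Suc.prems])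
  from Suc.IH[OF this] show ?case
    by (auto intro!: defp_intros dt_intros defp2_subst[OF Suc.prems])
qed

lemma dtI:
  assumes "defp2 R" "\<And>x t. t = \<tau> x \<longleftrightarrow> R x t"
  shows "dt \<tau>"
  using assms by (simp add: dt_def defp2_def)

text \<open>The least element of a finite fibre is a definable function of the parameters (with
  value 0 over empty fibres). Removing it lowers the bound by one.\<close>

lemma cover_by_terms:
  assumes "defp2 Q" "\<And>x. finite {t. Q x t}" "\<And>x. card {t. Q x t} \<le> K"
  shows "\<exists>T. finite T \<and> (\<forall>\<tau>\<in>T. dt \<tau>) \<and> (\<forall>x t. Q x t \<longrightarrow> (\<exists>\<tau>\<in>T. t = \<tau> x))"
  using assms
proof (induction K arbitrary: Q)
  case 0
  then show ?case by (intro exI[of _ "{}"]) auto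
next
  case (Suc K)
  define \<mu> where "\<mu> x = (if \<exists>t. Q x t then Min {t. Q x t} else 0)" for x
  have \<mu>: "Q x (\<mu> x)" if "Q x t" for x t
    using Min_in[OF Suc.prems(2)[of x]] that by (auto simp: \<mu>_def)
  have \<mu>': "\<mu> x \<le> s" if "Q x s" for x s
    using Min_le[OF Suc.prems(2)[of x]] that by (auto simp: \<mu>_def)
  have d: "dt \<mu>"
  proof (rule dtI)
    show "defp2 (\<lambda>x t. (Q x t \<and> (\<forall>s. Q x s \<longrightarrow> t \<le> s)) \<or> (\<not> (\<exists>s. Q x s) \<and> t = 0))"
      unfolding defp2_def by (intro defp_intros dt_intros defp2_subst[OF Suc.prems(1)])
    show "t = \<mu> x \<longleftrightarrow> (Q x t \<and> (\<forall>s. Q x s \<longrightarrow> t \<le> s)) \<or> (\<not> (\<exists>s. Q x s) \<and> t = 0)" for x t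
    proof (cases "\<exists>t. Q x t")
      case True
      then show ?thesis using \<mu>[of x] \<mu>'[of x] by (metis order.antisym)
    next
      case False
      then show ?thesis by (auto simp: \<mu>_def)
    qed
  qed
  have 1: "defp2 (\<lambda>x t. Q x t \<and> t \<noteq> \<mu> x)"
    unfolding defp2_def
    by (intro defp_intros dt_intros defp2_subst[OF Suc.prems(1)] dt_shift[OF d])
  have 2: "{t. Q x t \<and> t \<noteq> \<mu> x} = {t. Q x t} - {\<mu> x}" for x by auto
  have 3: "card ({t. Q x t} - {\<mu> x}) \<le> K" for x
  proof (cases "\<exists>t. Q x t")
    case True
    then have "\<mu> x \<in> {t. Q x t}" using \<mu> by blast
    then show ?thesis using Suc.prems(3)[of x] Suc.prems(2)[of x] by simp
  qed simp
  obtain T where T: "finite T" "\<forall>\<tau>\<in>T. dt \<tau>" "\<forall>x t. Q x t \<and> t \<noteq> \<mu> x \<longrightarrow> (\<exists>\<tau>\<in>T. t = \<tau> x)"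
    using Suc.IH[OF 1] 2 3 Suc.prems(2) by auto
  show ?case
    by (rule exI[of _ "insert \<mu> T"]) (use T d in blast)
qed

definition defp3 :: "((nat \<Rightarrow> real) \<Rightarrow> real \<Rightarrow> real \<Rightarrow> bool) \<Rightarrow> bool" where
  "defp3 B \<longleftrightarrow> defp (\<lambda>y. B (\<lambda>i. y (Suc (Suc i))) (y 1) (y 0))"

lemma defp3_subst:
  assumes "defp3 B" "\<And>i. dt (\<sigma> i)" "dt \<tau>" "dt \<rho>"
  shows "defp (\<lambda>x. B (\<lambda>i. \<sigma> i x) (\<tau> x) (\<rho> x))"
proof -
  define \<eta> where "\<eta> = case_nat \<rho> (case_nat \<tau> \<sigma>)"
  have "dt (\<eta> i)" for i
    by (auto simp: \<eta>_def split: nat.split intro: assms)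
  from defp_subst[where \<tau> = \<eta>, OF assms(1)[unfolded defp3_def] this] show ?thesis
    by (simp add: \<eta>_def)
qed

lemma defp2_good:
  assumes "defp3 B"
  shows "defp2 (\<lambda>x s. good (B x) s)"
  unfolding defp2_def good_def matching_def
  by (intro defp_intros defp3_subst[OF assms] dt_intros)

text \<open>Near \<open>s0\<close> the fibres are traced by finitely many functions continuous at
  \<open>s0\<close>. Which of them lie in the fibre and which of them coincide does not change, so
  points neither appear nor vanish, split or merge.\<close>

lemma eventually_good:
  assumes "finite G" "\<And>g. g \<in> G \<Longrightarrow> isCont g s0"
    and cover: "eventually (\<lambda>s. \<forall>t. A s t \<longrightarrow> (\<exists>g\<in>G. t = g s)) (nhds s0)"
    and A: "\<And>g. g \<in> G \<Longrightarrow> eventually (\<lambda>s. A s (g s) = A s0 (g s0)) (nhds s0)"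
    and E: "\<And>g h. g \<in> G \<Longrightarrow> h \<in> G \<Longrightarrow> eventually (\<lambda>s. (g s = h s) = (g s0 = h s0)) (nhds s0)"
  shows "good A s0"
proof -
  have cov0: "\<exists>g\<in>G. t = g s0" if "A s0 t" for t
    using eventually_nhds_x_imp_x[OF cover] that by blast
  then have "{t. A s0 t} \<subseteq> (\<lambda>g. g s0) ` G" by auto
  then have "finite {t. A s0 t}" using assms(1) by (meson finite_imageI finite_subset)
  then obtain e where e: "0 < e" "\<And>a b. A s0 a \<Longrightarrow> A s0 b \<Longrightarrow> a < b \<Longrightarrow> a + e + e < b"
    using finite_separated[of "{t. A s0 t}"] by auto
  have "eventually (\<lambda>s. \<forall>g\<in>G. \<bar>g s - g s0\<bar> < e) (nhds s0)"
  proof (rule eventually_ball_finite[OF assms(1)], rule ballI)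
    fix g assume "g \<in> G"
    then have "(g \<longlongrightarrow> g s0) (nhds s0)"
      using assms(2) by (simp add: continuous_at tendsto_at_iff_tendsto_nhds)
    from tendstoD[OF this e(1)] show "eventually (\<lambda>s. \<bar>g s - g s0\<bar> < e) (nhds s0)"
      by (simp add: dist_real_def)
  qed
  moreover have "eventually (\<lambda>s. \<forall>g\<in>G. A s (g s) = A s0 (g s0)) (nhds s0)"
    by (rule eventually_ball_finite[OF assms(1)]) (use A in blast)
  moreover have "eventually (\<lambda>s. \<forall>g\<in>G. \<forall>h\<in>G. (g s = h s) = (g s0 = h s0)) (nhds s0)"
    by (intro eventually_ball_finite[OF assms(1)] ballI) (use E in blast)
  ultimately have "eventually (\<lambda>s. (\<forall>t. A s t \<longrightarrow> (\<exists>g\<in>G. t = g s)) \<and> (\<forall>g\<in>G. \<bar>g s - g s0\<bar> < e) \<and>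
     (\<forall>g\<in>G. A s (g s) = A s0 (g s0)) \<and> (\<forall>g\<in>G. \<forall>h\<in>G. (g s = h s) = (g s0 = h s0))) (nhds s0)"
    using cover by eventually_elim blast
  then obtain d where d: "d > 0" "\<And>s. \<bar>s - s0\<bar> < d \<Longrightarrow> (\<forall>t. A s t \<longrightarrow> (\<exists>g\<in>G. t = g s)) \<and> (\<forall>g\<in>G. \<bar>g s - g s0\<bar> < e) \<and>
     (\<forall>g\<in>G. A s (g s) = A s0 (g s0)) \<and> (\<forall>g\<in>G. \<forall>h\<in>G. (g s = h s) = (g s0 = h s0))"
    unfolding eventually_nhds_metric dist_real_def by blast
  have fw: "\<exists>t'. A s t' \<and> t - e < t' \<and> t' < t + e \<and> (\<forall>u. A s u \<and> t - e < u \<and> u < t + e \<longrightarrow> u = t')"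
    if "s0 - d < s \<and> s < s0 + d" and t: "A s0 t" for s t
  proof -
    have "\<bar>s - s0\<bar> < d" using that by auto
    note s = d(2)[OF this]
    obtain g where g: "g \<in> G" "t = g s0" using cov0[OF t] by blast
    have "u = g s" if u: "A s u \<and> t - e < u \<and> u < t + e" for u
    proof -
      obtain h where h: "h \<in> G" "u = h s" using s u by blast
      have "A s0 (h s0)" using s h u by blast
      moreover have "\<bar>h s - h s0\<bar> < e" using s h by blast
      \<comment> \<open>Both values lie within \<open>e\<close> of \<open>u\<close>, whereas
        distinct points of the fibre over \<open>s0\<close> are more than \<open>2 * e\<close>
        apart.\<close>
      ultimately have "h s0 = g s0"
        using e(2)[of "h s0" "g s0"] e(2)[of "g s0" "h s0"] t g u h
        by (cases "h s0" "g s0" rule: linorder_cases) (auto simp: abs_less_iff)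
      then show ?thesis using s g h by blast
    qed
    moreover have "A s (g s)" "\<bar>g s - t\<bar> < e" using s g t by auto
    ultimately show ?thesis
      by (intro exI[of _ "g s"]) (auto simp: abs_less_iff)
  qed
  have bw: "\<exists>t. A s0 t \<and> t - e < t' \<and> t' < t + e"
    if "s0 - d < s \<and> s < s0 + d" and t: "A s t'" for s t'
  proof -
    have "\<bar>s - s0\<bar> < d" using that by auto
    note s = d(2)[OF this]
    obtain g where g: "g \<in> G" "t' = g s" using s t by blast
    have "A s0 (g s0)" "\<bar>g s - g s0\<bar> < e" using s g t by blast+
    then show ?thesis
      using g by (intro exI[of _ "g s0"]) (auto simp: abs_less_iff)
  qed
  have "matching e (A s0) (A s)" if "s0 - d < s \<and> s < s0 + d" for s
    unfolding matching_def using fw[OF that] bw[OF that] by blast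
  then show ?thesis unfolding good_def using e d(1) by blast
qed

text \<open>No common bound on the fibres is available yet. For each \<open>m\<close> the fibres
  with exactly \<open>m\<close> points are covered by finitely many definable functions, and the
  places where these are discontinuous or change their incidences are finite in number. Over all
  \<open>m\<close> this gives countably many bad values, and goodness is first order.\<close>

lemma finite_bad:
  assumes A: "defp3 (\<lambda>_. A)" and fin: "\<And>s. finite {t. A s t}"
  shows "finite {s. \<not> good A s}"
proof (rule tame_finite_if_countable)
  have A2: "defp (\<lambda>x. A (\<tau> x) (\<rho> x))" if "dt \<tau>" "dt \<rho>" for \<tau> \<rho>
    using defp3_subst[OF A, of "\<lambda>i x. 0"] that dt_const by blast
  show "tame (\<lambda>s. \<not> good A s)"
    using defp2_tame[OF defp2_good[OF A]] by (rule tame_comp)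
  let ?N = "\<lambda>f. {s. \<not> eventually (\<lambda>s'. f s' = f s) (nhds s)}"
  have "\<exists>G. finite G \<and> (\<forall>g\<in>G. du g) \<and> (\<forall>s t. card {t. A s t} = m \<and> A s t \<longrightarrow> (\<exists>g\<in>G. t = g s))" for m
  proof -
    \<comment> \<open>Fibres with more than \<open>m\<close> points are emptied, so that the bound
      required by \<open>cover_by_terms\<close> holds.\<close>
    define Q where "Q x t \<longleftrightarrow> A (x 0) t \<and> \<not> atleast (Suc m) (A (x 0))" for x :: "nat \<Rightarrow> real" and t
    have 1: "defp2 Q"
      unfolding defp2_def Q_def
      by (intro defp_intros A2 dt_intros defp_atleast) (unfold defp2_def, intro A2 dt_intros)
    have fin': "finite {t. Q x t}" for x
      using fin[of "x 0"] by (rule finite_subset[rotated]) (auto simp: Q_def)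
    have card: "card {t. Q x t} \<le> m" for x
    proof (cases "atleast (Suc m) (A (x 0))")
      case False
      then have "card {t. A (x 0) t} \<le> m" using atleast_iff_card[OF fin, of "Suc m" "x 0"] by linarith
      with False show ?thesis by (simp add: Q_def del: atleast.simps)
    qed (simp add: Q_def del: atleast.simps)
    obtain T where T: "finite T" "\<forall>\<tau>\<in>T. dt \<tau>"
      "\<forall>x t. A (x 0) t \<and> \<not> atleast (Suc m) (A (x 0)) \<longrightarrow> (\<exists>\<tau>\<in>T. t = \<tau> x)"
      using cover_by_terms[OF 1 fin' card] unfolding Q_def by blast
    show ?thesis
    \<comment> \<open>The terms in \<open>T\<close> may read any coordinate; setting all of them to
      \<open>s\<close> leaves functions of one variable.\<close>
    proof (intro exI[of _ "(\<lambda>\<tau> s. \<tau> (\<lambda>_. s)) ` T"] conjI ballI allI impI)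
      show "finite ((\<lambda>\<tau> s. \<tau> (\<lambda>_. s)) ` T)" using T(1) by simp
      fix g assume "g \<in> (\<lambda>\<tau> s. \<tau> (\<lambda>_. s)) ` T"
      then show "du g" unfolding du_def using T(2) by (auto intro!: dt_subst[of _ "\<lambda>i x. x 0"] dt_var)
    next
      fix s t assume st: "card {t. A s t} = m \<and> A s t"
      then have "\<not> atleast (Suc m) (A s)" using atleast_iff_card[OF fin, of "Suc m" s] by simp
      then show "\<exists>g\<in>(\<lambda>\<tau> s. \<tau> (\<lambda>_. s)) ` T. t = g s"
        using T(3)[rule_format, of "\<lambda>_. s" t] st by auto
    qed
  qed
  then obtain G where G: "\<And>m. finite (G m)" "\<And>m g. g \<in> G m \<Longrightarrow> du g"
    "\<And>s t. A s t \<Longrightarrow> \<exists>g\<in>G (card {t. A s t}). t = g s" by metis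
  have card_eq: "(\<lambda>s. card {t. A s t} = m) = (\<lambda>s. atleast m (A s) \<and> \<not> atleast (Suc m) (A s))" for m
    by (auto simp: atleast_iff_card[OF fin] simp del: atleast.simps)
  have tame1: "tame (\<lambda>s. card {t. A s t} = m)" for m
    unfolding card_eq
    by (rule defp_tame, intro defp_intros defp_atleast) (unfold defp2_def, (intro A2 dt_intros)+)
  have tame2: "tame (\<lambda>s. A s (g s))" if "du g" for g
    by (rule defp_tame) (intro A2 dt_unary[OF that] dt_intros)
  have tame3: "tame (\<lambda>s. g s = h s)" if "du g" "du h" for g h
    by (rule defp_tame) (intro defp_intros dt_unary[OF that(1)] dt_unary[OF that(2)] dt_intros)
  let ?B = "\<Union>m. ?N (\<lambda>s. card {t. A s t} = m) \<union> (\<Union>g\<in>G m. {s. \<not> isCont g s} \<union> ?N (\<lambda>s. A s (g s)))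
      \<union> (\<Union>g\<in>G m. \<Union>h\<in>G m. ?N (\<lambda>s. g s = h s))"
  have "countable ?B"
    using G(1,2)
    by (intro countable_UN countable_Un countable_finite finite_UN_I tame_not_locally_const
        finite_discontinuities finite_UnI tame1 tame2 tame3 countableI_type) auto
  moreover have "{s. \<not> good A s} \<subseteq> ?B"
  proof (rule subsetI, rule ccontr)
    fix s assume "s \<in> {s. \<not> good A s}" and s: "s \<notin> ?B"
    then have ng: "\<not> good A s" by blast
    define m where "m = card {t. A s t}"
    have "good A s"
    proof (rule eventually_good)
      show "finite (G m)" by (rule G(1))
      show "isCont g s" if "g \<in> G m" for g using s that by blast
      have "eventually (\<lambda>s'. (card {t. A s' t} = m) = (card {t. A s t} = m)) (nhds s)"
        using s by blast
      then show "eventually (\<lambda>s. \<forall>t. A s t \<longrightarrow> (\<exists>g\<in>G m. t = g s)) (nhds s)"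
      proof eventually_elim
        case (elim s')
        then have "card {t. A s' t} = m" by (simp add: m_def)
        then show ?case using G(3) by metis
      qed
      show "eventually (\<lambda>s'. A s' (g s') = A s (g s)) (nhds s)" if "g \<in> G m" for g
        using s that by blast
      show "eventually (\<lambda>s'. (g s' = h s') = (g s = h s)) (nhds s)" if "g \<in> G m" "h \<in> G m" for g h
        using s that by blast
    qed
    with ng show False by blast
  qed
  ultimately show "countable {s. \<not> good A s}" using countable_subset by blast
qed

lemma defp_dep: "defp P \<Longrightarrow> \<exists>n. dep n P"
  by (auto simp: defp_def)

lemma dep_defp2:
  assumes "defp2 Q"
  shows "\<exists>n. dep n Q"
proof -
  obtain n where n: "dep n (\<lambda>y. Q (\<lambda>i. y (Suc i)) (y 0))" using assms defp_dep unfolding defp2_def by blast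
  have "dep n Q"
    unfolding dep_def
  proof (intro allI impI ext)
    fix x y :: "nat \<Rightarrow> real" and t assume *: "\<forall>i<n. x i = y i"
    show "Q x t = Q y t"
      using depD[OF n, of "case_nat t x" "case_nat t y"] * by (auto split: nat.splits)
  qed
  then show ?thesis ..
qed

lemma dt_trunc: "dt (\<lambda>x. trunc m x i)"
  by (cases "i < m") (auto simp: trunc_def intro: dt_intros)

lemma dt_fun_upd: "dt \<tau> \<Longrightarrow> dt (\<lambda>x. (x(j := \<tau> x)) i)"
  using dt_upd[of \<tau> "\<lambda>i x. x i"] dt_var by auto

text \<open>The induction passes from \<open>m + 1\<close> to \<open>m\<close> parameters by letting the last one vary: the fibre
  cardinality is constant between consecutive bad values, so it suffices to bound it at the bad
  values and at one value in each gap, and finitely many definable functions of the remaining \<open>m\<close>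
  parameters enumerate these.\<close>

lemma uniform_finiteness_dep:
  assumes "defp2 P" "dep m P" "\<And>x. finite {t. P x t}"
  shows "\<exists>N. \<forall>x. card {t. P x t} \<le> N"
  using assms
proof (induction m arbitrary: P)
  case 0
  then have "P x = P (\<lambda>_. 0)" for x by (auto simp: dep_def)
  then show ?case by (metis order_refl)
next
  case (Suc m)
  define B where "B x s t = P (x(m := s)) t" for x s t
  have B: "defp3 B"
    unfolding defp3_def B_def fun_upd_def
    by (rule defp2_subst[OF Suc.prems(1)]) (auto intro!: dt_if defp_const dt_intros)
  have depB: "dep m B"
    unfolding dep_def B_def
  proof (intro allI impI ext)
    fix x y :: "nat \<Rightarrow> real" and s t assume *: "\<forall>i<m. x i = y i"
    have "P (x(m := s)) = P (y(m := s))"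
      by (rule depD[OF Suc.prems(2)]) (use * in auto)
    then show "P (x(m := s)) t = P (y(m := s)) t" by simp
  qed
  define Bad where "Bad x s \<longleftrightarrow> \<not> good (B x) s" for x s
  have Bad: "defp2 Bad"
    unfolding Bad_def defp2_def by (rule defp_not) (rule defp2_good[OF B, unfolded defp2_def])
  have finBad: "finite {s. Bad x s}" for x
    unfolding Bad_def
  proof (rule finite_bad)
    show "defp3 (\<lambda>_. B x)"
      unfolding defp3_def by (rule defp3_subst[OF B]) (rule dt_intros)+
    show "finite {t. B x s t}" for s using Suc.prems(3) by (simp add: B_def)
  qed
  define Rep where "Rep x r \<longleftrightarrow> Bad x r \<or> (\<exists>a b. Bad x a \<and> Bad x b \<and> r = (a + b) / 2) \<or>
     (\<exists>a. Bad x a \<and> (r = a + 1 \<or> r = a - 1)) \<or> r = 0" for x r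
  have Rep: "defp2 Rep"
    unfolding Rep_def defp2_def by (intro defp_intros defp2_subst[OF Bad] dt_intros)
  have depRep: "dep m Rep"
    unfolding dep_def
  proof (intro allI impI ext)
    fix x y :: "nat \<Rightarrow> real" and r assume *: "\<forall>i<m. x i = y i"
    have "B x = B y" by (rule depD[OF depB]) (use * in auto)
    then show "Rep x r = Rep y r" by (simp add: Rep_def Bad_def)
  qed
  have finRep: "finite {r. Rep x r}" for x
  proof -
    let ?S = "{s. Bad x s}"
    have "{r. Rep x r} \<subseteq> ?S \<union> (\<lambda>(a, b). (a + b) / 2) ` (?S \<times> ?S) \<union> (\<lambda>a. a + 1) ` ?S \<union> (\<lambda>a. a - 1) ` ?S \<union> {0}"
    proof
      fix r assume "r \<in> {r. Rep x r}"
      moreover have "(a + b) / 2 \<in> (\<lambda>(a, b). (a + b) / 2) ` (?S \<times> ?S)" if "Bad x a" "Bad x b" for a b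
        by (rule rev_image_eqI[of "(a, b)"]) (use that in auto)
      ultimately show "r \<in> ?S \<union> (\<lambda>(a, b). (a + b) / 2) ` (?S \<times> ?S) \<union> (\<lambda>a. a + 1) ` ?S \<union> (\<lambda>a. a - 1) ` ?S \<union> {0}"
        unfolding Rep_def by blast
    qed
    then show ?thesis by (rule finite_subset) (intro finite_UnI finite_imageI finite_cartesian_product finBad, simp)
  qed
  obtain K where "\<And>x. card {r. Rep x r} \<le> K" using Suc.IH[OF Rep depRep finRep] by blast
  from cover_by_terms[OF Rep finRep this] obtain T where T: "finite T" "\<And>\<tau>. \<tau> \<in> T \<Longrightarrow> dt \<tau>"
    "\<And>x r. Rep x r \<Longrightarrow> \<exists>\<tau>\<in>T. r = \<tau> x" by metis
  \<comment> \<open>Truncation hides coordinate \<open>m\<close> from \<open>\<tau>\<close>, so that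
    the substituted family has only \<open>m\<close> parameters and the induction hypothesis
    applies.\<close>
  have "\<exists>N. \<forall>x. card {t. P (x(m := \<tau> (trunc m x))) t} \<le> N" if "\<tau> \<in> T" for \<tau>
  proof (rule Suc.IH)
    have \<tau>: "dt (\<lambda>x. \<tau> (trunc m x))"
      using dt_subst[OF T(2)[OF that], of "\<lambda>i x. trunc m x i"] dt_trunc by simp
    show "defp2 (\<lambda>x t. P (x(m := \<tau> (trunc m x))) t)"
      unfolding defp2_def
      by (rule defp2_subst[OF Suc.prems(1)])
        (use dt_shift[OF dt_fun_upd[OF \<tau>]] dt_var in auto)
    show "dep m (\<lambda>x. P (x(m := \<tau> (trunc m x))))"
      unfolding dep_def
    proof (intro allI impI)
      fix x y :: "nat \<Rightarrow> real" assume *: "\<forall>i<m. x i = y i"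
      then have "trunc m x = trunc m y" by (auto simp: trunc_def fun_eq_iff)
      then show "P (x(m := \<tau> (trunc m x))) = P (y(m := \<tau> (trunc m y)))"
        using * by (intro depD[OF Suc.prems(2)]) auto
    qed
  qed (rule Suc.prems(3))
  then obtain N where N: "\<And>\<tau> x. \<tau> \<in> T \<Longrightarrow> card {t. P (x(m := \<tau> (trunc m x))) t} \<le> N \<tau>" by metis
  have "card {t. P x t} \<le> (\<Sum>\<tau>\<in>T. N \<tau>)" for x
  proof -
    obtain r where r: "Rep x r" "card {t. P x t} = card {t. P (x(m := r)) t}"
    proof (cases "Bad x (x m)")
      case True
      then show thesis using that[of "x m"] by (simp add: Rep_def)
    next
      case False
      have loc: "\<exists>d>0. \<forall>s'. s - d < s' \<and> s' < s + d \<longrightarrow> card {t. B x s' t} = card {t. B x s t}"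
        if "s \<notin> {s. Bad x s}" for s
      proof -
        have "good (B x) s" using that by (simp add: Bad_def)
        then obtain d where "0 < d"
          "\<And>s'. s - d < s' \<Longrightarrow> s' < s + d \<Longrightarrow> card {t. B x s' t} = card {t. B x s t}"
          by (rule good_card_const) blast
        then show ?thesis by blast
      qed
      obtain r where "card {t. B x r t} = card {t. B x (x m) t}"
        "(\<exists>a\<in>{s. Bad x s}. \<exists>b\<in>{s. Bad x s}. r = (a + b) / 2) \<or> (\<exists>a\<in>{s. Bad x s}. r = a + 1 \<or> r = a - 1) \<or> r = 0"
        by (rule representative_of_gap[OF finBad _ loc, of "x m"]) (use False in auto)
      then show thesis using that[of r] by (auto simp: B_def Rep_def)
    qed
    have "Rep (trunc m x) r" using r(1) depD[OF depRep, of "trunc m x" x] by simp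
    then obtain \<tau> where \<tau>: "\<tau> \<in> T" "r = \<tau> (trunc m x)" using T(3) by blast
    have "card {t. P x t} \<le> N \<tau>" using N[OF \<tau>(1), of x] r \<tau> by simp
    also have "\<dots> \<le> (\<Sum>\<tau>\<in>T. N \<tau>)" using T(1) \<tau>(1) by (simp add: member_le_sum)
    finally show ?thesis .
  qed
  then show ?case by blast
qed

lemma uniform_finiteness:
  assumes "defp2 P" "\<And>x. finite {t. P x t}"
  obtains N where "\<And>x. card {t. P x t} \<le> N"
  using uniform_finiteness_dep[OF assms(1) _ assms(2)] dep_defp2[OF assms(1)] by blast

end

section \<open>Constructible functions and Fubini\<close>

lemma eventually_nhds_real:
  "eventually P (nhds (t :: real)) \<longleftrightarrow> (\<exists>d. 0 < d \<and> (\<forall>u. t - d < u \<and> u < t + d \<longrightarrow> P u))"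
proof -
  have "dist u t < d \<longleftrightarrow> t - d < u \<and> u < t + d" for u d
    by (auto simp: dist_real_def abs_less_iff)
  then show ?thesis unfolding eventually_nhds_metric by simp
qed

definition llim :: "(real \<Rightarrow> int) \<Rightarrow> real \<Rightarrow> int" where
  "llim f t = (THE c. eventually (\<lambda>s. f s = c) (at_left t))"

lemma llim_eq:
  assumes "eventually (\<lambda>s. f s = c) (at_left t)"
  shows "llim f t = c"
  unfolding llim_def
proof (rule the_equality, fact)
  fix c' assume "eventually (\<lambda>s. f s = c') (at_left t)"
  with assms have "eventually (\<lambda>s. c' = c) (at_left t)" by eventually_elim auto
  then show "c' = c" by simp
qed

lemma tame_reflect:
  assumes "tame f"
  shows "tame (\<lambda>t. f (- t))"
proof -
  obtain S where S: "finite S" "\<And>a b. a \<le> b \<Longrightarrow> {a..b} \<inter> S = {} \<Longrightarrow> f a = f b"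
    using assms(1) by (rule tameE) blast
  have "f (- a) = f (- b)" if "a \<le> b" "{a..b} \<inter> uminus ` S = {}" for a b
  proof -
    have "x \<notin> S" if "x \<in> {-b..-a}" for x
    proof
      assume "x \<in> S"
      then have "- x \<in> uminus ` S" by blast
      moreover have "- x \<in> {a..b}" using that by auto
      ultimately show False using \<open>{a..b} \<inter> uminus ` S = {}\<close> by blast
    qed
    then show ?thesis using S(2)[of "-b" "-a"] that(1) by force
  qed
  then show ?thesis unfolding tame_def using S(1) by (intro exI[of _ "uminus ` S"]) blast
qed

lemma ev_llim:
  assumes "tame f"
  shows "eventually (\<lambda>s. f s = llim f t) (at_left t)"
proof -
  obtain c where "eventually (\<lambda>s. f (- s) = c) (at_right (- t))"
    using tame_right[OF tame_reflect[OF assms]] by blast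
  then have "eventually (\<lambda>s. f s = c) (at_left t)" by (simp add: eventually_at_left_to_right)
  with llim_eq[OF this] show ?thesis by simp
qed

lemma tame_finite_range:
  fixes f :: "real \<Rightarrow> int"
  assumes "finite C" "\<And>t. f t \<in> C" "\<And>c. c \<in> C \<Longrightarrow> tame (\<lambda>t. f t = c)"
  shows "tame f"
proof -
  have "tame (\<lambda>t. \<Sum>c\<in>C. c * of_bool (f t = c))"
    using assms by (intro Eint_sum(1) tame_comp[of _ "\<lambda>b. c * of_bool b" for c]) auto
  moreover have "(\<Sum>c\<in>C. c * of_bool (f t = c)) = f t" for t
    using assms by (simp add: of_bool_def sum.delta if_distrib cong: if_cong)
  ultimately show ?thesis by simp
qed

text \<open>The gap containing \<open>s\<close> is encoded by the set of elements of \<open>S\<close> below \<open>s\<close>.\<close>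

lemma gaps_of_finite_set:
  fixes S :: "real set"
  assumes "finite S"
  shows "\<exists>\<J>. finite \<J> \<and> (\<forall>J\<in>\<J>. open J \<and> is_interval J \<and> J \<noteq> {} \<and> J \<inter> S = {}) \<and>
    (\<forall>s. s \<notin> S \<longrightarrow> (\<exists>!J. J \<in> \<J> \<and> s \<in> J))"
proof -
  define gap where "gap L = {s. s \<notin> S \<and> {a \<in> S. a < s} = L}" for L
  define \<J> where "\<J> = gap ` Pow S - {{}}"
  show ?thesis
  proof (intro exI[of _ \<J>] conjI ballI[where A = \<J>] allI impI)
    show "finite \<J>" unfolding \<J>_def using assms by simp
    fix J assume "J \<in> \<J>"
    note that = this
    have "open J \<and> is_interval J \<and> J \<noteq> {} \<and> J \<inter> S = {}"
    proof -
      have "J \<in> gap ` Pow S" "J \<noteq> {}" using that by (simp_all add: \<J>_def)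
      then obtain L where L: "L \<subseteq> S" "J = gap L" "J \<noteq> {}" by (metis PowD imageE)
      have eq: "gap L = (\<Inter>a\<in>S. if a \<in> L then {a<..} else {..<a})" (is "_ = ?R")
      proof (intro equalityI subsetI)
        fix s assume "s \<in> gap L"
        then have s: "s \<notin> S" "{a \<in> S. a < s} = L" by (simp_all add: gap_def)
        have "s \<in> (if a \<in> L then {a<..} else {..<a})" if "a \<in> S" for a
        proof -
          have "a \<noteq> s" using s(1) that by blast
          then show ?thesis using s(2) that by auto
        qed
        then show "s \<in> ?R" by blast
      next
        fix s assume s: "s \<in> ?R"
        have *: "(if a \<in> L then a < s else s < a)" if "a \<in> S" for a
        proof -
          have "s \<in> (if a \<in> L then {a<..} else {..<a})" using s that by blast
          then show ?thesis by (simp split: if_splits)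
        qed
        have "s \<notin> S" using *[of s] by (auto split: if_splits)
        moreover have "{a \<in> S. a < s} = L"
          using * L(1) by (auto split: if_splits dest: order.asym)
        ultimately show "s \<in> gap L" by (simp add: gap_def)
      qed
      have "open ?R" using assms by (intro open_INT) auto
      moreover have "is_interval ?R"
        unfolding is_interval_1
      proof (intro ballI allI impI INT_I)
        fix u v x a assume *: "u \<in> ?R" "v \<in> ?R" "u \<le> x \<and> x \<le> v" "a \<in> S"
        then have "u \<in> (if a \<in> L then {a<..} else {..<a})" "v \<in> (if a \<in> L then {a<..} else {..<a})"
          by blast+
        then show "x \<in> (if a \<in> L then {a<..} else {..<a})" using *(3) by (auto split: if_splits)
      qed
      moreover have "gap L \<inter> S = {}" by (auto simp: gap_def)
      ultimately show ?thesis using L eq by simp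
    qed
    then show "open J" "is_interval J" "J \<noteq> {}" "J \<inter> S = {}" by simp_all
  next
    show "\<exists>!J. J \<in> \<J> \<and> s \<in> J" if "s \<notin> S" for s
    proof (rule ex1I[of _ "gap {a \<in> S. a < s}"])
      have "s \<in> gap {a \<in> S. a < s}" using that by (simp add: gap_def)
      then show "gap {a \<in> S. a < s} \<in> \<J> \<and> s \<in> gap {a \<in> S. a < s}" by (auto simp: \<J>_def)
      show "J = gap {a \<in> S. a < s}" if "J \<in> \<J> \<and> s \<in> J" for J
        using that by (auto simp: \<J>_def gap_def)
    qed
  qed
qed

section \<open>Interchange of integrals for a graph and for the region above it\<close>

definition Fub :: "(real \<Rightarrow> real \<Rightarrow> int) \<Rightarrow> bool" where
  "Fub f \<longleftrightarrow> Eint (\<lambda>s. Eint (\<lambda>t. f s t)) = Eint (\<lambda>t. Eint (\<lambda>s. f s t))"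

lemma Eint_mult_right: "tame f \<Longrightarrow> Eint (\<lambda>t. f t * c) = Eint f * c"
  using Eint_cmult[of f c] by (simp add: mult.commute)

lemma Fub_point:
  assumes "tame b"
  shows "Fub (\<lambda>s t. of_bool (s = p) * b t)"
  unfolding Fub_def
  by (simp add: Eint_cmult[OF assms] Eint_mult_right[OF tame_point] Eint_point)

text \<open>Both iterated integrals are -1. With \<open>s\<close> innermost, either each horizontal
  line meets the graph at most once, and those that meet it form the image of \<open>J\<close>,
  again an open interval; or the graph lies in a single horizontal line.\<close>

lemma Fub_graph:
  assumes J: "open J" "is_interval J" "J \<noteq> {}" and g: "continuous_on J g" "inj_on g J \<or> (\<exists>c. \<forall>s\<in>J. g s = c)"
  shows "Fub (\<lambda>s t. of_bool (s \<in> J) * of_bool (t = g s))"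
proof -
  have l: "Eint (\<lambda>s. Eint (\<lambda>t. of_bool (s \<in> J) * of_bool (t = g s))) = -1"
    by (simp add: Eint_cmult[OF tame_point] Eint_point Eint_open_interval[OF J])
  have r: "Eint (\<lambda>t. Eint (\<lambda>s. of_bool (s \<in> J) * of_bool (t = g s))) = -1"
    using g(2)
  proof
    assume inj: "inj_on g J"
    have "(\<lambda>s. of_bool (s \<in> J) * of_bool (t = g s) :: int) =
        (if t \<in> g ` J then (\<lambda>s. of_bool (s = inv_into J g t)) else (\<lambda>s. 0))" for t
      using inj by (auto simp: fun_eq_iff f_inv_into_f inv_into_into)
    then have "Eint (\<lambda>s. of_bool (s \<in> J) * of_bool (t = g s)) = of_bool (t \<in> g ` J)" for t
      by (simp add: Eint_point)
    moreover have "Eint (\<lambda>t. of_bool (t \<in> g ` J)) = -1"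
    proof (rule Eint_open_interval)
      show "open (g ` J)" using injective_into_1d_imp_open_map_UNIV[OF J(1) g(1) inj] by simp
      show "is_interval (g ` J)"
        using connected_continuous_image[OF g(1)] J(2) is_interval_connected_1 by blast
    qed (use J in simp)
    ultimately show ?thesis by simp
  next
    assume "\<exists>c. \<forall>s\<in>J. g s = c"
    then obtain c where c: "\<And>s. s \<in> J \<Longrightarrow> g s = c" by blast
    have "(\<lambda>s. of_bool (s \<in> J) * of_bool (t = g s) :: int) = (\<lambda>s. of_bool (s \<in> J) * of_bool (t = c))" for t
      using c by auto
    then have "Eint (\<lambda>s. of_bool (s \<in> J) * of_bool (t = g s)) = - 1 * of_bool (t = c)" for t
      using Eint_mult_right[OF tame_of_bool[OF J(2)]] by (simp add: Eint_open_interval[OF J])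
    then show ?thesis using Eint_cmult[OF tame_point, of "-1" c] by (simp only:) (simp add: Eint_point)
  qed
  show ?thesis unfolding Fub_def l r ..
qed

text \<open>Both iterated integrals are 1, as for a product of two open intervals. For fixed
  \<open>t\<close> the points \<open>s\<close> with \<open>g s < t\<close> form an open interval
  because \<open>g\<close> is monotone, and it is nonempty exactly for \<open>t\<close> in the open
  interval \<open>U\<close>.\<close>

lemma Fub_above:
  assumes J: "open J" "is_interval J" "J \<noteq> {}" and g: "continuous_on J g" "inj_on g J \<or> (\<exists>c. \<forall>s\<in>J. g s = c)"
  shows "Fub (\<lambda>s t. of_bool (s \<in> J) * of_bool (g s < t))"
proof -
  have ray: "is_interval {a<..}" "Eint (\<lambda>t. of_bool (a < t)) = -1" for a :: real
    using Eint_open_interval[of "{a<..}"] by (auto simp: is_interval_1)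
  have ray2: "tame (\<lambda>t. of_bool (a < t) :: int)" for a
    using tame_of_bool[OF ray(1)] by simp
  have l: "Eint (\<lambda>s. Eint (\<lambda>t. of_bool (s \<in> J) * of_bool (g s < t))) = 1"
    using Eint_mult_right[OF tame_of_bool[OF J(2)], of "-1"]
    by (simp add: Eint_cmult[OF ray2] ray(2) Eint_open_interval[OF J])
  define U where "U = {t. \<exists>s\<in>J. g s < t}"
  have between: "g x < t" if "u \<in> J" "v \<in> J" "u \<le> x" "x \<le> v" "g u < t" "g v < t" for u v x t
  proof -
    consider "x = u" | "x = v" | "u < x" "x < v" using \<open>u \<le> x\<close> \<open>x \<le> v\<close> by fastforce
    then show ?thesis
    proof cases
      case 3
      have sub: "{u..v} \<subseteq> J" using J(2) that(1,2) unfolding is_interval_1 by (meson atLeastAtMost_iff subsetI)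
      have x: "x \<in> J" using sub 3 by auto
      from g(2) show ?thesis
      proof
        assume "inj_on g J"
        then have "inj_on g {u..v}" using sub inj_on_subset by blast
        from continuous_inj_imp_mono[OF 3 continuous_on_subset[OF g(1) sub] this]
        show ?thesis using that by linarith
      next
        assume "\<exists>c. \<forall>s\<in>J. g s = c"
        then show ?thesis using x that by fastforce
      qed
    qed (use that in auto)
  qed
  have inner: "Eint (\<lambda>s. of_bool (s \<in> J) * of_bool (g s < t)) = - 1 * of_bool (t \<in> U)" for t
  proof -
    have eq: "(\<lambda>s. of_bool (s \<in> J) * of_bool (g s < t) :: int) = (\<lambda>s. of_bool (s \<in> g -` {..<t} \<inter> J))"
      by auto
    show ?thesis
    proof (cases "t \<in> U")
      case True
      have "Eint (\<lambda>s. of_bool (s \<in> g -` {..<t} \<inter> J)) = -1"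
      proof (rule Eint_open_interval)
        show "open (g -` {..<t} \<inter> J)"
          using g(1)[unfolded continuous_on_open_vimage[OF J(1)]] open_lessThan by simp
        show "is_interval (g -` {..<t} \<inter> J)"
          unfolding is_interval_1
        proof (intro ballI allI impI)
          fix u v x assume *: "u \<in> g -` {..<t} \<inter> J" "v \<in> g -` {..<t} \<inter> J" "u \<le> x \<and> x \<le> v"
          then have "x \<in> J" using J(2) unfolding is_interval_1 by (meson IntD2)
          then show "x \<in> g -` {..<t} \<inter> J" using between[of u v x t] * by auto
        qed
      qed (use True in \<open>auto simp: U_def\<close>)
      then show ?thesis unfolding eq using True by simp
    next
      case False
      then have "(\<lambda>s. of_bool (s \<in> g -` {..<t} \<inter> J) :: int) = (\<lambda>s. 0)"
        by (intro ext) (auto simp: U_def)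
      then show ?thesis unfolding eq using False by simp
    qed
  qed
  have U: "open U" "is_interval U" "U \<noteq> {}"
  proof -
    have "U = (\<Union>s\<in>J. {g s<..})" by (auto simp: U_def)
    then show "open U" by auto
    show "is_interval U"
      unfolding is_interval_1
    proof (intro ballI allI impI)
      fix u v x assume "u \<in> U" "u \<le> x \<and> x \<le> v"
      then obtain s where "s \<in> J" "g s < x" by (auto simp: U_def)
      then show "x \<in> U" by (auto simp: U_def)
    qed
    obtain s where "s \<in> J" using J(3) by blast
    then have "g s + 1 \<in> U" by (auto simp: U_def intro!: bexI[of _ s])
    then show "U \<noteq> {}" by blast
  qed
  have r: "Eint (\<lambda>t. Eint (\<lambda>s. of_bool (s \<in> J) * of_bool (g s < t))) = 1"
    unfolding inner Eint_cmult[OF tame_of_bool[OF U(2)]] Eint_open_interval[OF U] by simp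
  show ?thesis unfolding Fub_def l r ..
qed

context o_minimal_structure
begin

section \<open>Constructible functions of several variables\<close>

definition CF :: "((nat \<Rightarrow> real) \<Rightarrow> int) \<Rightarrow> bool" where
  "CF F \<longleftrightarrow> finite (range F) \<and> (\<forall>c. defp (\<lambda>x. F x = c))"

lemma CFI: "finite C \<Longrightarrow> (\<And>x. F x \<in> C) \<Longrightarrow> (\<And>c. defp (\<lambda>x. F x = c)) \<Longrightarrow> CF F"
  unfolding CF_def by (auto intro: finite_subset)

lemma CF_of_bool: "defp P \<Longrightarrow> CF (\<lambda>x. of_bool (P x))"
proof (rule CFI[of "{0, 1}"])
  fix c :: int assume P: "defp P"
  have "defp (\<lambda>x. P x \<and> c = 1 \<or> \<not> P x \<and> c = 0)" by (intro defp_disj defp_conj defp_not defp_const P)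
  then show "defp (\<lambda>x. of_bool (P x) = c)" by (rule back_subst[of defp]) (auto simp: fun_eq_iff)
qed auto

lemma CF_comb:
  assumes "CF F" "CF G"
  shows "CF (\<lambda>x. h (F x) (G x))"
proof (rule CFI[of "(\<lambda>(a, b). h a b) ` (range F \<times> range G)"])
  show "finite ((\<lambda>(a, b). h a b) ` (range F \<times> range G))" using assms by (simp add: CF_def)
  fix c
  have "defp (\<lambda>x. \<exists>a\<in>range F. \<exists>b\<in>range G. (h a b = c \<and> F x = a) \<and> G x = b)"
    using assms by (intro defp_bex_finite defp_conj defp_const) (auto simp: CF_def)
  then show "defp (\<lambda>x. h (F x) (G x) = c)" by (rule back_subst[of defp]) (auto simp: fun_eq_iff)
qed auto

lemma CF_const: "CF (\<lambda>x. c)"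
  unfolding CF_def by (auto intro: defp_const)

lemma CF_add: "CF F \<Longrightarrow> CF G \<Longrightarrow> CF (\<lambda>x. F x + G x)"
  by (rule CF_comb)

lemma CF_diff: "CF F \<Longrightarrow> CF G \<Longrightarrow> CF (\<lambda>x. F x - G x)"
  by (rule CF_comb)

lemma CF_mult: "CF F \<Longrightarrow> CF G \<Longrightarrow> CF (\<lambda>x. F x * G x)"
  by (rule CF_comb)

lemma CF_cmult: "CF F \<Longrightarrow> CF (\<lambda>x. c * F x)"
  by (rule CF_mult[OF CF_const])

lemma CF_sum: "finite I \<Longrightarrow> (\<And>i. i \<in> I \<Longrightarrow> CF (F i)) \<Longrightarrow> CF (\<lambda>x. \<Sum>i\<in>I. F i x)"
  by (induction I rule: finite_induct) (auto intro: CF_const CF_add)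

lemma defp_CF_eq: "CF F \<Longrightarrow> defp (\<lambda>x. F x = c)"
  by (simp add: CF_def)

lemma defp_CF_eq2:
  assumes "CF F" "CF G"
  shows "defp (\<lambda>x. F x = G x)"
  using defp_CF_eq[OF CF_diff[OF assms], of 0] by simp

lemma CF_subst: "CF F \<Longrightarrow> (\<And>i. dt (\<tau> i)) \<Longrightarrow> CF (\<lambda>x. F (\<lambda>i. \<tau> i x))"
  using CFI[of "range F" "\<lambda>x. F (\<lambda>i. \<tau> i x)"] defp_subst[of "\<lambda>x. F x = c" \<tau> for c]
  unfolding CF_def by blast

lemma CF_tame:
  assumes "CF F"
  shows "tame (\<lambda>t. F (x(j := t)))"
proof (rule tame_finite_range[of "range F"])
  show "tame (\<lambda>t. F (x(j := t)) = c)" for c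
    using defp2_tame[OF defp2_update[OF defp_CF_eq[OF assms]]] .
qed (use assms in \<open>auto simp: CF_def\<close>)

text \<open>The one-sided limit of a tame function is attained nearby, so no new values arise, and
  having limit \<open>c\<close> is a first-order condition.\<close>

lemma CF_rlim:
  assumes F: "CF F"
  shows "CF (\<lambda>x. rlim (\<lambda>t. F (x(j := t))) (x j))"
proof -
  have iff: "rlim (\<lambda>t. F (x(j := t))) (x j) = c \<longleftrightarrow> (\<exists>d. 0 < d \<and> (\<forall>s. x j < s \<and> s < x j + d \<longrightarrow> F (x(j := s)) = c))" for x c
  proof -
    have "rlim (\<lambda>t. F (x(j := t))) (x j) = c \<longleftrightarrow> eventually (\<lambda>s. F (x(j := s)) = c) (at_right (x j))"
      using ev_rlim[OF CF_tame[OF F]] rlim_eq by metis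
    also have "\<dots> \<longleftrightarrow> (\<exists>d. 0 < d \<and> (\<forall>s. x j < s \<and> s < x j + d \<longrightarrow> F (x(j := s)) = c))"
      unfolding eventually_at_right_field
    proof safe
      fix b assume "x j < b" "\<forall>y>x j. y < b \<longrightarrow> F (x(j := y)) = c"
      then show "\<exists>d>0. \<forall>s. x j < s \<and> s < x j + d \<longrightarrow> F (x(j := s)) = c"
        by (intro exI[of _ "b - x j"]) simp
    next
      fix d assume "0 < d" "\<forall>s. x j < s \<and> s < x j + d \<longrightarrow> F (x(j := s)) = c"
      then show "\<exists>b>x j. \<forall>y>x j. y < b \<longrightarrow> F (x(j := y)) = c"
        by (intro exI[of _ "x j + d"]) simp
    qed
    finally show ?thesis .
  qed
  show ?thesis
  proof (rule CFI[of "range F"])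
    show "finite (range F)" using F by (simp add: CF_def)
    have U: "defp2 (\<lambda>x t. F (x(j := t)) = c)" for c
      by (rule defp2_update[OF defp_CF_eq[OF F]])
    show "defp (\<lambda>x. rlim (\<lambda>t. F (x(j := t))) (x j) = c)" for c
      unfolding iff by (intro defp_intros defp2_subst[OF U] dt_intros)
    fix x
    obtain d where "0 < d" "\<forall>s. x j < s \<and> s < x j + d \<longrightarrow> F (x(j := s)) = rlim (\<lambda>t. F (x(j := t))) (x j)"
      using iff[of x "rlim (\<lambda>t. F (x(j := t))) (x j)"] by blast
    then have "F (x(j := x j + d / 2)) = rlim (\<lambda>t. F (x(j := t))) (x j)" by simp
    then show "rlim (\<lambda>t. F (x(j := t))) (x j) \<in> range F" by (metis rangeI)
  qed
qed

lemma CF_lbot: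
  assumes F: "CF F"
  shows "CF (\<lambda>x. lbot (\<lambda>t. F (x(j := t))))"
proof -
  have iff: "lbot (\<lambda>t. F (x(j := t))) = c \<longleftrightarrow> (\<exists>b. \<forall>s. s \<le> b \<longrightarrow> F (x(j := s)) = c)" for x c
    using ev_lbot[OF CF_tame[OF F, of x j]] lbot_eq[of "\<lambda>t. F (x(j := t))" c]
    unfolding eventually_at_bot_linorder by metis
  show ?thesis
  proof (rule CFI[of "range F"])
    show "finite (range F)" using F by (simp add: CF_def)
    have U: "defp2 (\<lambda>x t. F (x(j := t)) = c)" for c
      by (rule defp2_update[OF defp_CF_eq[OF F]])
    show "defp (\<lambda>x. lbot (\<lambda>t. F (x(j := t))) = c)" for c
      unfolding iff by (intro defp_intros defp2_subst[OF U] dt_intros)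
    fix x
    obtain b where "\<forall>s. s \<le> b \<longrightarrow> F (x(j := s)) = lbot (\<lambda>t. F (x(j := t)))"
      using iff[of x "lbot (\<lambda>t. F (x(j := t)))"] by blast
    then have "F (x(j := b)) = lbot (\<lambda>t. F (x(j := t)))" by simp
    then show "lbot (\<lambda>t. F (x(j := t))) \<in> range F" by (metis rangeI)
  qed
qed

text \<open>Uniform finiteness makes the range finite, and each single value is described by two
  \<open>atleast\<close> conditions.\<close>

lemma CF_card:
  assumes Q: "defp2 Q" and fin: "\<And>x. finite {t. Q x t}"
  shows "CF (\<lambda>x. int (card {t. Q x t}))"
proof -
  obtain N where N: "\<And>x. card {t. Q x t} \<le> N" using uniform_finiteness[OF assms] by blast
  show ?thesis
  proof (rule CFI[of "int ` {..N}"])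
    show "int (card {t. Q x t}) \<in> int ` {..N}" for x using N by simp
    fix c
    \<comment> \<open>The guard excludes negative \<open>c\<close>, for which \<open>nat c\<close>
      would be 0.\<close>
    have "defp (\<lambda>x. (0 \<le> c \<and> atleast (nat c) (Q x)) \<and> \<not> atleast (Suc (nat c)) (Q x))"
      by (intro defp_conj defp_not defp_const defp_atleast Q)
    then show "defp (\<lambda>x. int (card {t. Q x t}) = c)"
      unfolding atleast_iff_card[OF fin] by (rule back_subst[of defp]) auto
  qed simp
qed

definition I :: "nat \<Rightarrow> ((nat \<Rightarrow> real) \<Rightarrow> int) \<Rightarrow> (nat \<Rightarrow> real) \<Rightarrow> int" where
  "I j F x = Eint (\<lambda>t. F (x(j := t)))"

text \<open>Jump heights take finitely many values \<open>k\<close>, and the number of jumps of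
  height \<open>k\<close> is a constructible function of the parameters; the integral is a
  combination of these numbers and a limit.\<close>

lemma CF_I:
  assumes F: "CF F"
  shows "CF (I j F)"
proof -
  \<comment> \<open>At \<open>x(j := t)\<close> this is the jump at \<open>t\<close> of the section
    through \<open>x\<close>, so the jumps are counted over a definable family.\<close>
  define G where "G x = F x - rlim (\<lambda>t. F (x(j := t))) (x j)" for x
  have G: "CF G" unfolding G_def by (intro CF_diff F CF_rlim)
  define C where "C = range G - {0}"
  have "finite C" using G by (simp add: C_def CF_def)
  have fin: "finite {t. G (x(j := t)) \<noteq> 0}" for x
    using tame_finite_jumps[OF CF_tame[OF F, of x j]] by (simp add: G_def)
  have "I j F x = (\<Sum>k\<in>C. k * int (card {t. G (x(j := t)) = k})) - lbot (\<lambda>t. F (x(j := t)))" for x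
  proof -
    have "(\<Sum>t | F (x(j := t)) \<noteq> rlim (\<lambda>t. F (x(j := t))) t. F (x(j := t)) - rlim (\<lambda>t. F (x(j := t))) t)
        = (\<Sum>t | G (x(j := t)) \<noteq> 0. G (x(j := t)))"
      by (simp add: G_def)
    also have "\<dots> = (\<Sum>k\<in>C. \<Sum>t | t \<in> {t. G (x(j := t)) \<noteq> 0} \<and> G (x(j := t)) = k. G (x(j := t)))"
      using fin[of x] \<open>finite C\<close> by (subst sum.group) (auto simp: C_def)
    also have "\<dots> = (\<Sum>k\<in>C. k * int (card {t. G (x(j := t)) = k}))"
    proof (rule sum.cong[OF refl])
      fix k assume "k \<in> C"
      then have "{t. t \<in> {t. G (x(j := t)) \<noteq> 0} \<and> G (x(j := t)) = k} = {t. G (x(j := t)) = k}"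
        by (auto simp: C_def)
      then show "(\<Sum>t | t \<in> {t. G (x(j := t)) \<noteq> 0} \<and> G (x(j := t)) = k. G (x(j := t))) = k * int (card {t. G (x(j := t)) = k})"
        by simp
    qed
    finally show ?thesis by (simp add: I_def Eint_def)
  qed
  moreover have "CF (\<lambda>x. (\<Sum>k\<in>C. k * int (card {t. G (x(j := t)) = k})) - lbot (\<lambda>t. F (x(j := t))))"
  proof (intro CF_diff CF_lbot F CF_sum \<open>finite C\<close> CF_mult CF_const CF_card)
    show "defp2 (\<lambda>x t. G (x(j := t)) = k)" for k by (rule defp2_update[OF defp_CF_eq[OF G]])
    show "finite {t. G (x(j := t)) = k}" if "k \<in> C" for k x
      using fin[of x] by (rule finite_subset[rotated]) (use that in \<open>auto simp: C_def\<close>)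
  qed
  ultimately show ?thesis by presburger
qed

section \<open>Interchange of two integrations\<close>

definition CF2 :: "(real \<Rightarrow> real \<Rightarrow> int) \<Rightarrow> bool" where
  "CF2 f \<longleftrightarrow> CF (\<lambda>x. f (x 0) (x 1))"

lemma CF2_subst: "CF2 f \<Longrightarrow> dt \<tau> \<Longrightarrow> dt \<rho> \<Longrightarrow> CF (\<lambda>x. f (\<tau> x) (\<rho> x))"
  using CF_subst[of "\<lambda>x. f (x 0) (x 1)" "\<lambda>i. if i = 0 then \<tau> else \<rho>"] by (simp add: CF2_def)

lemma CF_tame1: "CF (\<lambda>x. a (x 0)) \<Longrightarrow> tame a"
  using CF_tame[of "\<lambda>x. a (x 0)" _ 0] by simp

lemma CF2_tame:
  assumes "CF2 f"
  shows "tame (\<lambda>t. f s t)" "tame (\<lambda>s. f s t)"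
  using CF2_subst[OF assms, of "\<lambda>x. s" "\<lambda>x. x 0"] CF2_subst[OF assms, of "\<lambda>x. x 0" "\<lambda>x. t"]
  by (auto intro!: CF_tame1 dt_intros)

lemma CF2_inner:
  assumes "CF2 f"
  shows "tame (\<lambda>s. Eint (f s))" "tame (\<lambda>t. Eint (\<lambda>s. f s t))"
proof -
  have "CF (I 1 (\<lambda>x. f (x 0) (x 1)))" using assms unfolding CF2_def by (rule CF_I)
  then have "CF (\<lambda>x. Eint (f (x 0)))" by (simp add: I_def[abs_def])
  then show "tame (\<lambda>s. Eint (f s))" by (rule CF_tame1)
  have "CF (I 1 (\<lambda>x. f (x 1) (x 0)))" using CF2_subst[OF assms] dt_var by (intro CF_I) blast
  then have "CF (\<lambda>x. Eint (\<lambda>s. f s (x 0)))" by (simp add: I_def[abs_def])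
  then show "tame (\<lambda>t. Eint (\<lambda>s. f s t))" by (rule CF_tame1)
qed

lemma CF2_add: "CF2 f \<Longrightarrow> CF2 g \<Longrightarrow> CF2 (\<lambda>s t. f s t + g s t)"
  unfolding CF2_def by (rule CF_add)

lemma Fub_add:
  assumes "CF2 f" "CF2 g" "Fub f" "Fub g"
  shows "Fub (\<lambda>s t. f s t + g s t)"
  using assms unfolding Fub_def by (simp add: Eint_add CF2_tame CF2_inner)

lemma Fub_cmult:
  assumes "CF2 f" "Fub f"
  shows "Fub (\<lambda>s t. c * f s t)"
  using assms unfolding Fub_def by (simp add: Eint_cmult CF2_tame CF2_inner)

lemma Fub_sum:
  assumes "finite K" "\<And>i. i \<in> K \<Longrightarrow> CF2 (f i)" "\<And>i. i \<in> K \<Longrightarrow> Fub (f i)"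
  shows "CF2 (\<lambda>s t. \<Sum>i\<in>K. f i s t) \<and> Fub (\<lambda>s t. \<Sum>i\<in>K. f i s t)"
  using assms
proof (induction K rule: finite_induct)
  case empty
  then show ?case by (simp add: CF2_def CF_const Fub_def)
next
  case (insert i K)
  then show ?case using CF2_add[of "f i"] Fub_add[of "f i"] by simp
qed

lemma defp_interval:
  assumes "open J" "is_interval J" "dt \<tau>"
  shows "defp (\<lambda>x. \<tau> x \<in> J)"
proof -
  have "defp (\<lambda>x. x 0 \<in> J)" using defp_unary[of "{J}"] assms by simp
  from defp_subst[OF this, of "\<lambda>i. \<tau>"] show ?thesis using assms(3) by simp
qed

text \<open>The coefficient function \<open>a\<close> is cut into point masses and constants on intervals on which \<open>g\<close> is
  continuous and injective or constant.\<close>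

lemma Fub_over_graph:
  assumes a: "CF (\<lambda>x. a (x 0))" and g: "du g"
    and R: "\<And>\<tau> \<rho>. dt \<tau> \<Longrightarrow> dt \<rho> \<Longrightarrow> defp (\<lambda>x. R (\<tau> x) (\<rho> x))"
    and local_case: "\<And>J. open J \<Longrightarrow> is_interval J \<Longrightarrow> J \<noteq> {} \<Longrightarrow> continuous_on J g \<Longrightarrow>
      inj_on g J \<or> (\<exists>c. \<forall>s\<in>J. g s = c) \<Longrightarrow> Fub (\<lambda>s t. of_bool (s \<in> J) * of_bool (R (g s) t))"
  shows "Fub (\<lambda>s t. a s * of_bool (R (g s) t))"
proof -
  have CFR: "CF2 (\<lambda>s t. of_bool (R (g s) t))"
    unfolding CF2_def by (intro CF_of_bool R dt_unary[OF g] dt_intros)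
  obtain S1 where S1: "finite S1" "\<And>u v. u \<le> v \<Longrightarrow> {u..v} \<inter> S1 = {} \<Longrightarrow> a u = a v"
    using CF_tame1[OF a] by (rule tameE) blast
  obtain S2 where S2: "finite S2"
    "\<And>J. open J \<Longrightarrow> is_interval J \<Longrightarrow> J \<inter> S2 = {} \<Longrightarrow>
      continuous_on J g \<and> (inj_on g J \<or> (\<exists>c. \<forall>s\<in>J. g s = c))"
    using piecewise_injective_or_constant[OF g] by blast
  define S where "S = S1 \<union> S2"
  have S: "finite S" using S1 S2 by (simp add: S_def)
  obtain \<J> where \<J>0: "finite \<J> \<and> (\<forall>J\<in>\<J>. open J \<and> is_interval J \<and> J \<noteq> {} \<and> J \<inter> S = {}) \<and>
    (\<forall>s. s \<notin> S \<longrightarrow> (\<exists>!J. J \<in> \<J> \<and> s \<in> J))"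
    using gaps_of_finite_set[OF S] by (rule exE)
  note \<J> = \<J>0[THEN conjunct1] \<J>0[THEN conjunct2, THEN conjunct1, rule_format]
    \<J>0[THEN conjunct2, THEN conjunct2, rule_format]
  define \<rho> where "\<rho> J = (SOME s. s \<in> J)" for J :: "real set"
  have \<rho>: "\<rho> J \<in> J" if "J \<in> \<J>" for J using \<J>(2)[OF that] some_in_eq unfolding \<rho>_def by blast
  have const: "a s = a (\<rho> J)" if "J \<in> \<J>" "s \<in> J" for s J
  proof -
    have J: "is_interval J" "J \<inter> S1 = {}" using \<J>(2)[OF that(1)] by (auto simp: S_def)
    have sub: "{u..v} \<inter> S1 = {}" if "u \<in> J" "v \<in> J" for u v
      using J that unfolding is_interval_1 by (meson atLeastAtMost_iff disjoint_iff)
    show ?thesis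
    proof (cases "s \<le> \<rho> J")
      case True
      show ?thesis by (rule S1(2)[OF True sub[OF that(2) \<rho>[OF that(1)]]])
    next
      case False
      then have le: "\<rho> J \<le> s" by simp
      show ?thesis by (rule S1(2)[OF le sub[OF \<rho>[OF that(1)] that(2)], symmetric])
    qed
  qed
  have a_eq: "a s = (\<Sum>p\<in>S. a p * of_bool (s = p)) + (\<Sum>J\<in>\<J>. a (\<rho> J) * of_bool (s \<in> J))" for s
  proof (cases "s \<in> S")
    case True
    have "s \<notin> J" if "J \<in> \<J>" for J using \<J>(2)[OF that] True by blast
    then have "(\<Sum>J\<in>\<J>. a (\<rho> J) * of_bool (s \<in> J)) = 0" by simp
    moreover have "(\<Sum>p\<in>S. a p * of_bool (s = p)) = a s"
      using S True by (simp add: of_bool_def if_distrib sum.delta' cong: if_cong)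
    ultimately show ?thesis by simp
  next
    case False
    then obtain J0 where J0: "J0 \<in> \<J>" "s \<in> J0" "\<And>J. J \<in> \<J> \<Longrightarrow> s \<in> J \<Longrightarrow> J = J0" using \<J>(3) by metis
    have "(\<Sum>J\<in>\<J>. a (\<rho> J) * of_bool (s \<in> J)) = (\<Sum>J\<in>\<J>. if J = J0 then a (\<rho> J) else 0)"
    proof (rule sum.cong[OF refl])
      fix J assume "J \<in> \<J>"
      then have "s \<in> J \<longleftrightarrow> J = J0" using J0 by blast
      then show "a (\<rho> J) * of_bool (s \<in> J) = (if J = J0 then a (\<rho> J) else 0)" by simp
    qed
    also have "\<dots> = a (\<rho> J0)" using J0(1) \<J>(1) by simp
    also have "\<dots> = a s" by (rule const[OF J0(1,2), symmetric])
    finally have "(\<Sum>J\<in>\<J>. a (\<rho> J) * of_bool (s \<in> J)) = a s" .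
    moreover have "(\<Sum>p\<in>S. a p * of_bool (s = p)) = 0"
      by (rule sum.neutral) (use False in auto)
    ultimately show ?thesis by simp
  qed
  have 1: "CF2 (\<lambda>s t. \<Sum>p\<in>S. a p * (of_bool (s = p) * of_bool (R (g p) t))) \<and>
      Fub (\<lambda>s t. \<Sum>p\<in>S. a p * (of_bool (s = p) * of_bool (R (g p) t)))"
  proof (rule Fub_sum[OF S])
    fix p
    have *: "CF2 (\<lambda>s t. of_bool (s = p) * of_bool (R (g p) t))"
      unfolding CF2_def by (intro CF_mult CF_of_bool defp_intros R dt_intros)
    then show "CF2 (\<lambda>s t. a p * (of_bool (s = p) * of_bool (R (g p) t)))"
      unfolding CF2_def by (rule CF_cmult)
    show "Fub (\<lambda>s t. a p * (of_bool (s = p) * of_bool (R (g p) t)))"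
      by (intro Fub_cmult[OF *] Fub_point CF2_tame(1)[OF CFR])
  qed
  have 2: "CF2 (\<lambda>s t. \<Sum>J\<in>\<J>. a (\<rho> J) * (of_bool (s \<in> J) * of_bool (R (g s) t))) \<and>
      Fub (\<lambda>s t. \<Sum>J\<in>\<J>. a (\<rho> J) * (of_bool (s \<in> J) * of_bool (R (g s) t)))"
  proof (rule Fub_sum[OF \<J>(1)])
    fix J assume J: "J \<in> \<J>"
    have *: "CF2 (\<lambda>s t. of_bool (s \<in> J) * of_bool (R (g s) t))"
      unfolding CF2_def using \<J>(2)[OF J] by (intro CF_mult CF_of_bool defp_interval R dt_intros dt_unary[OF g]) auto
    then show "CF2 (\<lambda>s t. a (\<rho> J) * (of_bool (s \<in> J) * of_bool (R (g s) t)))"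
      unfolding CF2_def by (rule CF_cmult)
    show "Fub (\<lambda>s t. a (\<rho> J) * (of_bool (s \<in> J) * of_bool (R (g s) t)))"
      using \<J>(2)[OF J] S2(2)[of J] by (intro Fub_cmult[OF *] local_case) (auto simp: S_def)
  qed
  have "a s * of_bool (R (g s) t) = (\<Sum>p\<in>S. a p * (of_bool (s = p) * of_bool (R (g p) t))) +
     (\<Sum>J\<in>\<J>. a (\<rho> J) * (of_bool (s \<in> J) * of_bool (R (g s) t)))" for s t
  proof -
    have "(\<Sum>p\<in>S. a p * (of_bool (s = p) * of_bool (R (g p) t))) = (\<Sum>p\<in>S. a p * of_bool (s = p)) * of_bool (R (g s) t)"
      unfolding sum_distrib_right by (rule sum.cong) auto
    moreover have "(\<Sum>J\<in>\<J>. a (\<rho> J) * (of_bool (s \<in> J) * of_bool (R (g s) t))) = (\<Sum>J\<in>\<J>. a (\<rho> J) * of_bool (s \<in> J)) * of_bool (R (g s) t)"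
      unfolding sum_distrib_right by (rule sum.cong) auto
    ultimately show ?thesis by (subst a_eq) (simp only: distrib_right)
  qed
  then show ?thesis using Fub_add 1 2 by simp
qed

lemma CF_one_sided:
  assumes f: "CF2 f" and g: "du g"
  shows "CF (\<lambda>x. rlim (f (x 0)) (g (x 0)))" "CF (\<lambda>x. llim (f (x 0)) (g (x 0)))"
proof -
  have "CF (\<lambda>x. rlim (\<lambda>t. f (x 0) t) (x 1))"
    using CF_rlim[OF f[unfolded CF2_def], of 1] by simp
  from CF_subst[OF this, of "\<lambda>i x. if i = 0 then x 0 else g (x 0)"]
  show "CF (\<lambda>x. rlim (f (x 0)) (g (x 0)))"
    using dt_var dt_unary[OF g dt_var] by (simp add: dt_if[OF defp_const])
  have ll: "llim h t = rlim (\<lambda>u. h (- u)) (- t)" if "tame h" for h t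
  proof (rule rlim_eq[symmetric])
    show "eventually (\<lambda>s. h (- s) = llim h t) (at_right (- t))"
      using ev_llim[OF that, of t] by (simp add: eventually_at_left_to_right)
  qed
  have "CF2 (\<lambda>s u. f s (- u))" unfolding CF2_def using CF2_subst[OF f dt_var dt_minus[OF dt_var]] .
  from CF_rlim[OF this[unfolded CF2_def], of 1]
  have "CF (\<lambda>x. rlim (\<lambda>u. f (x 0) (- u)) (x 1))" by simp
  from CF_subst[OF this, of "\<lambda>i x. if i = 0 then x 0 else - g (x 0)"]
  have "CF (\<lambda>x. rlim (\<lambda>u. f (x 0) (- u)) (- g (x 0)))"
    using dt_var dt_minus[OF dt_unary[OF g dt_var]] by (simp add: dt_if[OF defp_const])
  then show "CF (\<lambda>x. llim (f (x 0)) (g (x 0)))" by (simp add: ll CF2_tame(1)[OF f])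
qed

text \<open>Discontinuities in \<open>t\<close> are removed one graph at a time, by subtracting
  multiples of the indicators of the graph and of the region above it. A function without
  discontinuities in \<open>t\<close> does not depend on \<open>t\<close>, and both integrals can
  then be read off.\<close>

lemma Fub_of_cover:
  assumes "finite G" "CF2 f" "\<And>g. g \<in> G \<Longrightarrow> du g"
    "\<And>s t. \<not> eventually (\<lambda>u. f s u = f s t) (nhds t) \<Longrightarrow> \<exists>g\<in>G. t = g s"
  shows "Fub f"
  using assms
proof (induction G arbitrary: f rule: finite_induct)
  case empty
  have "f s t = f s 0" for s t
  proof (rule const_on_if_locally_const[where a = "min t 0" and b = "max t 0"])
    fix u
    have "eventually (\<lambda>v. f s v = f s u) (nhds u)" using empty by blast
    then show "\<exists>d>0. \<forall>v. u - d < v \<and> v < u + d \<longrightarrow> f s v = f s u"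
      by (simp only: eventually_nhds_real)
  qed auto
  then have eq: "f = (\<lambda>s t. f s 0)" by blast
  have "tame (\<lambda>s. f s 0)" by (rule CF2_tame[OF empty(1)])
  then have "Eint (\<lambda>s. - f s 0) = - Eint (\<lambda>s. f s 0)" using Eint_cmult[of "\<lambda>s. f s 0" "-1"] by simp
  then show ?case by (subst eq) (simp add: Fub_def)
next
  case (insert g G)
  have g: "du g" using insert.prems by blast
  have tame: "tame (f s)" for s using CF2_tame(1)[OF insert.prems(1)] .
  \<comment> \<open>The limit from the left is the reference: \<open>\<alpha>\<close> is the
    deviation on the graph, \<open>\<beta>\<close> the deviation just above it. After subtracting
    both, the function is locally constant in \<open>t\<close> across the graph.\<close>
  define \<alpha> where "\<alpha> s = f s (g s) - llim (f s) (g s)" for s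
  define \<beta> where "\<beta> s = rlim (f s) (g s) - llim (f s) (g s)" for s
  have \<alpha>: "CF (\<lambda>x. \<alpha> (x 0))" unfolding \<alpha>_def
    by (intro CF_diff CF2_subst[OF insert.prems(1)] CF_one_sided insert.prems(1) g dt_unary[OF g] dt_var)
  have \<beta>: "CF (\<lambda>x. \<beta> (x 0))" unfolding \<beta>_def
    by (intro CF_diff CF_one_sided insert.prems(1) g)
  define A where "A s t = \<alpha> s * of_bool (t = g s)" for s t
  define B where "B s t = \<beta> s * of_bool (g s < t)" for s t
  have CFA: "CF2 A" unfolding CF2_def A_def
    by (intro CF_mult \<alpha> CF_of_bool defp_intros dt_unary[OF g] dt_var)
  have CFB: "CF2 B" unfolding CF2_def B_def
    by (intro CF_mult \<beta> CF_of_bool defp_intros dt_unary[OF g] dt_var)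
  have FA: "Fub A" unfolding A_def
    by (rule Fub_over_graph[OF \<alpha> g, of "\<lambda>a t. t = a"]) (auto intro: defp_intros Fub_graph)
  have FB: "Fub B" unfolding B_def
    by (rule Fub_over_graph[OF \<beta> g, of "\<lambda>a t. a < t"]) (auto intro: defp_intros Fub_above)
  define f' where "f' s t = f s t - A s t - B s t" for s t
  have CF': "CF2 f'" using insert.prems(1) CFA CFB unfolding CF2_def f'_def by (intro CF_diff)
  have "Fub f'"
  proof (rule insert.IH[OF CF'])
    fix s t assume *: "\<not> eventually (\<lambda>u. f' s u = f' s t) (nhds t)"
    show "\<exists>g\<in>G. t = g s"
    proof (rule ccontr)
      assume no: "\<not> (\<exists>g\<in>G. t = g s)"
      have "eventually (\<lambda>u. f' s u = f' s t) (nhds t)"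
      proof (cases "t = g s")
        case True
        have "eventually (\<lambda>u. f' s u = f' s t) (at_right t)"
          using ev_rlim[OF tame[of s], of t] eventually_at_right_less[of t]
        proof eventually_elim
          case (elim u)
          then show ?case using True by (simp add: f'_def A_def B_def \<alpha>_def \<beta>_def)
        qed
        moreover have "eventually (\<lambda>u. u < t) (at_left t)" by (simp add: eventually_at_filter)
        then have "eventually (\<lambda>u. f' s u = f' s t) (at_left t)"
          using ev_llim[OF tame[of s], of t]
        proof eventually_elim
          case (elim u)
          then show ?case using True by (simp add: f'_def A_def B_def \<alpha>_def \<beta>_def)
        qed
        ultimately have "eventually (\<lambda>u. f' s u = f' s t) (at t)" by (simp add: eventually_at_split)
        then show ?thesis by (simp add: eventually_at_filter) (auto elim: eventually_mono)
      next
        case False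
        have "eventually (\<lambda>u. f s u = f s t) (nhds t)"
          using no False insert.prems(3)[of s t] by blast
        moreover have "eventually (\<lambda>u. (u = g s) = (t = g s) \<and> (g s < u) = (g s < t)) (nhds t)"
        proof (cases "t < g s")
          case True
          then have "eventually (\<lambda>u. u < g s) (nhds t)"
            using eventually_nhds_in_open[of "{..<g s}" t] by simp
          then show ?thesis by eventually_elim (use True in auto)
        next
          case False
          with \<open>t \<noteq> g s\<close> have gt: "g s < t" by simp
          then have "eventually (\<lambda>u. g s < u) (nhds t)"
            using eventually_nhds_in_open[of "{g s<..}" t] by simp
          then show ?thesis by eventually_elim (use gt in auto)
        qed
        ultimately show ?thesis by eventually_elim (simp add: f'_def A_def B_def)
      qed
      with * show False by blast
    qed
  qed (use insert.prems in blast)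
  then have "Fub (\<lambda>s t. (f' s t + A s t) + B s t)"
    by (intro Fub_add CF2_add CF' CFA CFB FA FB)
  moreover have "(\<lambda>s t. (f' s t + A s t) + B s t) = f" by (simp add: f'_def fun_eq_iff)
  ultimately show ?case by simp
qed

text \<open>For each \<open>s\<close> there are finitely many discontinuities in \<open>t\<close>,
  hence boundedly many, hence finitely many definable functions of \<open>s\<close> cover
  them.\<close>

lemma Fub_CF2:
  assumes f: "CF2 f"
  shows "Fub f"
proof -
  define Q where "Q x t \<longleftrightarrow> \<not> (\<exists>d. 0 < d \<and> (\<forall>u. t - d < u \<and> u < t + d \<longrightarrow> f (x 0) u = f (x 0) t))"
    for x :: "nat \<Rightarrow> real" and t
  have Q_iff: "Q x t \<longleftrightarrow> \<not> eventually (\<lambda>u. f (x 0) u = f (x 0) t) (nhds t)" for x t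
    unfolding Q_def eventually_nhds_real ..
  have Q: "defp2 Q"
    unfolding defp2_def Q_def by (intro defp_intros defp_CF_eq2 CF2_subst[OF f] dt_intros)
  have fin: "finite {t. Q x t}" for x
    unfolding Q_iff using tame_not_locally_const[OF CF2_tame(1)[OF f]] .
  obtain N where "\<And>x. card {t. Q x t} \<le> N" using uniform_finiteness[OF Q fin] by blast
  from cover_by_terms[OF Q fin this] obtain T where T: "finite T" "\<forall>\<tau>\<in>T. dt \<tau>"
    "\<forall>x t. Q x t \<longrightarrow> (\<exists>\<tau>\<in>T. t = \<tau> x)" by blast
  show ?thesis
  proof (rule Fub_of_cover[OF _ f])
    show "finite ((\<lambda>\<tau> s. \<tau> (\<lambda>_. s)) ` T)" using T(1) by simp
    show "du g" if "g \<in> (\<lambda>\<tau> s. \<tau> (\<lambda>_. s)) ` T" for g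
      using that T(2) by (auto simp: du_def intro!: dt_subst[of _ "\<lambda>i x. x 0"] dt_var)
    fix s t assume "\<not> eventually (\<lambda>u. f s u = f s t) (nhds t)"
    then have "Q (\<lambda>_. s) t" by (simp add: Q_iff)
    then obtain \<tau> where "\<tau> \<in> T" "t = \<tau> (\<lambda>_. s)" using T(3) by blast
    then show "\<exists>g\<in>(\<lambda>\<tau> s. \<tau> (\<lambda>_. s)) ` T. t = g s"
      by (intro bexI[of _ "\<lambda>s. \<tau> (\<lambda>_. s)"]) auto
  qed
qed

lemma I_commute:
  assumes F: "CF F" and "i \<noteq> j"
  shows "I i (I j F) = I j (I i F)"
proof
  fix x
  have "CF2 (\<lambda>s t. F (x(i := s, j := t)))"
    unfolding CF2_def
  proof (rule CF_subst[OF F, of "\<lambda>k y. (x(i := y 0, j := y 1)) k"])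
    show "dt (\<lambda>y. (x(i := y 0, j := y 1)) k)" for k
      by (cases "k = j"; cases "k = i") (auto intro: dt_intros)
  qed
  then have "Fub (\<lambda>s t. F (x(i := s, j := t)))" by (rule Fub_CF2)
  moreover have "x(j := t, i := s) = x(i := s, j := t)" for s t using assms(2) by (intro fun_upd_twist) simp
  ultimately show "I i (I j F) x = I j (I i F) x"
    unfolding Fub_def I_def by simp
qed

end

section \<open>The Euler characteristic as an iterated integral\<close>

lemma sum_fun_apply: "(sum f A) x = (\<Sum>a\<in>A. f a x)"
  by (induction A rule: infinite_finite_induct) auto

section \<open>Barycentric coordinates and disjointness of open simplices\<close>

lemma affine_independent_unique:
  fixes V :: "'a::real_vector set"
  assumes "finite V" "\<not> affine_dependent V" "sum u V = sum w V"
    "(\<Sum>v\<in>V. u v *\<^sub>R v) = (\<Sum>v\<in>V. w v *\<^sub>R v)" "v \<in> V"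
  shows "u v = w v"
proof -
  have "sum (\<lambda>v. u v - w v) V = 0" "(\<Sum>v\<in>V. (u v - w v) *\<^sub>R v) = 0"
    using assms by (simp_all add: sum_subtractf scaleR_left_diff_distrib)
  then have "affine_dependent V" if "u v - w v \<noteq> 0"
    unfolding affine_dependent_explicit_finite[OF assms(1)] using that assms(5)
    by (intro exI[of _ "\<lambda>v. u v - w v"]) blast
  then show ?thesis using assms(2) by force
qed

lemma finite_complexD:
  assumes "finite_complex N K" "V \<in> K"
  shows "finite V" "V \<subseteq> espace N" "V \<noteq> {}" "\<not> affine_dependent V"
proof -
  have "\<forall>V\<in>K. V \<subseteq> espace N \<and> finite V \<and> V \<noteq> {} \<and> \<not> affine_dependent V"
    using assms(1) unfolding finite_complex_def by (elim conjE)
  with assms(2) show "finite V" "V \<subseteq> espace N" "V \<noteq> {}" "\<not> affine_dependent V" by blast+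
qed

text \<open>A common point lies in the hull of \<open>V \<inter> W\<close>. Its coordinates there,
  extended by 0, must agree with the positive ones over \<open>V\<close>, so no vertex of
  \<open>V\<close> is missing from \<open>W\<close>. By symmetry, open simplices with a common point
  have the same vertices.\<close>

lemma open_simplex_subset:
  assumes K: "finite_complex N K" and V: "V \<in> K" "W \<in> K"
    and p: "p \<in> open_simplex V" "p \<in> open_simplex W"
  shows "V \<subseteq> W"
proof
  fix v assume v: "v \<in> V"
  have fin: "finite V" "finite W" and ind: "\<not> affine_dependent V"
    using finite_complexD[OF K] V by blast+
  obtain u where u: "p = (\<Sum>v\<in>V. u v *\<^sub>R v)" "\<forall>v\<in>V. 0 < u v" "sum u V = 1"
    using p(1) unfolding open_simplex_def by blast
  have "p \<in> convex hull V"
    unfolding convex_hull_finite[OF fin(1)] using u by (auto intro!: exI[of _ u] less_imp_le)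
  moreover obtain w where "p = (\<Sum>v\<in>W. w v *\<^sub>R v)" "\<forall>v\<in>W. 0 < w v" "sum w W = 1"
    using p(2) unfolding open_simplex_def by blast
  then have "p \<in> convex hull W"
    unfolding convex_hull_finite[OF fin(2)] by (auto intro!: exI[of _ w] less_imp_le)
  moreover have "\<forall>V\<in>K. \<forall>W\<in>K. convex hull V \<inter> convex hull W = convex hull (V \<inter> W)"
    using K unfolding finite_complex_def by (elim conjE)
  ultimately have "p \<in> convex hull (V \<inter> W)" using V by blast
  then obtain z where z: "sum z (V \<inter> W) = 1" "(\<Sum>v\<in>V \<inter> W. z v *\<^sub>R v) = p"
    using fin convex_hull_finite[of "V \<inter> W"] by auto
  define z' where "z' v = (if v \<in> W then z v else 0)" for v
  have "sum z' V = sum z (V \<inter> W)"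
    unfolding z'_def using fin by (simp add: sum.inter_restrict)
  moreover have "(\<Sum>v\<in>V. z' v *\<^sub>R v) = (\<Sum>v\<in>V \<inter> W. z v *\<^sub>R v)"
    unfolding z'_def using fin by (simp add: sum.inter_restrict if_distrib[of "\<lambda>c. c *\<^sub>R _"] cong: if_cong)
  ultimately have "u v = z' v"
    using affine_independent_unique[OF fin(1) ind _ _ v, of u z'] u z by simp
  moreover have "u v > 0" using u v by blast
  ultimately show "v \<in> W" unfolding z'_def by (auto split: if_splits)
qed

context o_minimal_structure
begin

lemma defp_of_definable:
  assumes "X \<in> D d"
  shows "defp (\<lambda>x. trunc d x \<in> X)"
proof -
  have "{x \<in> espace d. trunc d x \<in> X} = X"
    using subset_space[OF assms] by (auto simp: trunc_id)
  then show ?thesis unfolding defp_def using dep_trunc[of d "\<lambda>x. x \<in> X"] assms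
    by (intro exI[of _ d]) simp
qed

lemma defp_trunc: "defp P \<Longrightarrow> defp (\<lambda>x. P (trunc d x))"
  using defp_subst[of P "\<lambda>i x. trunc d x i"] dt_trunc by blast

lemma definable_Collect:
  assumes "defp P"
  shows "{x \<in> espace d. P x} \<in> D d"
proof -
  have "{x \<in> espace d. P (trunc d x)} \<in> D d"
    by (rule definable_of_defp[OF defp_trunc[OF assms] dep_trunc])
  moreover have "{x \<in> espace d. P (trunc d x)} = {x \<in> espace d. P x}" by (auto simp: trunc_id)
  ultimately show ?thesis by simp
qed

section \<open>Iterated integrals\<close>

definition Is :: "nat list \<Rightarrow> ((nat \<Rightarrow> real) \<Rightarrow> int) \<Rightarrow> (nat \<Rightarrow> real) \<Rightarrow> int" where
  "Is js F = foldr I js F"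

lemma Is_simps [simp]: "Is [] F = F" "Is (j # js) F = I j (Is js F)"
  by (simp_all add: Is_def)

lemma Is_append: "Is (xs @ ys) F = Is xs (Is ys F)"
  by (simp add: Is_def)

lemma CF_Is: "CF F \<Longrightarrow> CF (Is js F)"
  by (induction js) (auto intro: CF_I)

lemma I_Is_commute: "CF F \<Longrightarrow> j \<notin> set js \<Longrightarrow> Is js (I j F) = I j (Is js F)"
  by (induction js) (auto simp: I_commute CF_Is)

lemma Is_permute:
  assumes "CF F" "distinct xs" "distinct ys" "set xs = set ys"
  shows "Is xs F = Is ys F"
  using assms(2-)
proof (induction xs arbitrary: ys)
  case Nil
  then show ?case by simp
next
  case (Cons x xs)
  then obtain ys1 ys2 where ys: "ys = ys1 @ x # ys2" by (metis list.set_intros(1) split_list)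
  have "Is xs F = Is (ys1 @ ys2) F"
  proof (rule Cons.IH)
    show "set xs = set (ys1 @ ys2)" using Cons.prems ys by auto
  qed (use Cons.prems ys in auto)
  moreover have "Is ys F = I x (Is (ys1 @ ys2) F)"
    using Cons.prems ys by (simp add: Is_append I_Is_commute CF_Is assms(1))
  ultimately show ?case by simp
qed

lemma Is_cong:
  assumes "\<And>z. (\<And>i. i \<notin> set js \<Longrightarrow> z i = x i) \<Longrightarrow> F z = G z"
  shows "Is js F x = Is js G x"
  using assms
proof (induction js arbitrary: x)
  case Nil
  then show ?case by simp
next
  case (Cons j js)
  have "Is js F (x(j := t)) = Is js G (x(j := t))" for t
    by (rule Cons.IH, rule Cons.prems) auto
  then show ?case by (simp add: I_def)
qed

lemma I_zero: "I j (\<lambda>x. 0) = (\<lambda>x. 0)"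
  by (simp add: I_def fun_eq_iff)

lemma Is_zero: "Is js (\<lambda>x. 0) = (\<lambda>x. 0)"
  by (induction js) (simp_all add: I_zero)

lemma I_add: "CF F \<Longrightarrow> CF G \<Longrightarrow> I j (\<lambda>x. F x + G x) = (\<lambda>x. I j F x + I j G x)"
  by (simp add: I_def fun_eq_iff Eint_add CF_tame)

lemma I_cmult: "CF F \<Longrightarrow> I j (\<lambda>x. c * F x) = (\<lambda>x. c * I j F x)"
  by (simp add: I_def fun_eq_iff Eint_cmult CF_tame)

lemma Is_add: "CF F \<Longrightarrow> CF G \<Longrightarrow> Is js (\<lambda>x. F x + G x) = (\<lambda>x. Is js F x + Is js G x)"
  by (induction js) (simp_all add: I_add CF_Is)

lemma Is_cmult: "CF F \<Longrightarrow> Is js (\<lambda>x. c * F x) = (\<lambda>x. c * Is js F x)"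
  by (induction js) (simp_all add: I_cmult CF_Is)

lemma Is_sum:
  "finite A \<Longrightarrow> (\<And>a. a \<in> A \<Longrightarrow> CF (F a)) \<Longrightarrow> Is js (\<lambda>x. \<Sum>a\<in>A. F a x) = (\<lambda>x. \<Sum>a\<in>A. Is js (F a) x)"
  by (induction A rule: finite_induct) (simp_all add: Is_zero Is_add CF_sum)

lemma Is_rename:
  assumes "inj \<sigma>"
  shows "Is (map \<sigma> js) (\<lambda>x. F (\<lambda>i. x (\<sigma> i))) x = Is js F (\<lambda>i. x (\<sigma> i))"
proof (induction js arbitrary: x)
  case (Cons j js)
  have "(\<lambda>i. (x(\<sigma> j := t)) (\<sigma> i)) = (\<lambda>i. x (\<sigma> i))(j := t)" for t
    using assms by (auto simp: fun_eq_iff inj_eq)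
  then show ?case by (simp add: I_def Cons.IH)
qed simp

lemma Is_point: "distinct js \<Longrightarrow> Is js (\<lambda>z. of_bool (\<forall>j\<in>set js. z j = c j)) x = 1"
proof (induction js arbitrary: x)
  case (Cons j js)
  have "Is js (\<lambda>z. of_bool (\<forall>k\<in>set (j # js). z k = c k)) (x(j := t)) = of_bool (t = c j)" for t
  proof (cases "t = c j")
    case True
    have "Is js (\<lambda>z. of_bool (\<forall>k\<in>set (j # js). z k = c k)) (x(j := t)) =
      Is js (\<lambda>z. of_bool (\<forall>k\<in>set js. z k = c k)) (x(j := t))"
      by (rule Is_cong) (use Cons.prems True in auto)
    then show ?thesis using Cons True by simp
  next
    case False
    have "Is js (\<lambda>z. of_bool (\<forall>k\<in>set (j # js). z k = c k)) (x(j := t)) = Is js (\<lambda>z. 0) (x(j := t))"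
      by (rule Is_cong) (use Cons.prems False in auto)
    then show ?thesis using False by (simp add: Is_zero)
  qed
  then show ?case by (simp add: I_def Eint_point)
qed simp

lemma Is_single:
  assumes "distinct js"
    "\<And>z. (\<And>i. i \<notin> set js \<Longrightarrow> z i = x i) \<Longrightarrow> \<Gamma> z \<longleftrightarrow> B \<and> (\<forall>j\<in>set js. z j = c j)"
  shows "Is js (\<lambda>z. of_bool (\<Gamma> z)) x = of_bool B"
proof (cases B)
  case True
  have "Is js (\<lambda>z. of_bool (\<Gamma> z)) x = Is js (\<lambda>z. of_bool (\<forall>j\<in>set js. z j = c j)) x"
    by (rule Is_cong) (use assms(2) True in simp)
  then show ?thesis using Is_point[OF assms(1)] True by simp
next
  case False
  have "Is js (\<lambda>z. of_bool (\<Gamma> z)) x = Is js (\<lambda>z. 0) x"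
    by (rule Is_cong) (use assms(2) False in simp)
  then show ?thesis using False by (simp add: Is_zero)
qed

text \<open>A candidate for the Euler characteristic that requires no choice of a decomposition;
  \<open>euler_char_eq_chi\<close> shows that the two agree.\<close>

definition chi :: "nat \<Rightarrow> ((nat \<Rightarrow> real) \<Rightarrow> bool) \<Rightarrow> int" where
  "chi d P = Is [0..<d] (\<lambda>x. of_bool (P x)) (\<lambda>_. 0)"

text \<open>The Euler characteristic of the graph of a bijection is computed by integrating over the fibres
  of either projection, and these fibres are points.\<close>

lemma chi_bij:
  assumes X: "X \<subseteq> espace m" and Y: "Y \<subseteq> espace n" and bij: "bij_betw h X Y"
    and \<Gamma>: "defp (\<lambda>z. trunc m z \<in> X \<and> trunc n (\<lambda>i. z (i + m)) = h (trunc m z))" (is "defp ?\<Gamma>")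
  shows "chi m (\<lambda>x. trunc m x \<in> X) = chi n (\<lambda>y. trunc n y \<in> Y)"
proof -
  let ?F = "\<lambda>z. of_bool (?\<Gamma> z) :: int"
  have F: "CF ?F" using \<Gamma> by (rule CF_of_bool)
  have hY: "h x \<in> Y" if "x \<in> X" for x using bij_betwE[OF bij] that by blast
  have 1: "Is [m..<m+n] ?F = (\<lambda>x. of_bool (trunc m x \<in> X))"
  proof
    fix x
    show "Is [m..<m+n] ?F x = of_bool (trunc m x \<in> X)"
    proof (rule Is_single[where c = "\<lambda>j. h (trunc m x) (j - m)"])
      fix z assume z: "\<And>i. i \<notin> set [m..<m+n] \<Longrightarrow> z i = x i"
      then have tr: "trunc m z = trunc m x" by (auto simp: trunc_def fun_eq_iff)
      have "trunc n (\<lambda>i. z (i + m)) = h (trunc m x) \<longleftrightarrow> (\<forall>j\<in>set [m..<m+n]. z j = h (trunc m x) (j - m))"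
        if "trunc m x \<in> X"
      proof
        assume *: "trunc n (\<lambda>i. z (i + m)) = h (trunc m x)"
        show "\<forall>j\<in>set [m..<m+n]. z j = h (trunc m x) (j - m)"
          unfolding *[symmetric] by (auto simp: trunc_def)
      next
        assume *: "\<forall>j\<in>set [m..<m+n]. z j = h (trunc m x) (j - m)"
        have "h (trunc m x) \<in> espace n" using hY[OF that] Y by blast
        then show "trunc n (\<lambda>i. z (i + m)) = h (trunc m x)"
          using * by (auto simp: fun_eq_iff trunc_def espace_iff)
      qed
      then show "?\<Gamma> z \<longleftrightarrow> trunc m x \<in> X \<and> (\<forall>j\<in>set [m..<m+n]. z j = h (trunc m x) (j - m))"
        unfolding tr by blast
    qed simp
  qed
  have 2: "Is [0..<m] ?F = (\<lambda>x. of_bool (trunc n (\<lambda>i. x (i + m)) \<in> Y))"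
  proof
    fix x
    define y where "y = trunc n (\<lambda>i. x (i + m))"
    have "Is [0..<m] ?F x = of_bool (y \<in> Y)"
    proof (rule Is_single[where c = "inv_into X h y"])
      fix z assume z: "\<And>i. i \<notin> set [0..<m] \<Longrightarrow> z i = x i"
      have tr: "trunc n (\<lambda>i. z (i + m)) = y" using z by (simp add: trunc_def y_def)
      have img: "h ` X = Y" using bij by (simp add: bij_betw_def)
      have "(trunc m z \<in> X \<and> y = h (trunc m z)) \<longleftrightarrow> (y \<in> Y \<and> trunc m z = inv_into X h y)"
      proof (intro iffI conjI; elim conjE)
        assume "trunc m z \<in> X" "y = h (trunc m z)"
        then show "y \<in> Y" "trunc m z = inv_into X h y"
          using hY bij_betw_inv_into_left[OF bij] by simp_all
      next
        assume y: "y \<in> Y" "trunc m z = inv_into X h y"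
        then show "trunc m z \<in> X" "y = h (trunc m z)"
          using img inv_into_into[of y h X] f_inv_into_f[of y h X] by simp_all
      qed
      moreover have "trunc m z = inv_into X h y \<longleftrightarrow> (\<forall>j\<in>set [0..<m]. z j = inv_into X h y j)" if "y \<in> Y"
      proof -
        have "inv_into X h y \<in> espace m" using that img X inv_into_into[of y h X] by auto
        then show ?thesis by (auto simp: fun_eq_iff trunc_def espace_iff)
      qed
      ultimately show "?\<Gamma> z \<longleftrightarrow> y \<in> Y \<and> (\<forall>j\<in>set [0..<m]. z j = inv_into X h y j)"
        unfolding tr by blast
    qed simp
    then show "Is [0..<m] ?F x = of_bool (trunc n (\<lambda>i. x (i + m)) \<in> Y)" by (simp add: y_def)
  qed
  have "Is ([0..<m] @ [m..<m+n]) ?F = Is ([m..<m+n] @ [0..<m]) ?F"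
    by (rule Is_permute[OF F]) auto
  then have "Is [0..<m] (\<lambda>x. of_bool (trunc m x \<in> X)) =
      Is [m..<m+n] (\<lambda>x. of_bool (trunc n (\<lambda>i. x (i + m)) \<in> Y))"
    unfolding Is_append 1 2 .
  moreover have "[m..<m+n] = map (\<lambda>i. i + m) [0..<n]"
    by (simp add: map_add_upt add.commute)
  ultimately show ?thesis
    using Is_rename[of "\<lambda>i. i + m" "[0..<n]" "\<lambda>y. of_bool (trunc n y \<in> Y)" "\<lambda>_. 0"]
    by (simp add: chi_def inj_on_def)
qed

text \<open>The last coordinate runs through the open interval from 0 to the remaining mass, so each
  coordinate contributes a factor -1.\<close>

lemma Is_solid_simplex:
  "Is [0..<k] (\<lambda>u. of_bool ((\<forall>i<k. 0 < u i) \<and> (\<Sum>i<k. u i) < 1)) x = (-1) ^ k"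
proof (induction k arbitrary: x)
  case (Suc k)
  let ?F = "\<lambda>u. of_bool ((\<forall>i<k. 0 < u i) \<and> (\<Sum>i<k. u i) < 1) :: int"
  have "I k (\<lambda>u. of_bool ((\<forall>i<Suc k. 0 < u i) \<and> (\<Sum>i<Suc k. u i) < 1)) u = - 1 * ?F u" for u
  proof (cases "(\<forall>i<k. 0 < u i) \<and> (\<Sum>i<k. u i) < 1")
    case True
    then have "(\<lambda>t. of_bool ((\<forall>i<Suc k. 0 < (u(k := t)) i) \<and> (\<Sum>i<Suc k. (u(k := t)) i) < 1) :: int) =
       (\<lambda>t. of_bool (t \<in> {0<..<1 - (\<Sum>i<k. u i)}))"
      by (auto simp: fun_eq_iff less_Suc_eq)
    moreover have "Eint (\<lambda>t. of_bool (t \<in> {0<..<1 - (\<Sum>i<k. u i)})) = -1"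
      by (rule Eint_open_interval) (use True in \<open>auto simp: is_interval_1\<close>)
    ultimately show ?thesis using True by (simp add: I_def)
  next
    case False
    then have "(\<lambda>t. of_bool ((\<forall>i<Suc k. 0 < (u(k := t)) i) \<and> (\<Sum>i<Suc k. (u(k := t)) i) < 1) :: int) =
       (\<lambda>t. 0)"
      by (auto simp: fun_eq_iff less_Suc_eq)
    then show ?thesis using False by (simp add: I_def)
  qed
  then have "I k (\<lambda>u. of_bool ((\<forall>i<Suc k. 0 < u i) \<and> (\<Sum>i<Suc k. u i) < 1)) = (\<lambda>u. - 1 * ?F u)"
    by (rule ext)
  then have "Is [0..<Suc k] (\<lambda>u. of_bool ((\<forall>i<Suc k. 0 < u i) \<and> (\<Sum>i<Suc k. u i) < 1)) x
    = Is [0..<k] (\<lambda>u. - 1 * ?F u) x"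
    by (simp only: Is_append Is_simps upt_Suc_append[OF le0])
  also have "\<dots> = - 1 * Is [0..<k] ?F x"
  proof (rule fun_cong[OF Is_cmult])
    show "CF ?F"
      by (intro CF_of_bool defp_conj defp_all_less defp_less dt_sum dt_intros) simp
  qed
  also have "\<dots> = (-1) ^ Suc k" using Suc by simp
  finally show ?case .
qed simp

text \<open>The last barycentric coordinate is determined by the others and integrates to 1, which
  leaves a solid simplex in \<open>k - 1\<close> coordinates.\<close>

lemma chi_simplex:
  assumes "k > 0"
  shows "chi k (\<lambda>u. (\<forall>i<k. 0 < u i) \<and> (\<Sum>i<k. u i) = 1) = (-1) ^ (k - 1)"
proof -
  obtain m where k: "k = Suc m" using assms not0_implies_Suc by blast
  let ?F = "\<lambda>u. of_bool ((\<forall>i<m. 0 < u i) \<and> (\<Sum>i<m. u i) < 1) :: int"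
  have "I m (\<lambda>u. of_bool ((\<forall>i<Suc m. 0 < u i) \<and> (\<Sum>i<Suc m. u i) = 1)) u = ?F u" for u
  proof -
    have "(\<lambda>t. of_bool ((\<forall>i<Suc m. 0 < (u(m := t)) i) \<and> (\<Sum>i<Suc m. (u(m := t)) i) = 1) :: int) =
       (if (\<forall>i<m. 0 < u i) \<and> (\<Sum>i<m. u i) < 1 then (\<lambda>t. of_bool (t = 1 - (\<Sum>i<m. u i))) else (\<lambda>t. 0))"
      by (auto simp: fun_eq_iff less_Suc_eq)
    then show ?thesis by (simp add: I_def Eint_point)
  qed
  then have "I m (\<lambda>u. of_bool ((\<forall>i<Suc m. 0 < u i) \<and> (\<Sum>i<Suc m. u i) = 1)) = ?F"
    by (rule ext)
  then have "chi k (\<lambda>u. (\<forall>i<k. 0 < u i) \<and> (\<Sum>i<k. u i) = 1) = Is [0..<m] ?F (\<lambda>_. 0)"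
    by (simp only: chi_def k Is_append Is_simps upt_Suc_append[OF le0])
  then show ?thesis using Is_solid_simplex by (simp add: k)
qed

text \<open>Barycentric coordinates give a definable bijection from the standard open simplex in
  \<open>k\<close> coordinates, with graph \<open>\<Gamma>\<close>; \<open>chi_bij\<close>
  transports the value.\<close>

lemma defp_open_simplex_chi:
  assumes V: "finite V" "V \<subseteq> espace N" "V \<noteq> {}" "\<not> affine_dependent V"
  shows "defp (\<lambda>x. trunc N x \<in> open_simplex V)"
    and "chi N (\<lambda>x. trunc N x \<in> open_simplex V) = (-1) ^ (card V - 1)"
proof -
  define k where "k = card V"
  obtain f where f: "bij_betw f {..<k} V"
    using ex_bij_betw_nat_finite[OF V(1)] by (auto simp: k_def atLeast0LessThan)
  define P where "P u \<longleftrightarrow> (\<forall>i<k. 0 < u i) \<and> (\<Sum>i<k. u i) = 1" for u :: "nat \<Rightarrow> real"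
  define \<Gamma> where "\<Gamma> z \<longleftrightarrow> P z \<and> (\<forall>j<N. z (k + j) = (\<Sum>i<k. z i * f i j))" for z
  have \<Gamma>: "defp \<Gamma>"
    unfolding \<Gamma>_def P_def
    by (intro defp_conj defp_all_less defp_less defp_eq dt_sum dt_intros) simp_all
  have comb: "(\<Sum>v\<in>V. u v *\<^sub>R v) j = (\<Sum>i<k. u (f i) * f i j)" for u j
    by (simp add: sum_fun_apply scaleR_fun_def sum.reindex_bij_betw[OF f, symmetric])
  have zero: "f i j = 0" if "i < k" "j \<ge> N" for i j
    using bij_betwE[OF f] that V(2) by (auto simp: espace_iff)
  have mem: "y \<in> open_simplex V \<longleftrightarrow> (\<exists>u. P u \<and> y = (\<lambda>j. \<Sum>i<k. u i * f i j))" for y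
  proof
    assume "y \<in> open_simplex V"
    then obtain u where u: "y = (\<Sum>v\<in>V. u v *\<^sub>R v)" "\<forall>v\<in>V. 0 < u v" "sum u V = 1"
      unfolding open_simplex_def by blast
    have "P (\<lambda>i. u (f i))"
      using u bij_betwE[OF f] by (auto simp: P_def sum.reindex_bij_betw[OF f])
    moreover have "y = (\<lambda>j. \<Sum>i<k. u (f i) * f i j)" using u(1) comb by (simp add: fun_eq_iff)
    ultimately show "\<exists>u. P u \<and> y = (\<lambda>j. \<Sum>i<k. u i * f i j)" by blast
  next
    assume "\<exists>u. P u \<and> y = (\<lambda>j. \<Sum>i<k. u i * f i j)"
    then obtain u where u: "P u" "y = (\<lambda>j. \<Sum>i<k. u i * f i j)" by blast
    define w where "w v = u (inv_into {..<k} f v)" for v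
    have w: "w (f i) = u i" if "i < k" for i
      using that f by (simp add: w_def bij_betw_inv_into_left)
    have "y = (\<Sum>v\<in>V. w v *\<^sub>R v)" using u(2) w comb by (simp add: fun_eq_iff)
    moreover have "sum w V = 1"
      using u(1) w by (simp add: P_def sum.reindex_bij_betw[OF f, symmetric])
    moreover have "\<forall>v\<in>V. 0 < w v"
      using u(1) w f by (auto simp: P_def bij_betw_def)
    ultimately show "y \<in> open_simplex V" unfolding open_simplex_def by blast
  qed
  have uniq: "u i = u' i" if "P u" "P u'" "\<And>j. (\<Sum>i<k. u i * f i j) = (\<Sum>i<k. u' i * f i j)" "i < k" for u u' i
  proof -
    define w w' where "w v = u (inv_into {..<k} f v)" and "w' v = u' (inv_into {..<k} f v)" for v
    have w: "w (f i) = u i" "w' (f i) = u' i" if "i < k" for i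
      using that f by (simp_all add: w_def w'_def bij_betw_inv_into_left)
    have "w (f i) = w' (f i)"
    proof (rule affine_independent_unique[where u = w and w = w' and v = "f i", OF V(1,4)])
      show "sum w V = sum w' V"
        using that(1,2) w by (simp add: P_def sum.reindex_bij_betw[OF f, symmetric])
      show "(\<Sum>v\<in>V. w v *\<^sub>R v) = (\<Sum>v\<in>V. w' v *\<^sub>R v)"
        using that(3) w comb by (simp add: fun_eq_iff)
      show "f i \<in> V" using bij_betwE[OF f] that(4) by blast
    qed
    then show ?thesis using w that(4) by simp
  qed
  define X where "X = {u \<in> espace k. P u}"
  define h where "h u = (\<lambda>j. \<Sum>i<k. u i * f i j)" for u :: "nat \<Rightarrow> real"
  have P_trunc: "P (trunc k u) = P u" and h_trunc: "h (trunc k u) = h u" for u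
    by (simp_all add: P_def h_def)
  have X_iff: "trunc k u \<in> X \<longleftrightarrow> P u" for u by (simp add: X_def P_trunc)
  have \<Gamma>_iff: "\<Gamma> z \<longleftrightarrow> P z \<and> trunc N (\<lambda>i. z (i + k)) = h z" for z
    unfolding \<Gamma>_def h_def using zero by (auto simp: fun_eq_iff trunc_def add.commute not_less)
  have ex: "trunc N y \<in> open_simplex V \<longleftrightarrow> (\<exists>u. \<Gamma> (\<lambda>i. if i < k then u i else y (i - k)))" for y
  proof -
    have "P (\<lambda>i. if i < k then u i else y (i - k)) = P u" "h (\<lambda>i. if i < k then u i else y (i - k)) = h u" for u
      by (simp_all add: P_def h_def)
    then show ?thesis unfolding mem \<Gamma>_iff by (simp add: h_def)
  qed
  show "defp (\<lambda>x. trunc N x \<in> open_simplex V)"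
    unfolding ex by (rule defp_ex_block[OF \<Gamma>])
  have "chi k (\<lambda>x. trunc k x \<in> X) = chi N (\<lambda>x. trunc N x \<in> open_simplex V)"
  proof (rule chi_bij[where h = h])
    show "X \<subseteq> espace k" by (auto simp: X_def)
    show "open_simplex V \<subseteq> espace N" using zero by (auto simp: mem espace_iff)
    show "defp (\<lambda>z. trunc k z \<in> X \<and> trunc N (\<lambda>i. z (i + k)) = h (trunc k z))"
      using \<Gamma> by (simp add: \<Gamma>_iff[abs_def] X_iff h_trunc)
    show "bij_betw h X (open_simplex V)"
      unfolding bij_betw_def
    proof (intro conjI inj_onI equalityI subsetI)
      fix u u' assume u: "u \<in> X" "u' \<in> X" and eq: "h u = h u'"
      show "u = u'"
      proof
        fix i
        show "u i = u' i"
          using uniq[of u u' i] u fun_cong[OF eq] by (cases "i < k") (auto simp: X_def h_def espace_iff)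
      qed
    next
      fix y assume "y \<in> open_simplex V"
      then obtain u where "P u" "y = h u" by (auto simp: mem h_def)
      then show "y \<in> h ` X" using X_iff h_trunc by (intro image_eqI[of _ _ "trunc k u"]) auto
    qed (auto simp: X_def mem h_def)
  qed
  moreover have "k > 0" using V by (simp add: k_def card_gt_0_iff)
  then have "chi k (\<lambda>x. trunc k x \<in> X) = (-1) ^ (k - 1)"
    using chi_simplex[of k] unfolding X_iff P_def by blast
  ultimately show "chi N (\<lambda>x. trunc N x \<in> open_simplex V) = (-1) ^ (card V - 1)"
    by (simp only: k_def)
qed

text \<open>The uniqueness half of the description in \<open>euler_char\<close>: \<open>chi\<close>
  is preserved by the bijection and additive over the disjoint open simplices, whichever
  decomposition was chosen.\<close>

lemma has_euler_char_eq_chi: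
  assumes X: "X \<in> D d" and e: "has_euler_char D d X e"
  shows "e = chi d (\<lambda>x. trunc d x \<in> X)"
proof -
  obtain N K L h where K: "finite_complex N K" "L \<subseteq> K" and h: "definable_map D d N X h"
    and bij: "bij_betw h X (\<Union>V\<in>L. open_simplex V)" and e: "e = (\<Sum>V\<in>L. (- 1) ^ (card V - 1))"
    using e unfolding has_euler_char_def by blast
  define Y where "Y = (\<Union>V\<in>L. open_simplex V)"
  have V: "finite V" "V \<subseteq> espace N" "V \<noteq> {}" "\<not> affine_dependent V" if "V \<in> L" for V
    using finite_complexD[OF K(1), of V] K(2) that by blast+
  have "finite K" using K(1) unfolding finite_complex_def by (elim conjE)
  then have L: "finite L" using K(2) by (rule finite_subset[rotated])
  have sub: "open_simplex V \<subseteq> espace N" if "V \<in> L" for V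
  proof
    fix y assume "y \<in> open_simplex V"
    then obtain u where "y = (\<Sum>v\<in>V. u v *\<^sub>R v)" unfolding open_simplex_def by blast
    then show "y \<in> espace N" using V[OF that]
      by (auto simp: espace_iff sum_fun_apply scaleR_fun_def intro!: sum.neutral)
  qed
  have YN: "Y \<subseteq> espace N" using sub by (auto simp: Y_def)
  have XN: "X \<subseteq> espace d" by (rule subset_space[OF X])
  define G where "G = {append_pt d x (h x) | x. x \<in> X}"
  have G: "G \<in> D (d + N)" using h by (simp add: definable_map_def G_def)
  have G_iff: "trunc (d + N) z \<in> G \<longleftrightarrow> trunc d z \<in> X \<and> trunc N (\<lambda>i. z (i + d)) = h (trunc d z)" for z
  proof
    assume "trunc (d + N) z \<in> G"
    then obtain x where x: "x \<in> X" "trunc (d + N) z = append_pt d x (h x)" by (auto simp: G_def)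
    have "trunc d z i = x i" for i
      using fun_cong[OF x(2), of i] XN x(1) by (auto simp: trunc_def append_pt_def espace_iff split: if_splits)
    then have "trunc d z = x" by blast
    moreover have "trunc N (\<lambda>i. z (i + d)) i = h x i" for i
      using fun_cong[OF x(2), of "i + d"] by (auto simp: trunc_def append_pt_def split: if_splits)
    ultimately show "trunc d z \<in> X \<and> trunc N (\<lambda>i. z (i + d)) = h (trunc d z)" using x(1) by blast
  next
    assume *: "trunc d z \<in> X \<and> trunc N (\<lambda>i. z (i + d)) = h (trunc d z)"
    have "trunc (d + N) z = append_pt d (trunc d z) (h (trunc d z))"
    proof
      fix i
      show "trunc (d + N) z i = append_pt d (trunc d z) (h (trunc d z)) i"
        using fun_cong[OF conjunct2[OF *], of "i - d"] by (auto simp: trunc_def append_pt_def split: if_splits)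
    qed
    then show "trunc (d + N) z \<in> G" using * by (auto simp: G_def)
  qed
  have "chi d (\<lambda>x. trunc d x \<in> X) = chi N (\<lambda>x. trunc N x \<in> Y)"
    using defp_of_definable[OF G] unfolding G_iff
    by (rule chi_bij[OF XN YN bij[folded Y_def]])
  also have "\<dots> = (\<Sum>V\<in>L. chi N (\<lambda>x. trunc N x \<in> open_simplex V))"
  proof -
    have "of_bool (y \<in> Y) = (\<Sum>V\<in>L. of_bool (y \<in> open_simplex V) :: int)" for y
    proof (cases "y \<in> Y")
      case True
      then obtain V where V: "V \<in> L" "y \<in> open_simplex V" by (auto simp: Y_def)
      have "(\<Sum>W\<in>L. of_bool (y \<in> open_simplex W) :: int) = (\<Sum>W\<in>L. if W = V then 1 else 0)"
      proof (rule sum.cong[OF refl])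
        fix W assume "W \<in> L"
        then have "y \<in> open_simplex W \<longleftrightarrow> W = V"
          using open_simplex_subset[OF K(1), of V W y] open_simplex_subset[OF K(1), of W V y] V K(2) by blast
        then show "(of_bool (y \<in> open_simplex W) :: int) = (if W = V then 1 else 0)" by simp
      qed
      then show ?thesis using True V L by simp
    qed (auto simp: Y_def intro!: sum.neutral[symmetric])
    then have "chi N (\<lambda>x. trunc N x \<in> Y) = Is [0..<N] (\<lambda>x. \<Sum>V\<in>L. of_bool (trunc N x \<in> open_simplex V)) (\<lambda>_. 0)"
      unfolding chi_def by presburger
    also have "\<dots> = (\<Sum>V\<in>L. chi N (\<lambda>x. trunc N x \<in> open_simplex V))"
      using fun_cong[OF Is_sum[OF L, of "\<lambda>V x. of_bool (trunc N x \<in> open_simplex V)"]]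
      by (simp add: chi_def CF_of_bool defp_open_simplex_chi V)
    finally show ?thesis .
  qed
  also have "\<dots> = e" unfolding e by (rule sum.cong[OF refl]) (simp add: defp_open_simplex_chi V)
  finally show ?thesis ..
qed

end

section \<open>Decomposition into open simplices\<close>

text \<open>Vertices are taken among the standard basis vectors. All faces of one standard simplex
  form a complex, and any selection of its open faces is a legitimate target in
  \<open>has_euler_char\<close>, so incidences between pieces never have to be controlled.\<close>

definition basis_pt :: "nat \<Rightarrow> nat \<Rightarrow> real" where
  "basis_pt i = (\<lambda>j. if j = i then 1 else 0)"

lemma inj_basis_pt: "inj basis_pt"
  by (auto simp: inj_def basis_pt_def fun_eq_iff split: if_splits)

lemma basis_pt_comb:
  assumes "finite A"
  shows "(\<Sum>v\<in>basis_pt ` A. u v *\<^sub>R v) = (\<lambda>i. if i \<in> A then u (basis_pt i) else 0)"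
proof
  fix j
  have "(\<Sum>v\<in>basis_pt ` A. u v *\<^sub>R v) j = (\<Sum>i\<in>A. u (basis_pt i) * basis_pt i j)"
    by (simp add: sum_fun_apply scaleR_fun_def sum.reindex inj_on_subset[OF inj_basis_pt])
  also have "\<dots> = (\<Sum>i\<in>A. if j = i then u (basis_pt i) else 0)"
    by (rule sum.cong) (auto simp: basis_pt_def)
  also have "\<dots> = (if j \<in> A then u (basis_pt j) else 0)" using assms by simp
  finally show "(\<Sum>v\<in>basis_pt ` A. u v *\<^sub>R v) j = (if j \<in> A then u (basis_pt j) else 0)" .
qed

text \<open>The open simplex spanned by the basis vectors with index in \<open>A\<close>
  (\<open>open_simplex_basis\<close>). The support of a point recovers \<open>A\<close>, so
  different faces are disjoint.\<close>

definition face :: "nat set \<Rightarrow> (nat \<Rightarrow> real) set" where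
  "face A = {y. (\<forall>i\<in>A. 0 < y i) \<and> (\<forall>i. i \<notin> A \<longrightarrow> y i = 0) \<and> (\<Sum>i\<in>A. y i) = 1}"

lemma open_simplex_basis:
  assumes "finite A"
  shows "open_simplex (basis_pt ` A) = face A"
proof (intro equalityI subsetI)
  fix y assume "y \<in> open_simplex (basis_pt ` A)"
  then obtain u where u: "y = (\<Sum>v\<in>basis_pt ` A. u v *\<^sub>R v)" "\<forall>v\<in>basis_pt ` A. 0 < u v" "sum u (basis_pt ` A) = 1"
    unfolding open_simplex_def by blast
  have "sum u (basis_pt ` A) = (\<Sum>i\<in>A. u (basis_pt i))"
    by (simp add: sum.reindex inj_on_subset[OF inj_basis_pt])
  then show "y \<in> face A" using u unfolding basis_pt_comb[OF assms] by (simp add: face_def)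
next
  fix y assume y: "y \<in> face A"
  define u where "u v = y (inv basis_pt v)" for v
  have u: "u (basis_pt i) = y i" for i by (simp add: u_def inj_basis_pt)
  have "y = (\<Sum>v\<in>basis_pt ` A. u v *\<^sub>R v)"
    unfolding basis_pt_comb[OF assms] u using y by (auto simp: face_def fun_eq_iff)
  moreover have "\<forall>v\<in>basis_pt ` A. 0 < u v" using y u by (simp add: face_def)
  moreover have "sum u (basis_pt ` A) = 1"
    using y by (simp add: sum.reindex inj_on_subset[OF inj_basis_pt] u face_def)
  ultimately show "y \<in> open_simplex (basis_pt ` A)" unfolding open_simplex_def by blast
qed

lemma convex_hull_basis:
  assumes "finite A"
  shows "convex hull (basis_pt ` A) = {y. (\<forall>i. 0 \<le> y i) \<and> (\<forall>i. i \<notin> A \<longrightarrow> y i = 0) \<and> (\<Sum>i\<in>A. y i) = 1}"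
proof (intro equalityI subsetI)
  fix y assume "y \<in> convex hull (basis_pt ` A)"
  then obtain u where u: "y = (\<Sum>v\<in>basis_pt ` A. u v *\<^sub>R v)" "\<forall>v\<in>basis_pt ` A. 0 \<le> u v" "sum u (basis_pt ` A) = 1"
    using assms by (auto simp: convex_hull_finite)
  have "sum u (basis_pt ` A) = (\<Sum>i\<in>A. u (basis_pt i))"
    by (simp add: sum.reindex inj_on_subset[OF inj_basis_pt])
  then show "y \<in> {y. (\<forall>i. 0 \<le> y i) \<and> (\<forall>i. i \<notin> A \<longrightarrow> y i = 0) \<and> (\<Sum>i\<in>A. y i) = 1}"
    using u unfolding basis_pt_comb[OF assms] by simp
next
  fix y :: "nat \<Rightarrow> real"
  assume y: "y \<in> {y. (\<forall>i. 0 \<le> y i) \<and> (\<forall>i. i \<notin> A \<longrightarrow> y i = 0) \<and> (\<Sum>i\<in>A. y i) = 1}"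
  define u where "u v = y (inv basis_pt v)" for v
  have u: "u (basis_pt i) = y i" for i by (simp add: u_def inj_basis_pt)
  have "y = (\<Sum>v\<in>basis_pt ` A. u v *\<^sub>R v)"
    unfolding basis_pt_comb[OF assms] u using y by (auto simp: fun_eq_iff)
  moreover have "\<forall>v\<in>basis_pt ` A. 0 \<le> u v" using y u by simp
  moreover have "sum u (basis_pt ` A) = 1"
    using y by (simp add: sum.reindex inj_on_subset[OF inj_basis_pt] u)
  ultimately show "y \<in> convex hull (basis_pt ` A)" using assms by (auto simp: convex_hull_finite intro!: exI[of _ u])
qed

definition basis_complex :: "nat \<Rightarrow> (nat \<Rightarrow> real) set set" where
  "basis_complex N = (`) basis_pt ` {A. A \<subseteq> {..<N} \<and> A \<noteq> {}}"

lemma finite_basis_complex: "finite_complex N (basis_complex N)"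
  unfolding finite_complex_def
proof (intro conjI ballI allI impI)
  have "finite {A. A \<subseteq> {..<N} \<and> A \<noteq> {}}" by (rule finite_subset[of _ "Pow {..<N}"]) auto
  then show "finite (basis_complex N)" by (simp add: basis_complex_def)
  fix V assume "V \<in> basis_complex N"
  then obtain A where A: "A \<subseteq> {..<N}" "A \<noteq> {}" "V = basis_pt ` A" by (auto simp: basis_complex_def)
  have fin: "finite A" using A(1) finite_subset by blast
  show "V \<subseteq> espace N" using A by (auto simp: espace_iff basis_pt_def)
  show "finite V" "V \<noteq> {}" using A fin by auto
  show "\<not> affine_dependent V"
  proof
    assume "affine_dependent V"
    then obtain U v where U: "v \<in> V" "U v \<noteq> 0" "(\<Sum>v\<in>V. U v *\<^sub>R v) = 0"
      using affine_dependent_explicit_finite[of V] fin A(3) by auto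
    obtain i where i: "i \<in> A" "v = basis_pt i" using U(1) A(3) by auto
    have "(\<Sum>v\<in>V. U v *\<^sub>R v) i = U v" using i fin by (simp add: A(3) basis_pt_comb)
    with U show False by (metis zero_fun_apply)
  qed
  fix W assume "W \<subseteq> V \<and> W \<noteq> {}"
  then obtain B where "B \<subseteq> A" "W = basis_pt ` B" "B \<noteq> {}" using A(3) by (metis image_empty subset_imageE)
  then show "W \<in> basis_complex N" using A by (auto simp: basis_complex_def)
next
  fix V W assume "V \<in> basis_complex N" "W \<in> basis_complex N"
  then obtain A B where A: "A \<subseteq> {..<N}" "V = basis_pt ` A" and B: "B \<subseteq> {..<N}" "W = basis_pt ` B"
    by (auto simp: basis_complex_def)
  have fin: "finite A" "finite B" using A(1) B(1) finite_subset by blast+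
  have eq: "V \<inter> W = basis_pt ` (A \<inter> B)" using A B inj_basis_pt by (simp add: image_Int)
  have sums: "(\<Sum>i\<in>A. y i) = (\<Sum>i\<in>A \<inter> B. y i)" "(\<Sum>i\<in>B. y i) = (\<Sum>i\<in>A \<inter> B. y i)"
    if "\<forall>i. i \<notin> A \<inter> B \<longrightarrow> y i = 0" for y :: "nat \<Rightarrow> real"
    using that fin by (auto intro!: sum.mono_neutral_right)
  have hull: "convex hull V = {y. (\<forall>i. 0 \<le> y i) \<and> (\<forall>i. i \<notin> A \<longrightarrow> y i = 0) \<and> (\<Sum>i\<in>A. y i) = 1}"
    "convex hull W = {y. (\<forall>i. 0 \<le> y i) \<and> (\<forall>i. i \<notin> B \<longrightarrow> y i = 0) \<and> (\<Sum>i\<in>B. y i) = 1}"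
    "convex hull (V \<inter> W) = {y. (\<forall>i. 0 \<le> y i) \<and> (\<forall>i. i \<notin> A \<inter> B \<longrightarrow> y i = 0) \<and> (\<Sum>i\<in>A \<inter> B. y i) = 1}"
    using convex_hull_basis[OF fin(1)] convex_hull_basis[OF fin(2)]
      convex_hull_basis[OF finite_Int[OF disjI1[OF fin(1)]], of B]
    by (simp_all only: A(2)[symmetric] B(2)[symmetric] eq[symmetric])
  show "convex hull V \<inter> convex hull W = convex hull (V \<inter> W)"
  proof (intro equalityI subsetI)
    fix y assume y: "y \<in> convex hull V \<inter> convex hull W"
    then have "\<forall>i. i \<notin> A \<inter> B \<longrightarrow> y i = 0" unfolding hull by blast
    then show "y \<in> convex hull (V \<inter> W)" using sums(1)[of y] y unfolding hull by simp
  next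
    fix y assume y: "y \<in> convex hull (V \<inter> W)"
    then have "\<forall>i. i \<notin> A \<inter> B \<longrightarrow> y i = 0" unfolding hull by blast
    then show "y \<in> convex hull V \<inter> convex hull W" using sums[of y] y unfolding hull by simp
  qed
qed

text \<open>Relabelling of vertices along \<open>\<sigma>\<close>. Two injections with disjoint
  ranges place two families of faces side by side, as \<open>cellular_disj\<close> needs.\<close>

definition pushf :: "(nat \<Rightarrow> nat) \<Rightarrow> (nat \<Rightarrow> real) \<Rightarrow> nat \<Rightarrow> real" where
  "pushf \<sigma> y = (\<lambda>j. if j \<in> range \<sigma> then y (inv \<sigma> j) else 0)"

lemma pushf_apply: "inj \<sigma> \<Longrightarrow> pushf \<sigma> y (\<sigma> i) = y i"
  by (simp add: pushf_def)

lemma bij_pushf: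
  assumes \<sigma>: "inj \<sigma>"
  shows "bij_betw (pushf \<sigma>) (\<Union>A\<in>\<L>. face A) (\<Union>A\<in>(`) \<sigma> ` \<L>. face A)"
proof (rule bij_betw_byWitness[where f' = "\<lambda>y i. y (\<sigma> i)"])
  show "\<forall>y\<in>\<Union>A\<in>\<L>. face A. (\<lambda>i. pushf \<sigma> y (\<sigma> i)) = y" by (simp add: pushf_apply[OF \<sigma>])
  have 0: "pushf \<sigma> (\<lambda>i. y (\<sigma> i)) = y" if "y \<in> face (\<sigma> ` A)" for y A
  proof
    fix j
    show "pushf \<sigma> (\<lambda>i. y (\<sigma> i)) j = y j"
    proof (cases "j \<in> range \<sigma>")
      case False
      then have "j \<notin> \<sigma> ` A" by blast
      then show ?thesis using that False by (simp add: pushf_def face_def)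
    qed (auto simp: pushf_apply[OF \<sigma>])
  qed
  then show "\<forall>y\<in>\<Union>A\<in>(`) \<sigma> ` \<L>. face A. pushf \<sigma> (\<lambda>i. y (\<sigma> i)) = y" by auto
  have sums: "(\<Sum>j\<in>\<sigma> ` A. g j) = (\<Sum>i\<in>A. g (\<sigma> i))" for g :: "nat \<Rightarrow> real" and A
    by (simp add: sum.reindex inj_on_subset[OF \<sigma>])
  have 1: "pushf \<sigma> y \<in> face (\<sigma> ` A)" if "y \<in> face A" for y A
    using that \<sigma> unfolding face_def by (auto simp: sums pushf_apply[OF \<sigma>]) (auto simp: pushf_def)
  then show "pushf \<sigma> ` (\<Union>A\<in>\<L>. face A) \<subseteq> (\<Union>A\<in>(`) \<sigma> ` \<L>. face A)" by blast
  have 2: "(\<lambda>i. y (\<sigma> i)) \<in> face A" if "y \<in> face (\<sigma> ` A)" for y A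
    using that \<sigma> unfolding face_def by (auto simp: sums inj_image_mem_iff)
  then show "(\<lambda>y i. y (\<sigma> i)) ` (\<Union>A\<in>(`) \<sigma> ` \<L>. face A) \<subseteq> (\<Union>A\<in>\<L>. face A)" by blast
qed

lemma face_support: "y \<in> face A \<Longrightarrow> {i. y i \<noteq> 0} = A"
  by (force simp: face_def)

context o_minimal_structure
begin

text \<open>A cell decomposition of the weakest kind that still yields an Euler characteristic: the
  bijection is only definable, closures of pieces may meet in any way, and the number of vertices is
  left open until \<open>has_euler_char_exists\<close>.\<close>

definition cellular :: "nat \<Rightarrow> ((nat \<Rightarrow> real) \<Rightarrow> bool) \<Rightarrow> bool" where
  "cellular d P \<longleftrightarrow> (\<exists>\<L> h. finite \<L> \<and> (\<forall>A\<in>\<L>. finite A \<and> A \<noteq> {}) \<and> (\<forall>i. dt (\<lambda>x. h x i)) \<and>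
     bij_betw h {x \<in> espace d. P x} (\<Union>A\<in>\<L>. face A))"

lemma cellular_cong: "(\<And>x. x \<in> espace d \<Longrightarrow> P x = Q x) \<Longrightarrow> cellular d P = cellular d Q"
proof -
  assume "\<And>x. x \<in> espace d \<Longrightarrow> P x = Q x"
  then have "{x \<in> espace d. P x} = {x \<in> espace d. Q x}" by auto
  then show ?thesis by (simp add: cellular_def)
qed

lemma cellular_False: "cellular d (\<lambda>x. False)"
  unfolding cellular_def by (intro exI[of _ "{}"] exI[of _ "\<lambda>x i. 0"]) (auto simp: dt_const bij_betw_def)

lemma cellular_bij:
  assumes "cellular d' P'" "\<And>i. dt (\<lambda>x. g x i)" "bij_betw g {x \<in> espace d. P x} {x \<in> espace d'. P' x}"
  shows "cellular d P"
proof -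
  obtain \<L> h where h: "finite \<L>" "\<forall>A\<in>\<L>. finite A \<and> A \<noteq> {}" "\<And>i. dt (\<lambda>x. h x i)"
    "bij_betw h {x \<in> espace d'. P' x} (\<Union>A\<in>\<L>. face A)"
    using assms(1) unfolding cellular_def by blast
  have "dt (\<lambda>x. (h \<circ> g) x i)" for i
    using dt_subst[OF h(3), of "\<lambda>i x. g x i"] assms(2) by simp
  then show ?thesis unfolding cellular_def
    using h(1,2) bij_betw_trans[OF assms(3) h(4)] by blast
qed

lemma dt_pushf: "(\<And>i. dt (\<lambda>x. h x i)) \<Longrightarrow> dt (\<lambda>x. pushf \<sigma> (h x) i)"
  by (cases "i \<in> range \<sigma>") (simp_all add: pushf_def dt_const)

lemma cellular_disj:
  assumes "cellular d P" "cellular d Q" "defp P" "\<And>x. x \<in> espace d \<Longrightarrow> \<not> (P x \<and> Q x)"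
  shows "cellular d (\<lambda>x. P x \<or> Q x)"
proof -
  obtain \<L> h where h: "finite \<L>" "\<forall>A\<in>\<L>. finite A \<and> A \<noteq> {}" "\<And>i. dt (\<lambda>x. h x i)"
    "bij_betw h {x \<in> espace d. P x} (\<Union>A\<in>\<L>. face A)"
    using assms(1) unfolding cellular_def by blast
  obtain \<M> k where k: "finite \<M>" "\<forall>A\<in>\<M>. finite A \<and> A \<noteq> {}" "\<And>i. dt (\<lambda>x. k x i)"
    "bij_betw k {x \<in> espace d. Q x} (\<Union>A\<in>\<M>. face A)"
    using assms(2) unfolding cellular_def by blast
  \<comment> \<open>Even and odd labels keep the vertices of the two families apart.\<close>
  define a b :: "nat \<Rightarrow> nat" where "a i = 2 * i" and "b i = Suc (2 * i)" for i
  have ab: "inj a" "inj b" by (auto simp: a_def b_def inj_def)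
  define g where "g x = (if P x then pushf a (h x) else pushf b (k x))" for x
  have gi: "g x i = (if P x then pushf a (h x) i else pushf b (k x) i)" for x i by (simp add: g_def)
  define \<N> where "\<N> = (`) a ` \<L> \<union> (`) b ` \<M>"
  have 1: "bij_betw g {x \<in> espace d. P x} (\<Union>A\<in>(`) a ` \<L>. face A)"
    using bij_betw_trans[OF h(4) bij_pushf[OF ab(1)]] by (rule iffD1[OF bij_betw_cong, rotated]) (simp add: g_def)
  have 2: "bij_betw g {x \<in> espace d. Q x} (\<Union>A\<in>(`) b ` \<M>. face A)"
    using bij_betw_trans[OF k(4) bij_pushf[OF ab(2)]]
    by (rule iffD1[OF bij_betw_cong, rotated]) (use assms(4) in \<open>auto simp: g_def\<close>)
  have "bij_betw g ({x \<in> espace d. P x} \<union> {x \<in> espace d. Q x}) ((\<Union>A\<in>(`) a ` \<L>. face A) \<union> (\<Union>A\<in>(`) b ` \<M>. face A))"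
  proof (rule bij_betw_combine[OF 1 2])
    \<comment> \<open>Even and odd labels can agree only in the empty set, which
      \<open>cellular\<close> excludes.\<close>
    have "A = {}" if eq: "a ` A = b ` B" for A B
    proof (rule ccontr)
      assume "A \<noteq> {}"
      then obtain i where "a i \<in> b ` B" using eq by blast
      then show False by (auto simp: a_def b_def) presburger
    qed
    then have "y \<notin> face (b ` B)" if "y \<in> face (a ` A)" "A \<noteq> {}" for y A B
      using face_support that by metis
    then show "(\<Union>A\<in>(`) a ` \<L>. face A) \<inter> (\<Union>A\<in>(`) b ` \<M>. face A) = {}" using h(2) by blast
  qed
  moreover have "{x \<in> espace d. P x} \<union> {x \<in> espace d. Q x} = {x \<in> espace d. P x \<or> Q x}" by blast
  moreover have "(\<Union>A\<in>(`) a ` \<L>. face A) \<union> (\<Union>A\<in>(`) b ` \<M>. face A) = (\<Union>A\<in>\<N>. face A)" by (auto simp: \<N>_def)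
  ultimately have "bij_betw g {x \<in> espace d. P x \<or> Q x} (\<Union>A\<in>\<N>. face A)" by simp
  moreover have "dt (\<lambda>x. g x i)" for i
    unfolding gi by (intro dt_if assms(3) dt_pushf h(3) k(3))
  moreover have "finite \<N>" "\<forall>A\<in>\<N>. finite A \<and> A \<noteq> {}" using h(1,2) k(1,2) by (auto simp: \<N>_def)
  ultimately show ?thesis unfolding cellular_def by blast
qed

text \<open>Multiplying a face with an open interval adds one vertex to it: this is the join coordinate.\<close>

lemma cellular_prod:
  assumes "cellular d P"
  shows "cellular (Suc d) (\<lambda>x. P (trunc d x) \<and> 0 < x d \<and> x d < 1)"
proof -
  obtain \<L> h where h: "finite \<L>" "\<forall>A\<in>\<L>. finite A \<and> A \<noteq> {}" "\<And>i. dt (\<lambda>x. h x i)"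
    and bij: "bij_betw h {x \<in> espace d. P x} (\<Union>A\<in>\<L>. face A)"
    using assms(1) unfolding cellular_def by blast
  define h' where "h' = inv_into {x \<in> espace d. P x} h"
  \<comment> \<open>\<open>x d\<close> becomes the weight of the new vertex 0; the old weights move
    up by one index and are scaled to the remaining mass \<open>1 - x d\<close>.\<close>
  define k where "k x = case_nat (x d) (\<lambda>i. (1 - x d) * h (trunc d x) i)" for x
  define \<M> where "\<M> = (\<lambda>A. insert 0 (Suc ` A)) ` \<L>"
  have sums: "(\<Sum>i\<in>insert 0 (Suc ` A). y i) = y 0 + (\<Sum>i\<in>A. y (Suc i))" if "finite A" for y :: "nat \<Rightarrow> real" and A
    using that by (subst sum.insert) (auto simp: sum.reindex)
  let ?X = "{x \<in> espace (Suc d). P (trunc d x) \<and> 0 < x d \<and> x d < 1}"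
  define u where "u y = (\<lambda>i. y (Suc i) / (1 - y 0))" for y :: "nat \<Rightarrow> real"
  have "bij_betw k ?X (\<Union>A\<in>\<M>. face A)"
  proof (rule bij_betw_byWitness[where f' = "\<lambda>y. (h' (u y))(d := y 0)"])
    have left: "h' (h x) = x" if "x \<in> espace d" "P x" for x
      unfolding h'_def using bij_betw_inv_into_left[OF bij] that by blast
    show "\<forall>x\<in>?X.
        (h' (u (k x)))(d := k x 0) = x"
    proof
      fix x assume x: "x \<in> ?X"
      then have "u (k x) = h (trunc d x)" by (simp add: k_def u_def)
      then have "h' (u (k x)) = trunc d x" using left x by simp
      then show "(h' (u (k x)))(d := k x 0) = x"
        using x by (auto simp: k_def fun_eq_iff trunc_def espace_iff)
    qed
    have face: "0 < y 0 \<and> y 0 < 1 \<and> (u y) \<in> face A"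
      if "y \<in> face (insert 0 (Suc ` A))" "A \<in> \<L>" for y A
    proof -
      have A: "finite A" "A \<noteq> {}" using h(2) that(2) by auto
      have y: "y 0 + (\<Sum>i\<in>A. y (Suc i)) = 1" "0 < y 0" "\<And>i. i \<in> A \<Longrightarrow> 0 < y (Suc i)"
        "\<And>i. i \<notin> A \<Longrightarrow> y (Suc i) = 0"
        using that(1) sums[OF A(1)] unfolding face_def by auto
      have "0 < (\<Sum>i\<in>A. y (Suc i))" using A y(3) by (intro sum_pos) auto
      then have lt: "y 0 < 1" using y(1) by linarith
      have "(\<Sum>i\<in>A. y (Suc i) / (1 - y 0)) = 1"
        using y(1) lt by (simp add: sum_divide_distrib[symmetric])
      then show ?thesis using y lt by (simp add: face_def u_def)
    qed
    have right: "h' z \<in> espace d \<and> P (h' z) \<and> h (h' z) = z" if "z \<in> face A" "A \<in> \<L>" for z A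
    proof -
      have "h ` {x \<in> espace d. P x} = (\<Union>A\<in>\<L>. face A)" using bij by (simp add: bij_betw_def)
      then have z: "z \<in> h ` {x \<in> espace d. P x}" using that by blast
      show ?thesis using inv_into_into[OF z] f_inv_into_f[OF z] by (simp add: h'_def)
    qed
    have *: "(h' z)(d := s) \<in> espace (Suc d)" "trunc d ((h' z)(d := s)) = h' z" if "h' z \<in> espace d" for z s
      using that by (auto simp: espace_iff trunc_def fun_eq_iff)
    show "\<forall>y\<in>\<Union>A\<in>\<M>. face A. k ((h' (u y))(d := y 0)) = y"
    proof
      fix y assume "y \<in> (\<Union>A\<in>\<M>. face A)"
      then obtain A where A: "A \<in> \<L>" "y \<in> face (insert 0 (Suc ` A))" by (auto simp: \<M>_def)
      note f = face[OF A(2,1)]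
      have r: "h' (u y) \<in> espace d" "h (h' (u y)) = (u y)"
        using right[OF _ A(1)] f by blast+
      show "k ((h' (u y))(d := y 0)) = y"
        unfolding k_def *(2)[OF r(1)] r(2) using f by (auto simp: fun_eq_iff u_def split: nat.split)
    qed
    show "(\<lambda>y. (h' (u y))(d := y 0)) ` (\<Union>A\<in>\<M>. face A)
        \<subseteq> ?X"
    proof (rule image_subsetI)
      fix y assume "y \<in> (\<Union>A\<in>\<M>. face A)"
      then obtain A where A: "A \<in> \<L>" "y \<in> face (insert 0 (Suc ` A))" by (auto simp: \<M>_def)
      note f = face[OF A(2,1)]
      have r: "h' (u y) \<in> espace d" "P (h' (u y))"
        using right[OF _ A(1)] f by blast+
      show "(h' (u y))(d := y 0) \<in> ?X"
        using *[OF r(1)] r(2) f by simp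
    qed
    show "k ` ?X \<subseteq> (\<Union>A\<in>\<M>. face A)"
    proof (rule image_subsetI)
      fix x assume x: "x \<in> ?X"
      then have "h (trunc d x) \<in> (\<Union>A\<in>\<L>. face A)" using bij_betwE[OF bij] by simp
      then obtain A where A: "A \<in> \<L>" "h (trunc d x) \<in> face A" by blast
      have fin: "finite A" using h(2) A(1) by blast
      have "k x \<in> face (insert 0 (Suc ` A))"
        unfolding face_def
      proof (intro CollectI conjI)
        show "\<forall>i\<in>insert 0 (Suc ` A). 0 < k x i" using A(2) x by (auto simp: k_def face_def)
        show "\<forall>i. i \<notin> insert 0 (Suc ` A) \<longrightarrow> k x i = 0"
          using A(2) by (auto simp: k_def face_def split: nat.split)
        show "(\<Sum>i\<in>insert 0 (Suc ` A). k x i) = 1"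
          using A(2) by (simp add: sums[OF fin] k_def face_def sum_distrib_left[symmetric])
      qed
      then show "k x \<in> (\<Union>A\<in>\<M>. face A)" using A(1) by (auto simp: \<M>_def)
    qed
  qed
  moreover have "dt (\<lambda>x. k x i)" for i
  proof -
    have "dt (\<lambda>x. h (trunc d x) i)" for i using dt_subst[OF h(3), of "\<lambda>i x. trunc d x i"] dt_trunc by simp
    then show ?thesis unfolding k_def by (cases i) (simp_all add: dt_intros)
  qed
  moreover have "finite \<M>" "\<forall>A\<in>\<M>. finite A \<and> A \<noteq> {}" using h(1,2) by (auto simp: \<M>_def)
  ultimately show ?thesis unfolding cellular_def by blast
qed

lemma defp_upd_trunc: "defp P \<Longrightarrow> dt \<tau> \<Longrightarrow> defp (\<lambda>x. P ((trunc d x)(d := \<tau> x)))"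
  using defp_subst[of P "\<lambda>i x. ((trunc d x)(d := \<tau> x)) i"]
  using dt_upd[of \<tau> "\<lambda>i x. trunc d x i" _ d] dt_trunc by (auto simp: fun_upd_def)

lemma dt_trunc_comp: "dt \<tau> \<Longrightarrow> dt (\<lambda>x. \<tau> (trunc d x))"
  using dt_subst[of \<tau> "\<lambda>i x. trunc d x i"] dt_trunc by simp

text \<open>Forgetting the last coordinate is a bijection from a graph onto its base, one dimension
  lower.\<close>

lemma cellular_graph:
  assumes IH: "\<And>P. defp P \<Longrightarrow> cellular d P" and P: "defp P" and \<tau>: "dt \<tau>"
  shows "cellular (Suc d) (\<lambda>x. P x \<and> x d = \<tau> (trunc d x))"
proof (rule cellular_bij)
  show "cellular d (\<lambda>x. P ((trunc d x)(d := \<tau> (trunc d x))))"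
    by (intro IH defp_upd_trunc P dt_trunc_comp \<tau>)
  show "dt (\<lambda>x. trunc d x i)" for i by (rule dt_trunc)
  show "bij_betw (trunc d) {x \<in> espace (Suc d). P x \<and> x d = \<tau> (trunc d x)}
     {x \<in> espace d. P ((trunc d x)(d := \<tau> (trunc d x)))}"
  proof (rule bij_betw_byWitness[where f' = "\<lambda>x. x(d := \<tau> x)"])
    have eq: "(trunc d x)(d := x d) = x" if "x \<in> espace (Suc d)" for x
      using that by (auto simp: trunc_def espace_iff fun_eq_iff)
    show "\<forall>x\<in>{x \<in> espace (Suc d). P x \<and> x d = \<tau> (trunc d x)}. (trunc d x)(d := \<tau> (trunc d x)) = x"
      using eq by (metis (mono_tags, lifting) mem_Collect_eq)
    have tr: "trunc d (x(d := s)) = x" if "x \<in> espace d" for x s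
      using that by (auto simp: trunc_def espace_iff fun_eq_iff)
    then show "\<forall>x\<in>{x \<in> espace d. P ((trunc d x)(d := \<tau> (trunc d x)))}. trunc d (x(d := \<tau> x)) = x" by simp
    show "trunc d ` {x \<in> espace (Suc d). P x \<and> x d = \<tau> (trunc d x)} \<subseteq> {x \<in> espace d. P ((trunc d x)(d := \<tau> (trunc d x)))}"
    proof (rule image_subsetI)
      fix x assume x: "x \<in> {x \<in> espace (Suc d). P x \<and> x d = \<tau> (trunc d x)}"
      then have "(trunc d x)(d := \<tau> (trunc d x)) = x" using eq[of x] by simp
      then show "trunc d x \<in> {x \<in> espace d. P ((trunc d x)(d := \<tau> (trunc d x)))}"
        using x by (simp add: trunc_id)
    qed
    show "(\<lambda>x. x(d := \<tau> x)) ` {x \<in> espace d. P ((trunc d x)(d := \<tau> (trunc d x)))} \<subseteq> {x \<in> espace (Suc d). P x \<and> x d = \<tau> (trunc d x)}"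
      using tr by (auto simp: trunc_id espace_iff)
  qed
qed

text \<open>An affine map on each fibre carries the band to a product with the open unit interval,
  the case of \<open>cellular_prod\<close>.\<close>

lemma cellular_band:
  assumes IH: "\<And>P. defp P \<Longrightarrow> cellular d P" and Q: "defp Q" and a: "dt a" and b: "dt b"
  shows "cellular (Suc d) (\<lambda>x. Q (trunc d x) \<and> a (trunc d x) < x d \<and> x d < b (trunc d x))"
proof (rule cellular_bij)
  \<comment> \<open>The base is restricted to nonempty fibres, so that the rescaling divides by a
    positive length.\<close>
  define P where "P y \<longleftrightarrow> Q y \<and> a y < b y" for y
  let ?X = "{x \<in> espace (Suc d). Q (trunc d x) \<and> a (trunc d x) < x d \<and> x d < b (trunc d x)}"
  let ?Y = "{x \<in> espace (Suc d). P (trunc d x) \<and> 0 < x d \<and> x d < 1}"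
  show "cellular (Suc d) (\<lambda>x. P (trunc d x) \<and> 0 < x d \<and> x d < 1)"
    unfolding P_def by (rule cellular_prod[of d "\<lambda>y. Q y \<and> a y < b y"]) (intro IH defp_conj defp_less Q a b)
  define g where "g x = (trunc d x)(d := (x d - a (trunc d x)) / (b (trunc d x) - a (trunc d x)))" for x
  define h where "h x = (trunc d x)(d := a (trunc d x) + x d * (b (trunc d x) - a (trunc d x)))" for x
  have tr: "trunc d (g x) = trunc d x" "trunc d (h x) = trunc d x" for x
    by (auto simp: g_def h_def trunc_def fun_eq_iff)
  have sp: "g x \<in> espace (Suc d)" "h x \<in> espace (Suc d)" for x
    by (auto simp: g_def h_def trunc_def espace_iff)
  have eq: "(trunc d x)(d := s) = x \<longleftrightarrow> s = x d" if "x \<in> espace (Suc d)" for x s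
    using that by (auto simp: trunc_def espace_iff fun_eq_iff)
  show "dt (\<lambda>x. g x i)" for i
    unfolding g_def by (cases "i = d") (auto intro!: dt_intros dt_trunc_comp dt_trunc a b)
  show "bij_betw g ?X ?Y"
  proof (rule bij_betw_byWitness[where f' = h])
    show "\<forall>x\<in>?X. h (g x) = x" by (auto simp: h_def tr eq) (simp add: g_def)
    show "\<forall>x\<in>?Y. g (h x) = x" by (auto simp: g_def tr eq P_def) (simp add: h_def)
    show "g ` ?X \<subseteq> ?Y" using sp by (auto simp: tr P_def) (auto simp: g_def)
    show "h ` ?Y \<subseteq> ?X"
    proof (rule image_subsetI)
      fix x assume x: "x \<in> ?Y"
      define w where "w = b (trunc d x) - a (trunc d x)"
      have "0 < x d * w" "x d * w < 1 * w"
        using x by (auto simp: w_def P_def intro!: mult_strict_right_mono)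
      then show "h x \<in> ?X" using x sp unfolding w_def by (simp add: tr P_def) (simp add: h_def)
    qed
  qed
qed

text \<open>The interval between \<open>a\<close> and \<open>b\<close> is cut successively along functions covering the
  boundary points of the fibres.\<close>

lemma cellular_between:
  assumes IH: "\<And>P. defp P \<Longrightarrow> cellular d P"
    and "finite T" and P: "defp P" and "\<And>\<tau>. \<tau> \<in> T \<Longrightarrow> dt \<tau>" "dt a" "dt b"
    and "\<And>y t. y \<in> espace d \<Longrightarrow> a y < t \<Longrightarrow> t < b y \<Longrightarrow>
      \<not> (\<exists>e. 0 < e \<and> (\<forall>u. t - e < u \<and> u < t + e \<longrightarrow> P (y(d := u)) = P (y(d := t)))) \<Longrightarrow>
      \<exists>\<tau>\<in>T. t = \<tau> y"
  shows "cellular (Suc d) (\<lambda>x. P x \<and> a (trunc d x) < x d \<and> x d < b (trunc d x))"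
  using assms(2,4-)
proof (induction T arbitrary: a b rule: finite_induct)
  case empty
  \<comment> \<open>With no boundary point in between, \<open>P\<close> is constant along each fibre
    and can be tested at the midpoint, a definable function of the base point.\<close>
  define m where "m y = (a y + b y) / 2" for y
  have const: "P (y(d := t)) = P (y(d := m y))" if "y \<in> espace d" "a y < t" "t < b y" for y t
  proof (rule const_on_if_locally_const[where a = "min t (m y)" and b = "max t (m y)" and f = "\<lambda>t. P (y(d := t))"])
    fix s assume s: "s \<in> {min t (m y)..max t (m y)}"
    have "a y < m y" "m y < b y" using that by (auto simp: m_def)
    then have "a y < s" "s < b y" using s that by (auto simp: min_def max_def split: if_splits)
    then show "\<exists>e>0. \<forall>u. s - e < u \<and> u < s + e \<longrightarrow> P (y(d := u)) = P (y(d := s))"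
      using empty.prems(4)[OF that(1), of s] by blast
  qed auto
  have eq: "(trunc d x)(d := x d) = x" if "x \<in> espace (Suc d)" for x
    using that by (auto simp: trunc_def espace_iff fun_eq_iff)
  have "cellular (Suc d) (\<lambda>x. P ((trunc d (trunc d x))(d := m (trunc d x))) \<and> a (trunc d x) < x d \<and> x d < b (trunc d x))"
    unfolding m_def
  proof (rule cellular_band[where Q = "\<lambda>y. P ((trunc d y)(d := (a y + b y) / 2))"])
    show "defp (\<lambda>y. P ((trunc d y)(d := (a y + b y) / 2)))"
      by (intro defp_upd_trunc P dt_intros empty)
  qed (use IH empty in auto)
  also have "cellular (Suc d) (\<lambda>x. P ((trunc d (trunc d x))(d := m (trunc d x))) \<and> a (trunc d x) < x d \<and> x d < b (trunc d x))
    = cellular (Suc d) (\<lambda>x. P x \<and> a (trunc d x) < x d \<and> x d < b (trunc d x))"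
  proof (rule cellular_cong)
    fix x assume x: "x \<in> espace (Suc d)"
    show "(P ((trunc d (trunc d x))(d := m (trunc d x))) \<and> a (trunc d x) < x d \<and> x d < b (trunc d x)) =
      (P x \<and> a (trunc d x) < x d \<and> x d < b (trunc d x))"
      using const[of "trunc d x" "x d"] eq[OF x] by (auto simp: trunc_id)
  qed
  finally show ?case .
next
  case (insert \<tau> T)
  note \<tau> = insert.prems(1)[OF insertI1]
  \<comment> \<open>Clamped at \<open>b\<close> and \<open>a\<close>, because the graph of
    \<open>\<tau>\<close> may leave the band. Where it does, one of the two parts is the whole fibre
    and the other is empty.\<close>
  define b' a' where "b' y = (if \<tau> y < b y then \<tau> y else b y)" and "a' y = (if a y < \<tau> y then \<tau> y else a y)" for y
  have dt: "dt b'" "dt a'" unfolding b'_def a'_def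
    by (intro dt_if defp_less \<tau> insert.prems)+
  have 1: "cellular (Suc d) (\<lambda>x. P x \<and> a (trunc d x) < x d \<and> x d < b' (trunc d x))"
  proof (rule insert.IH)
    fix y t assume *: "y \<in> espace d" "a y < t" "t < b' y"
      "\<not> (\<exists>e>0. \<forall>u. t - e < u \<and> u < t + e \<longrightarrow> P (y(d := u)) = P (y(d := t)))"
    then have "t < b y" "t \<noteq> \<tau> y" by (auto simp: b'_def split: if_splits)
    then show "\<exists>\<tau>\<in>T. t = \<tau> y" using insert.prems(4)[OF *(1,2) _ *(4)] by blast
  qed (use insert.prems dt in auto)
  have 2: "cellular (Suc d) (\<lambda>x. P x \<and> a' (trunc d x) < x d \<and> x d < b (trunc d x))"
  proof (rule insert.IH)
    fix y t assume *: "y \<in> espace d" "a' y < t" "t < b y"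
      "\<not> (\<exists>e>0. \<forall>u. t - e < u \<and> u < t + e \<longrightarrow> P (y(d := u)) = P (y(d := t)))"
    then have "a y < t" "t \<noteq> \<tau> y" by (auto simp: a'_def split: if_splits)
    then show "\<exists>\<tau>\<in>T. t = \<tau> y" using insert.prems(4)[OF *(1) _ *(3,4)] by blast
  qed (use insert.prems dt in auto)
  define R where "R x \<longleftrightarrow> P x \<and> a (trunc d x) < x d \<and> x d < b (trunc d x)" for x
  have R: "defp R" unfolding R_def
    by (intro defp_conj P defp_less dt_intros dt_trunc_comp insert.prems)
  have 3: "cellular (Suc d) (\<lambda>x. R x \<and> x d = \<tau> (trunc d x))"
    by (rule cellular_graph[OF IH R \<tau>])
  have lt: "cellular (Suc d) (\<lambda>x. R x \<and> x d < \<tau> (trunc d x))"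
    using 1 by (rule iffD1[OF cellular_cong, rotated]) (auto simp: R_def b'_def)
  have gt: "cellular (Suc d) (\<lambda>x. R x \<and> \<tau> (trunc d x) < x d)"
    using 2 by (rule iffD1[OF cellular_cong, rotated]) (auto simp: R_def a'_def)
  have "cellular (Suc d) (\<lambda>x. R x \<and> x d < \<tau> (trunc d x) \<or> (R x \<and> x d = \<tau> (trunc d x) \<or> R x \<and> \<tau> (trunc d x) < x d))"
    by (intro cellular_disj lt 3 gt defp_conj R defp_less defp_eq dt_intros dt_trunc_comp \<tau>) auto
  then show ?case by (rule iffD1[OF cellular_cong, rotated]) (auto simp: R_def)
qed

text \<open>\<open>cellular_between\<close> needs terms as bounds on the last coordinate, so the
  line is first compressed to the interval from -1 to 1 by the definable bijection \<open>sq\<close>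
  with inverse \<open>un\<close>. The functions along which it is cut come from uniform finiteness
  of the boundary points.\<close>

lemma cellular_Suc:
  assumes IH: "\<And>P. defp P \<Longrightarrow> cellular d P" and P: "defp P"
  shows "cellular (Suc d) P"
proof (rule cellular_bij)
  define sq where "sq t = (if 0 \<le> t then t / (1 + t) else t / (1 - t))" for t :: real
  define un where "un t = (if 0 \<le> t then t / (1 - t) else t / (1 + t))" for t :: real
  have sq: "un (sq t) = t" "-1 < sq t" "sq t < 1" for t
  proof -
    have "1 - t / (1 + t) = 1 / (1 + t)" if "0 \<le> t" using that by (simp add: field_simps)
    moreover have "1 + t / (1 - t) = 1 / (1 - t)" if "t < 0" using that by (simp add: field_simps)
    ultimately show "un (sq t) = t" by (auto simp: sq_def un_def divide_less_0_iff zero_le_divide_iff)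
    show "-1 < sq t" "sq t < 1" by (auto simp: sq_def field_simps)
  qed
  have un: "sq (un t) = t" if "-1 < t" "t < 1" for t
  proof -
    have "1 + t / (1 - t) = 1 / (1 - t)" "1 - t / (1 + t) = 1 / (1 + t)"
      using that by (simp_all add: field_simps)
    then show ?thesis using that by (auto simp: sq_def un_def divide_less_0_iff zero_le_divide_iff)
  qed
  define g where "g x = x(d := sq (x d))" for x :: "nat \<Rightarrow> real"
  show "dt (\<lambda>x. g x i)" for i
    unfolding g_def sq_def by (cases "i = d") (auto intro!: dt_intros dt_if defp_intros)
  define P' where "P' x \<longleftrightarrow> P (x(d := un (x d)))" for x
  have P': "defp P'" unfolding P'_def un_def
    by (intro defp_update P dt_if defp_intros dt_intros)
  show "bij_betw g {x \<in> espace (Suc d). P x} {x \<in> espace (Suc d). P' x \<and> -1 < x d \<and> x d < 1}"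
  proof (rule bij_betw_byWitness[where f' = "\<lambda>x. x(d := un (x d))"])
    show "g ` {x \<in> espace (Suc d). P x} \<subseteq> {x \<in> espace (Suc d). P' x \<and> - 1 < x d \<and> x d < 1}"
      by (auto simp: g_def P'_def sq espace_iff)
    show "(\<lambda>x. x(d := un (x d))) ` {x \<in> espace (Suc d). P' x \<and> - 1 < x d \<and> x d < 1} \<subseteq> {x \<in> espace (Suc d). P x}"
      by (auto simp: P'_def espace_iff)
  qed (auto simp: g_def sq un)
  define Q where "Q x t \<longleftrightarrow> \<not> (\<exists>e. 0 < e \<and> (\<forall>u. t - e < u \<and> u < t + e \<longrightarrow> P' (x(d := u)) = P' (x(d := t))))" for x t
  have U: "defp2 (\<lambda>x t. P' (x(d := t)))" by (rule defp2_update[OF P'])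
  have Q: "defp2 Q" unfolding Q_def defp2_def
    by (intro defp_intros defp2_subst[OF U] dt_intros)
  have fin: "finite {t. Q x t}" for x
  proof -
    have "finite {s. \<not> eventually (\<lambda>s'. P' (x(d := s')) = P' (x(d := s))) (nhds s)}"
      by (rule tame_not_locally_const[OF defp2_tame[OF U]])
    then show ?thesis unfolding Q_def eventually_nhds_real by simp
  qed
  obtain N where "\<And>x. card {t. Q x t} \<le> N" using uniform_finiteness[OF Q fin] by blast
  from cover_by_terms[OF Q fin this] obtain T where T: "finite T" "\<forall>\<tau>\<in>T. dt \<tau>"
    "\<forall>x t. Q x t \<longrightarrow> (\<exists>\<tau>\<in>T. t = \<tau> x)" by blast
  show "cellular (Suc d) (\<lambda>x. P' x \<and> -1 < x d \<and> x d < 1)"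
  proof (rule cellular_between[OF IH T(1) P', of "\<lambda>_. -1" "\<lambda>_. 1"])
    fix y t assume "\<not> (\<exists>e>0. \<forall>u. t - e < u \<and> u < t + e \<longrightarrow> P' (y(d := u)) = P' (y(d := t)))"
    then have "Q y t" by (simp only: Q_def not_False_eq_True)
    then show "\<exists>\<tau>\<in>T. t = \<tau> y" using T(3) by blast
  qed (use T(2) dt_const in auto)
qed

lemma cellular_defp: "defp P \<Longrightarrow> cellular d P"
proof (induction d arbitrary: P)
  case 0
  have e0: "espace 0 = {\<lambda>_. 0}" by (auto simp: espace_iff fun_eq_iff)
  show ?case
  proof (cases "P (\<lambda>_. 0)")
    case True
    then have "{x \<in> espace 0. P x} = {\<lambda>_. 0}" by (auto simp: e0)
    moreover have "face {0} = {basis_pt 0}"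
      by (auto simp: face_def basis_pt_def fun_eq_iff)
    ultimately have "bij_betw (\<lambda>_. basis_pt 0) {x \<in> espace 0. P x} (\<Union>A\<in>{{0}}. face A)"
      by (simp add: bij_betw_def)
    then show ?thesis unfolding cellular_def using dt_const by (intro exI[of _ "{{0}}"] exI[of _ "\<lambda>_. basis_pt 0"]) simp
  next
    case False
    then show ?thesis using cellular_False by (subst cellular_cong[of 0 P "\<lambda>x. False"]) (auto simp: e0)
  qed
qed (rule cellular_Suc)

lemma has_euler_char_exists:
  assumes X: "X \<in> D d"
  shows "\<exists>e. has_euler_char D d X e"
proof -
  have XX: "{x \<in> espace d. trunc d x \<in> X} = X"
    using subset_space[OF X] by (auto simp: trunc_id)
  obtain \<L> h where h: "finite \<L>" "\<forall>A\<in>\<L>. finite A \<and> A \<noteq> {}" "\<And>i. dt (\<lambda>x. h x i)"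
    "bij_betw h X (\<Union>A\<in>\<L>. face A)"
    using cellular_defp[OF defp_of_definable[OF X], of d] unfolding cellular_def XX by blast
  have "finite (\<Union>\<L>)" using h(1,2) by blast
  then obtain N where N: "\<Union>\<L> \<subseteq> {..<N}" unfolding finite_nat_iff_bounded ..
  have support: "h x i = 0" if "x \<in> X" "i \<ge> N" for x i
  proof -
    have "h x \<in> (\<Union>A\<in>\<L>. face A)" using bij_betwE[OF h(4)] that(1) by blast
    then obtain A where A: "A \<in> \<L>" "h x \<in> face A" by blast
    then have "i \<notin> A" using N that(2) by (meson UnionI lessThan_iff not_less subsetD)
    then show ?thesis using A(2) by (simp add: face_def)
  qed
  define L where "L = (`) basis_pt ` \<L>"
  have "\<L> \<subseteq> {A. A \<subseteq> {..<N} \<and> A \<noteq> {}}" using N h(2) by blast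
  then have "L \<subseteq> basis_complex N" unfolding L_def basis_complex_def by (rule image_mono)
  moreover have "bij_betw h X (\<Union>V\<in>L. open_simplex V)"
    using h(2,4) by (simp add: L_def open_simplex_basis)
  moreover have "definable_map D d N X h"
  proof -
    define S where "S = {z \<in> espace (d + N). trunc d z \<in> X \<and> (\<forall>i<N. z (d + i) = h (trunc d z) i)}"
    have "{append_pt d x (h x) | x. x \<in> X} = S"
    proof (intro equalityI subsetI)
      fix z assume "z \<in> {append_pt d x (h x) | x. x \<in> X}"
      then obtain x where x: "x \<in> X" "z = append_pt d x (h x)" by blast
      have xd: "x \<in> espace d" using x(1) subset_space[OF X] by blast
      have hx: "h x i = 0" if "i \<ge> N" for i by (rule support[OF x(1) that])
      have tr: "trunc d z = x" using xd by (auto simp: x(2) trunc_def append_pt_def espace_iff fun_eq_iff)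
      have "z \<in> espace (d + N)" using xd hx by (auto simp: x(2) append_pt_def espace_iff)
      then show "z \<in> S" unfolding S_def using tr x by (auto simp: append_pt_def)
    next
      fix z assume z: "z \<in> S"
      then have "trunc d z \<in> X" by (simp add: S_def)
      note hx = support[OF this]
      have "z = append_pt d (trunc d z) (h (trunc d z))"
      proof
        fix i
        show "z i = append_pt d (trunc d z) (h (trunc d z)) i"
        proof (cases "i < d")
          case False
          then obtain k where k: "i = d + k" using le_Suc_ex not_less by blast
          show ?thesis using z hx[of k] by (cases "k < N") (auto simp: S_def k append_pt_def espace_iff)
        qed (simp add: append_pt_def)
      qed
      then show "z \<in> {append_pt d x (h x) | x. x \<in> X}" using z unfolding S_def by blast
    qed
    moreover have "S \<in> D (d + N)" unfolding S_def
      by (intro definable_Collect defp_conj defp_of_definable[OF X] defp_all_less defp_eq dt_var dt_trunc_comp h(3))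
    ultimately show ?thesis by (simp add: definable_map_def)
  qed
  ultimately show ?thesis unfolding has_euler_char_def using finite_basis_complex
    by (intro exI[of _ "\<Sum>V\<in>L. (- 1) ^ (card V - 1)"] exI[of _ N] exI[of _ "basis_complex N"]
        exI[of _ L] exI[of _ h]) simp
qed

lemma euler_char_eq_chi:
  assumes "X \<in> D d"
  shows "euler_char D d X = chi d (\<lambda>x. trunc d x \<in> X)"
  unfolding euler_char_def
proof (rule the_equality)
  obtain e where "has_euler_char D d X e" using has_euler_char_exists[OF assms] by blast
  then show "has_euler_char D d X (chi d (\<lambda>x. trunc d x \<in> X))"
    using has_euler_char_eq_chi[OF assms] by metis
  show "e = chi d (\<lambda>x. trunc d x \<in> X)" if "has_euler_char D d X e" for e
    using has_euler_char_eq_chi[OF assms that] .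
qed

end

section \<open>Inversion of the transform\<close>

text \<open>The contribution of compactness to injectivity: in a fixed direction some sublevel set
  is all of \<open>M\<close>, so the transform determines the Euler characteristic of
  \<open>M\<close> itself.\<close>

lemma bounded_coordinate:
  assumes "compactin (Euclidean_space d) M"
  obtains T where "\<And>x. x \<in> M \<Longrightarrow> x 0 \<le> T"
proof -
  have "continuous_map (Euclidean_space d) euclideanreal (\<lambda>x. x 0)"
    unfolding Euclidean_space_def
    by (intro continuous_map_from_subtopology continuous_map_product_projection) simp
  then have "compactin euclideanreal ((\<lambda>x. x 0) ` M)"
    using assms by (rule image_compactin[rotated])
  then have "bdd_above ((\<lambda>x. x 0) ` M)"
    by (simp add: compact_imp_bounded bounded_imp_bdd_above)
  then show thesis using that by (auto simp: bdd_above_def)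
qed

lemma times_line_usphere_iff:
  "p \<in> Defs.times_line d (usphere d) \<longleftrightarrow> p \<in> espace (Suc d) \<and> (\<Sum>i<d. p i * p i) = 1"
proof
  assume "p \<in> Defs.times_line d (usphere d)"
  then obtain x t where "p = x(d := t)" "x \<in> usphere d" by (auto simp: Defs.times_line_def)
  then show "p \<in> espace (Suc d) \<and> (\<Sum>i<d. p i * p i) = 1"
    by (auto simp: usphere_def espace_iff power2_eq_square)
next
  assume p: "p \<in> espace (Suc d) \<and> (\<Sum>i<d. p i * p i) = 1"
  then have "p(d := 0) \<in> usphere d" by (auto simp: usphere_def espace_iff power2_eq_square)
  moreover have "p = (p(d := 0))(d := p d)" by simp
  ultimately show "p \<in> Defs.times_line d (usphere d)" unfolding Defs.times_line_def by blast
qed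

context o_minimal_structure
begin

lemma Is_base:
  assumes "\<And>z z'. (\<And>i. i \<in> S \<union> set js \<Longrightarrow> z i = z' i) \<Longrightarrow> F z = F z'" "\<And>i. i \<in> S \<Longrightarrow> x i = y i"
  shows "Is js F x = Is js F y"
  using assms
proof (induction js arbitrary: S x y)
  case Nil
  have "F x = F y" by (rule Nil.prems(1), rule Nil.prems(2)) simp
  then show ?case by simp
next
  case (Cons j js)
  have "Is js F (x(j := t)) = Is js F (y(j := t))" for t
  proof (rule Cons.IH[of "insert j S"])
    show "F z = F z'" if "\<And>i. i \<in> insert j S \<union> set js \<Longrightarrow> z i = z' i" for z z'
    proof (rule Cons.prems(1))
      show "z i = z' i" if i: "i \<in> S \<union> set (j # js)" for i
        by (rule \<open>\<And>i. i \<in> insert j S \<union> set js \<Longrightarrow> z i = z' i\<close>) (use i in simp)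
    qed
    show "(x(j := t)) i = (y(j := t)) i" if "i \<in> insert j S" for i
      using Cons.prems(2)[of i] that by (cases "i = j") simp_all
  qed
  then show ?case by (simp add: I_def)
qed

lemma Is_block:
  assumes G: "\<And>x y. (\<And>i. i < n \<Longrightarrow> x i = y i) \<Longrightarrow> G x = G y"
    and F: "\<And>z. (\<And>i. i \<notin> {k..<k+n} \<Longrightarrow> z i = p i) \<Longrightarrow> F z \<longleftrightarrow> G (\<lambda>i. z (i + k))"
  shows "Is [k..<k+n] (\<lambda>z. of_bool (F z)) p = chi n G"
proof -
  have shift: "[k..<k+n] = map (\<lambda>i. i + k) [0..<n]"
    by (simp add: map_add_upt add.commute)
  have "Is [k..<k+n] (\<lambda>z. of_bool (F z)) p = Is [k..<k+n] (\<lambda>z. of_bool (G (\<lambda>i. z (i + k)))) p"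
    by (rule Is_cong) (use F in simp)
  also have "\<dots> = Is (map (\<lambda>i. i + k) [0..<n]) (\<lambda>z. of_bool (G (\<lambda>i. z (i + k)))) p"
    by (simp only: shift)
  also have "Is (map (\<lambda>i. i + k) [0..<n]) (\<lambda>z. of_bool (G (\<lambda>i. z (i + k)))) p
      = Is [0..<n] (\<lambda>z. of_bool (G z)) (\<lambda>i. p (i + k))"
    by (rule Is_rename[of "\<lambda>i. i + k" _ "\<lambda>x. of_bool (G x)"]) (simp add: inj_on_def)
  also have "\<dots> = chi n G"
    unfolding chi_def
  proof (rule Is_base[of "{}"])
    fix z z' :: "nat \<Rightarrow> real" assume "\<And>i. i \<in> {} \<union> set [0..<n] \<Longrightarrow> z i = z' i"
    then have "G z = G z'" by (intro G) auto
    then show "of_bool (G z) = (of_bool (G z') :: int)" by simp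
  qed auto
  finally show ?thesis .
qed

lemma ECT_eq_chi:
  assumes "M \<in> D d"
  shows "ECT D d M v t = chi d (\<lambda>x. trunc d x \<in> M \<and> (\<Sum>i<d. x i * v i) \<le> t)"
proof -
  have "{x \<in> espace d. (\<Sum>i<d. x i * v i) \<le> t} \<in> D d"
    by (intro definable_Collect defp_le dt_sum dt_intros) simp
  then have "M \<inter> {x \<in> espace d. (\<Sum>i<d. x i * v i) \<le> t} \<in> D d" by (rule inter[OF assms])
  moreover have "(\<lambda>x. trunc d x \<in> M \<inter> {x \<in> espace d. (\<Sum>i<d. x i * v i) \<le> t}) =
      (\<lambda>x. trunc d x \<in> M \<and> (\<Sum>i<d. x i * v i) \<le> t)"
    by (auto simp: fun_eq_iff)
  ultimately show ?thesis unfolding ECT_def by (simp add: euler_char_eq_chi)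
qed

lemma trunc_cong: "(\<And>i. i < n \<Longrightarrow> x i = y i) \<Longrightarrow> trunc n x = trunc n y"
  by (auto simp: trunc_def fun_eq_iff)

text \<open>The transform is a parametric integral: direction and level occupy the coordinates from
  0 to \<open>d\<close>, the point of \<open>M\<close> the next \<open>d\<close>, and integrating
  the latter out preserves constructibility.\<close>

lemma ECT_fun_constructible:
  assumes M: "M \<in> D d"
  shows "ECT_fun D d M \<in> constructible_functions D (Suc d) (Defs.times_line d (usphere d))"
proof -
  define H where "H z \<longleftrightarrow> trunc d (\<lambda>i. z (i + Suc d)) \<in> M \<and> (\<Sum>i<d. z (i + Suc d) * z i) \<le> z d" for z
  define F where "F = Is [Suc d..<Suc d + d] (\<lambda>z. of_bool (H z))"
  have "defp H"
    unfolding H_def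
    by (intro defp_conj defp_rename[OF defp_of_definable[OF M], of "\<lambda>i. i + Suc d"] defp_le dt_sum dt_intros) simp
  then have F: "CF F" unfolding F_def by (intro CF_Is CF_of_bool)
  have F_eq: "F p = ECT D d M (p(d := 0)) (p d)" for p
    unfolding F_def ECT_eq_chi[OF M]
  proof (rule Is_block)
    fix x y :: "nat \<Rightarrow> real" assume "\<And>i. i < d \<Longrightarrow> x i = y i"
    then show "(trunc d x \<in> M \<and> (\<Sum>i<d. x i * (p(d := 0)) i) \<le> p d) =
        (trunc d y \<in> M \<and> (\<Sum>i<d. y i * (p(d := 0)) i) \<le> p d)"
      using trunc_cong[of d x y] by simp
  next
    fix z assume z: "\<And>i. i \<notin> {Suc d..<Suc d + d} \<Longrightarrow> z i = p i"
    then have "z d = p d" "\<And>i. i < d \<Longrightarrow> z i = p i" by auto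
    then show "H z = (trunc d (\<lambda>i. z (i + Suc d)) \<in> M \<and> (\<Sum>i<d. z (i + Suc d) * (p(d := 0)) i) \<le> p d)"
      by (simp add: H_def)
  qed
  define X where "X = Defs.times_line d (usphere d)"
  have val: "ECT_fun D d M p = F p" if "p \<in> X" for p
    using that by (simp add: ECT_fun_def X_def F_eq)
  have "{p \<in> X. ECT_fun D d M p = c} \<in> D (Suc d)" for c
  proof -
    have "{p \<in> X. ECT_fun D d M p = c} = {p \<in> espace (Suc d). (\<Sum>i<d. p i * p i) = 1 \<and> F p = c}"
      using val by (auto simp: X_def times_line_usphere_iff)
    then show ?thesis
      by (simp only:) (intro definable_Collect defp_conj defp_eq dt_sum dt_intros defp_CF_eq[OF F], simp)
  qed
  moreover have "finite {c. {p \<in> X. ECT_fun D d M p = c} \<noteq> {}}"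
  proof (rule finite_subset)
    show "{c. {p \<in> X. ECT_fun D d M p = c} \<noteq> {}} \<subseteq> range F" using val by auto
    show "finite (range F)" using F by (simp add: CF_def)
  qed
  moreover have "ECT_fun D d M \<in> extensional X" by (simp add: ECT_fun_def X_def)
  ultimately show ?thesis unfolding constructible_functions_def X_def by simp
qed

text \<open>A line in a coordinate direction with nonzero coefficient meets the half-space in a
  closed ray, and closed rays integrate to 0.\<close>

lemma Is_closed_halfspace:
  assumes a: "j < d" "a j \<noteq> 0"
  shows "Is [d..<d+d] (\<lambda>z. of_bool ((\<Sum>i<d. a i * z (i + d)) \<le> 0)) x = 0"
proof -
  let ?F = "\<lambda>z. of_bool ((\<Sum>i<d. a i * z (i + d)) \<le> 0) :: int"
  have F: "CF ?F" by (intro CF_of_bool defp_le dt_sum dt_intros) simp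
  \<comment> \<open>The last entry of the list is the innermost integration, so the chosen
    coordinate is moved to the end.\<close>
  have "Is [d..<d+d] ?F = Is (remove1 (j + d) [d..<d+d] @ [j + d]) ?F"
    using a by (intro Is_permute[OF F]) (auto simp: distinct_remove1)
  moreover have "I (j + d) ?F = (\<lambda>z. 0)"
  proof
    fix z
    define r where "r = (\<Sum>i\<in>{..<d} - {j}. a i * z (i + d))"
    have "(\<Sum>i<d. a i * (z(j + d := t)) (i + d)) = a j * t + r" for t
    proof -
      have "(\<Sum>i<d. a i * (z(j + d := t)) (i + d)) = a j * t + (\<Sum>i\<in>{..<d} - {j}. a i * (z(j + d := t)) (i + d))"
        using a(1) by (subst sum.remove[of _ j]) auto
      also have "(\<Sum>i\<in>{..<d} - {j}. a i * (z(j + d := t)) (i + d)) = r"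
        unfolding r_def by (rule sum.cong) auto
      finally show ?thesis .
    qed
    then have "I (j + d) ?F z = Eint (\<lambda>t. of_bool (a j * t + r \<le> 0))" by (simp add: I_def)
    also have "\<dots> = 0"
    proof (cases "a j > 0")
      case True
      then have "(\<lambda>t. of_bool (a j * t + r \<le> 0) :: int) = (\<lambda>t. of_bool (t \<le> - r / a j))"
        by (auto simp: fun_eq_iff field_simps)
      then show ?thesis by (simp only: Eint_atMost)
    next
      case False
      then have "(\<lambda>t. of_bool (a j * t + r \<le> 0) :: int) = (\<lambda>t. of_bool (- r / a j \<le> t))"
        using a(2) by (auto simp: fun_eq_iff field_simps)
      then show ?thesis by (simp only: Eint_atLeast)
    qed
    finally show "I (j + d) ?F z = 0" .
  qed
  ultimately show ?thesis by (simp add: Is_append Is_zero)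
qed

lemma Is_one: "Is js (\<lambda>z. 1) = (\<lambda>z. (- 1) ^ length js)"
  by (induction js) (auto simp: I_def)

text \<open>For \<open>y \<noteq> x\<close> the vectors \<open>v\<close> with \<open>(y - x) \<bullet> v \<le> 0\<close> form a closed half-space, which
  has Euler characteristic \<open>0\<close>, so that integrating over all \<open>v\<close> only the point \<open>y = x\<close> contributes.\<close>

lemma halfspace_inversion:
  assumes M: "M \<in> D d" and x: "x \<in> espace d"
  shows "Is [d..<d+d] (\<lambda>z. chi d (\<lambda>y. trunc d y \<in> M \<and> (\<Sum>i<d. (y i - x i) * z (i + d)) \<le> 0)) (\<lambda>_. 0)
     = (- 1) ^ d * of_bool (x \<in> M)"
proof -
  define H where "H z \<longleftrightarrow> trunc d z \<in> M \<and> (\<Sum>i<d. (z i - x i) * z (i + d)) \<le> 0" for z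
  have H: "defp H"
    unfolding H_def by (intro defp_conj defp_of_definable[OF M] defp_le dt_sum dt_intros) simp
  have 1: "Is [0..<d] (\<lambda>z. of_bool (H z)) =
      (\<lambda>z. chi d (\<lambda>y. trunc d y \<in> M \<and> (\<Sum>i<d. (y i - x i) * z (i + d)) \<le> 0))"
  proof
    fix z
    have "Is [0..<0+d] (\<lambda>z. of_bool (H z)) z =
        chi d (\<lambda>y. trunc d y \<in> M \<and> (\<Sum>i<d. (y i - x i) * z (i + d)) \<le> 0)"
    proof (rule Is_block)
      fix y y' :: "nat \<Rightarrow> real" assume "\<And>i. i < d \<Longrightarrow> y i = y' i"
      then show "(trunc d y \<in> M \<and> (\<Sum>i<d. (y i - x i) * z (i + d)) \<le> 0) =
          (trunc d y' \<in> M \<and> (\<Sum>i<d. (y' i - x i) * z (i + d)) \<le> 0)"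
        using trunc_cong[of d y y'] by simp
    next
      fix w assume "\<And>i. i \<notin> {0..<0 + d} \<Longrightarrow> w i = z i"
      then have "\<And>i. w (i + d) = z (i + d)" by simp
      then show "H w = (trunc d (\<lambda>i. w (i + 0)) \<in> M \<and> (\<Sum>i<d. (w (i + 0) - x i) * z (i + d)) \<le> 0)"
        by (simp add: H_def)
    qed
    then show "Is [0..<d] (\<lambda>z. of_bool (H z)) z =
        chi d (\<lambda>y. trunc d y \<in> M \<and> (\<Sum>i<d. (y i - x i) * z (i + d)) \<le> 0)" by simp
  qed
  have 2: "Is [d..<d+d] (\<lambda>z. of_bool (H z)) =
      (\<lambda>z. (- 1) ^ d * of_bool (x \<in> M \<and> (\<forall>j\<in>set [0..<d]. z j = x j)))"
  proof
    fix z
    have step: "Is [d..<d+d] (\<lambda>z. of_bool (H z)) z =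
       Is [d..<d+d] (\<lambda>w. of_bool (trunc d z \<in> M \<and> (\<Sum>i<d. (z i - x i) * w (i + d)) \<le> 0)) z"
    proof (rule Is_cong)
      fix w :: "nat \<Rightarrow> real" assume w: "\<And>i. i \<notin> set [d..<d+d] \<Longrightarrow> w i = z i"
      have *: "w i = z i" if "i < d" for i using w that by simp
      then have "trunc d w = trunc d z" by (rule trunc_cong)
      with * show "of_bool (H w) = (of_bool (trunc d z \<in> M \<and> (\<Sum>i<d. (z i - x i) * w (i + d)) \<le> 0) :: int)"
        by (simp add: H_def)
    qed
    show "Is [d..<d+d] (\<lambda>z. of_bool (H z)) z = (- 1) ^ d * of_bool (x \<in> M \<and> (\<forall>j\<in>set [0..<d]. z j = x j))"
    proof (cases "\<forall>j\<in>set [0..<d]. z j = x j")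
      case True
      then have "trunc d z = trunc d x" by (intro trunc_cong) auto
      then have "trunc d z = x" using x by (simp add: trunc_id)
      moreover have "(\<Sum>i<d. (z i - x i) * w (i + d)) = 0" for w :: "nat \<Rightarrow> real"
        using True by (intro sum.neutral) auto
      \<comment> \<open>For \<open>y = x\<close> every vector satisfies the condition, and the
        constant 1 integrates to -1 in each of the \<open>d\<close> coordinates.\<close>
      ultimately show ?thesis unfolding step using True by (cases "x \<in> M") (simp_all add: Is_one Is_zero)
    next
      case False
      then obtain j where j: "j < d" "z j - x j \<noteq> 0" by auto
      have "Is [d..<d+d] (\<lambda>w. of_bool (trunc d z \<in> M \<and> (\<Sum>i<d. (z i - x i) * w (i + d)) \<le> 0)) z = 0"
        using Is_closed_halfspace[of j d "\<lambda>i. z i - x i", OF j] by (cases "trunc d z \<in> M") (simp_all add: Is_zero)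
      then show ?thesis unfolding step using False by simp
    qed
  qed
  have "Is ([d..<d+d] @ [0..<d]) (\<lambda>z. of_bool (H z)) = Is ([0..<d] @ [d..<d+d]) (\<lambda>z. of_bool (H z))"
    using H by (intro Is_permute CF_of_bool) auto
  then have "Is [d..<d+d] (Is [0..<d] (\<lambda>z. of_bool (H z))) (\<lambda>_. 0) =
      Is [0..<d] (Is [d..<d+d] (\<lambda>z. of_bool (H z))) (\<lambda>_. 0)"
    unfolding Is_append by (rule fun_cong)
  also have "\<dots> = (- 1) ^ d * Is [0..<d] (\<lambda>z. of_bool (x \<in> M \<and> (\<forall>j\<in>set [0..<d]. z j = x j))) (\<lambda>_. 0)"
    unfolding 2
    by (intro fun_cong[OF Is_cmult] CF_of_bool defp_conj defp_const defp_ball_finite defp_eq dt_intros) simp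
  also have "Is [0..<d] (\<lambda>z. of_bool (x \<in> M \<and> (\<forall>j\<in>set [0..<d]. z j = x j))) (\<lambda>_. 0) = of_bool (x \<in> M)"
    by (rule Is_single) auto
  finally show ?thesis unfolding 1 .
qed

text \<open>\<open>halfspace_inversion\<close> uses half-spaces for all vectors \<open>w\<close>,
  the transform only unit vectors. A nonzero \<open>w\<close> is normalised, which leaves its
  half-space unchanged. For \<open>w = 0\<close> the half-space is the whole space, and it is
  replaced by one that contains both sets.\<close>

lemma ECT_injective:
  assumes d: "d \<ge> 1" and M: "M \<in> constructible_sets D d" and M': "M' \<in> constructible_sets D d"
    and eq: "\<And>v. v \<in> usphere d \<Longrightarrow> ECT D d M v = ECT D d M' v"
  shows "M = M'"
proof -
  have MD: "M \<in> D d" "M' \<in> D d" using M M' by (auto simp: constructible_sets_def)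
  obtain T where T: "\<And>x. x \<in> M \<Longrightarrow> x 0 \<le> T"
    using M bounded_coordinate[of d M] by (auto simp: constructible_sets_def)
  obtain T' where T': "\<And>x. x \<in> M' \<Longrightarrow> x 0 \<le> T'"
    using M' bounded_coordinate[of d M'] by (auto simp: constructible_sets_def)
  \<comment> \<open>One level for both sets, so that the transforms are compared at the same
    argument.\<close>
  define S where "S = max T T'"
  have S: "x 0 \<le> S" if "x \<in> M \<or> x \<in> M'" for x using T[of x] T'[of x] that by (auto simp: S_def)
  have half: "chi d (\<lambda>y. trunc d y \<in> M \<and> (\<Sum>i<d. (y i - x i) * w i) \<le> 0) =
      chi d (\<lambda>y. trunc d y \<in> M' \<and> (\<Sum>i<d. (y i - x i) * w i) \<le> 0)" for x w :: "nat \<Rightarrow> real"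
  proof (cases "\<forall>i<d. w i = 0")
    case True
    \<comment> \<open>Any unit vector would do; the first basis vector is one because
      \<open>d \<ge> 1\<close>.\<close>
    define v where "v = basis_pt 0"
    have sum: "(\<Sum>i<d. y i * v i) = y 0" for y
    proof -
      have "(\<Sum>i<d. y i * v i) = (\<Sum>i<d. if i = 0 then y i else 0)"
        by (rule sum.cong) (auto simp: v_def basis_pt_def)
      then show ?thesis using d by simp
    qed
    have "(\<Sum>i<d. (v i)\<^sup>2) = 1" using sum[of v] by (simp add: power2_eq_square) (simp add: v_def basis_pt_def)
    then have v: "v \<in> usphere d" using d by (auto simp: usphere_def espace_iff v_def basis_pt_def)
    have *: "(\<lambda>y. trunc d y \<in> N \<and> (\<Sum>i<d. (y i - x i) * w i) \<le> 0) = (\<lambda>y. trunc d y \<in> N \<and> (\<Sum>i<d. y i * v i) \<le> S)"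
      if "N = M \<or> N = M'" for N
    proof
      fix y
      have "trunc d y \<in> N \<Longrightarrow> y 0 \<le> S" using S[of "trunc d y"] d that by (auto simp: trunc_def)
      then show "(trunc d y \<in> N \<and> (\<Sum>i<d. (y i - x i) * w i) \<le> 0) = (trunc d y \<in> N \<and> (\<Sum>i<d. y i * v i) \<le> S)"
        using True by (auto simp: sum)
    qed
    show ?thesis
      using fun_cong[OF eq[OF v], of S] *[of M] *[of M'] by (simp add: ECT_eq_chi MD)
  next
    case False
    define n where "n = sqrt (\<Sum>i<d. (w i)\<^sup>2)"
    obtain k where k: "k < d" "w k \<noteq> 0" using False by blast
    have "0 < (\<Sum>i<d. (w i)\<^sup>2)" using k by (intro sum_pos2[of _ k]) auto
    then have n: "0 < n" "n\<^sup>2 = (\<Sum>i<d. (w i)\<^sup>2)" by (auto simp: n_def)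
    define v where "v i = (if i < d then w i / n else 0)" for i
    define t where "t = (\<Sum>i<d. x i * v i)"
    have "(\<Sum>i<d. (v i)\<^sup>2) = (\<Sum>i<d. (w i)\<^sup>2) / n\<^sup>2"
      unfolding sum_divide_distrib by (rule sum.cong) (auto simp: v_def power_divide)
    moreover have "n\<^sup>2 \<noteq> 0" using n(1) by simp
    ultimately have "(\<Sum>i<d. (v i)\<^sup>2) = 1" by (metis n(2) divide_self)
    then have v: "v \<in> usphere d" by (auto simp: usphere_def espace_iff v_def)
    have "(\<Sum>i<d. (y i - x i) * w i) \<le> 0 \<longleftrightarrow> (\<Sum>i<d. y i * v i) \<le> t" for y
    proof -
      have "(\<Sum>i<d. (y i - x i) * w i) = n * ((\<Sum>i<d. y i * v i) - t)"
        unfolding t_def sum_subtractf[symmetric] sum_distrib_left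
        using n(1) by (intro sum.cong) (auto simp: v_def field_simps)
      then show ?thesis using n(1) by (simp add: mult_le_0_iff)
    qed
    then show ?thesis using fun_cong[OF eq[OF v], of t] by (simp add: ECT_eq_chi MD)
  qed
  have "x \<in> M \<longleftrightarrow> x \<in> M'" if x: "x \<in> espace d" for x
  proof -
    have "(- 1) ^ d * (of_bool (x \<in> M) :: int) = (- 1) ^ d * of_bool (x \<in> M')"
      unfolding halfspace_inversion[OF MD(1) x, symmetric] halfspace_inversion[OF MD(2) x, symmetric] half ..
    then show ?thesis by (auto simp: of_bool_def split: if_splits)
  qed
  then show ?thesis using subset_space[OF MD(1)] subset_space[OF MD(2)] by blast
qed

end

theorem theorem3p5:
  fixes D :: "nat \<Rightarrow> (nat \<Rightarrow> real) set set" and d :: nat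
  assumes "o_minimal_structure D" and "d \<ge> 1"
  shows "ECT_fun D d \<in> constructible_sets D d \<rightarrow>
           constructible_functions D (Suc d) (times_line d (usphere d)) \<and>
         inj_on (ECT_fun D d) (constructible_sets D d) \<and>
         (\<forall>M \<in> constructible_sets D d. \<forall>M' \<in> constructible_sets D d.
            (\<forall>v \<in> usphere d. ECT D d M v = ECT D d M' v) \<longrightarrow> M = M')"
proof (intro conjI funcsetI inj_onI ballI impI)
  interpret o_minimal_structure D by fact
  fix M assume M: "M \<in> constructible_sets D d"
  show "ECT_fun D d M \<in> constructible_functions D (Suc d) (Defs.times_line d (usphere d))"
    using M by (intro ECT_fun_constructible) (simp add: constructible_sets_def)
  fix M' assume M': "M' \<in> constructible_sets D d"
  show "M = M'" if eq: "\<forall>v \<in> usphere d. ECT D d M v = ECT D d M' v"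
    using ECT_injective[OF assms(2) M M'] eq by blast
  show "M = M'" if eq: "ECT_fun D d M = ECT_fun D d M'"
  proof (rule ECT_injective[OF assms(2) M M'], rule ext)
    fix v t assume v: "v \<in> usphere d"
    have "v(d := t) \<in> Defs.times_line d (usphere d)" unfolding Defs.times_line_def using v by blast
    moreover have "(v(d := t))(d := 0) = v" using v by (auto simp: usphere_def espace_iff)
    ultimately show "ECT D d M v t = ECT D d M' v t"
      using fun_cong[OF eq, of "v(d := t)"] by (simp add: ECT_fun_def)
  qed
qed

end
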